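(* Let $\psi:(0,\infty)\to(0,\infty)$ be a non-decreasing function such that $\sum_{k=1}^{\infty}\frac{1}{\psi(k)}=\infty$. Then for Lebesgue-almost every $\alpha\in\mathbb{R}$, the set \[\{N\in\mathbb{N}:\ \log P_N(\alpha)\le -\psi(\log N)\}\] has upper density $1$.
   Context: For $\alpha\in\mathbb{R}$ and $N\in\mathbb{N}$, the Sudler product is $P_N(\alpha):=\prod_{r=1}^{N}\lvert 2\sin(\pi r\alpha)\rvert$. The upper density of a set $A\subseteq\mathbb{N}$ is $\limsup_{M\to\infty}\frac{\#(A\cap\{1,\dots,M\})}{M}$. *)

theory Defs
  imports "HOL-Analysis.Analysis" "HOL-Library.Liminf_Limsup"
begin

definition sudler :: "nat \<Rightarrow> real \<Rightarrow> real" where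
  "sudler N \<alpha> = (\<Prod>r=1..N. \<bar>2 * sin (pi * real r * \<alpha>)\<bar>)"

definition upper_density :: "nat set \<Rightarrow> ereal" where
  "upper_density A = limsup (\<lambda>M. ereal (real (card (A \<inter> {1..M})) / real M))"

end

theory Submission
  imports Defs "HOL-Real_Asymp.Real_Asymp"
begin

text \<open>
  Suppose \<open>\<bar>\<alpha> - p/q\<bar> \<le> 1/(q\<^sup>2 A)\<close> with \<open>p/q\<close> reduced and \<open>A\<close> large. Since \<open>\<Prod>\<^sub>i \<bar>2 sin(\<pi>ip/q)\<bar> = q\<close>
  over \<open>0 < i < q\<close>, every complete block of \<open>q\<close> consecutive factors of \<open>P\<^sub>N(\<alpha>)\<close> with \<open>N \<le> qA/32\<close> is at most
  \<open>1/2\<close>, and the incomplete last block is at most \<open>e q P\<^sub>r(p/q)\<close> with \<open>r = N mod q\<close>. So \<open>log P\<^sub>N(\<alpha>)\<close> is below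
  a negative multiple of \<open>A\<close> for most \<open>N \<le> qA/32\<close>, provided \<open>log P\<^sub>r(p/q) = O(log q)\<close> for most \<open>r < q\<close>;
  call \<open>p/q\<close> good in this case.

  A majorant of \<open>log \<bar>2 sin(\<pi>x)\<bar>\<close> with Fourier coefficients \<open>O(1/h)\<close> and Parseval over \<open>r mod q\<close> bound the
  variance of \<open>log P\<^sub>r(p/q)\<close> by \<open>\<Sum>\<^sub>h 1/(h \<parallel>hp/q\<parallel>)\<^sup>2\<close>. For most \<open>\<alpha>\<close> the corresponding sum over
  \<open>h < Q\<close> is \<open>O(log\<^sup>2 Q)\<close>, and it controls the one at the Dirichlet approximation of \<open>\<alpha>\<close>; hence a
  positive proportion of the reduced fractions with denominator about \<open>Q = 8\<^sup>k\<close> is good.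

  Reduced fractions are well separated, so the neighbourhoods of radius \<open>1/(64\<^sup>k A\<^sub>k)\<close> of the good fractions
  are quasi-independent in \<open>k\<close>. Take \<open>A\<^sub>k\<close> to be a large multiple of \<open>max(\<psi>(5k), 5k)\<close>; the sum of the
  \<open>1/A\<^sub>k\<close> diverges, even over those \<open>k\<close> with \<open>\<psi>(5k) \<le> k\<^sup>2\<close>. A second moment argument gives a limsup set
  occupying a fixed proportion of every interval, with a constant independent of the implied constants
  above, and this forces full measure.
\<close>

section \<open>Trigonometry at rational points\<close>

definition int_dist :: "real \<Rightarrow> real" where
  "int_dist x = \<bar>x - of_int (round x)\<bar>"

lemma int_dist_le: "int_dist x \<le> \<bar>x - of_int m\<bar>"
  unfolding int_dist_def by (rule round_diff_minimal)

lemma int_dist_add_le: "int_dist (x + y) \<le> int_dist x + \<bar>y\<bar>"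
  using int_dist_le[of "x + y" "round x"] by (simp add: int_dist_def)

text \<open>Jordan's inequality: sine is concave on [0, pi/2], hence lies above its chord.\<close>

lemma sin_ge_two_div_pi:
  fixes y :: real
  assumes "0 \<le> y" "y \<le> pi / 2"
  shows "2 / pi * y \<le> sin y"
proof -
  have "convex_on {0..pi/2} (\<lambda>x::real. - sin x)"
    by (rule f''_ge0_imp_convex[where f'="\<lambda>x. - cos x" and f''="\<lambda>x. sin x"])
       (auto intro!: derivative_eq_intros sin_ge_zero)
  from convex_onD[OF this, of "2 / pi * y" 0 "pi / 2"] assms
  show ?thesis by (auto simp: field_simps)
qed

text \<open>Subtracting the nearest integer changes only the sign of the sine and brings the
  argument into [-pi/2, pi/2], where Jordan's inequality applies.\<close>

lemma abs_sin_pi_ge: "2 * int_dist x \<le> \<bar>sin (pi * x)\<bar>"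
proof -
  let ?m = "round x"
  let ?y = "x - of_int ?m"
  have "sin (pi * x) = sin (pi * ?y + pi * of_int ?m)"
    by (simp add: algebra_simps)
  also have "\<bar>\<dots>\<bar> = \<bar>sin (pi * ?y)\<bar>"
    by (simp only: sin_add) (simp add: abs_mult)
  finally have eq: "\<bar>sin (pi * x)\<bar> = \<bar>sin (pi * ?y)\<bar>" .
  have "\<bar>?y\<bar> \<le> 1 / 2"
    using of_int_round_abs_le[of x] by (simp add: abs_minus_commute)
  then have "2 / pi * (pi * \<bar>?y\<bar>) \<le> sin (pi * \<bar>?y\<bar>)"
    by (intro sin_ge_two_div_pi) (auto simp: field_simps)
  also have "\<dots> \<le> \<bar>sin (pi * ?y)\<bar>"
    by (smt (verit) mult_minus_right sin_minus)
  finally show ?thesis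
    unfolding eq int_dist_def by simp
qed

text \<open>For every integer m the numerator of ip/q - m is a nonzero integer, because q does not
  divide ip.\<close>

lemma int_dist_fraction_ge:
  fixes p :: int and q i :: nat
  assumes "coprime p (int q)" "q > 0" "\<not> q dvd i"
  shows "1 / real q \<le> int_dist (real i * real_of_int p / real q)"
proof -
  define m where "m = round (real i * real_of_int p / real q)"
  have "int i * p - m * int q \<noteq> 0"
  proof
    assume "int i * p - m * int q = 0"
    then have "int q dvd int i * p"
      by (metis dvd_triv_right eq_iff_diff_eq_0)
    then have "int q dvd int i"
      using assms(1) by (simp add: coprime_dvd_mult_left_iff coprime_commute)
    then show False using assms(3) by simp
  qed
  then have "1 \<le> \<bar>int i * p - m * int q\<bar>" by linarith
  then have "1 \<le> \<bar>real_of_int (int i * p - m * int q)\<bar>" by linarith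
  then have "1 / real q \<le> \<bar>real_of_int (int i * p - m * int q)\<bar> / real q"
    using assms(2) by (simp add: divide_right_mono)
  also have "\<dots> = \<bar>real i * real_of_int p / real q - real_of_int m\<bar>"
  proof -
    have "real_of_int (int i * p - m * int q) / real q = real i * real_of_int p / real q - real_of_int m"
      using assms(2) by (simp add: field_simps)
    then show ?thesis by (metis abs_divide abs_of_nat)
  qed
  finally show ?thesis by (simp add: int_dist_def m_def)
qed

lemma abs_sin_fraction_ge:
  fixes p :: int and q i :: nat
  assumes "coprime p (int q)" "q > 0" "\<not> q dvd i"
  shows "2 / real q \<le> \<bar>sin (pi * (real i * real_of_int p / real q))\<bar>"
  using int_dist_fraction_ge[OF assms] abs_sin_pi_ge[of "real i * real_of_int p / real q"]
  by simp

section \<open>Roots of unity and the product over the nonzero residues\<close>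

lemma norm_one_minus_cis: "norm (1 - cis (2 * x)) = \<bar>2 * sin x\<bar>"
proof -
  have "(norm (1 - cis (2 * x)))\<^sup>2 = (1 - cos (2 * x))\<^sup>2 + (sin (2 * x))\<^sup>2"
    by (simp add: cmod_power2)
  also have "\<dots> = 2 - 2 * cos (2 * x)"
    using sin_cos_squared_add[of "2 * x"] by (simp add: power2_eq_square algebra_simps)
  also have "\<dots> = (2 * sin x)\<^sup>2"
    by (simp add: cos_double_sin power2_eq_square)
  finally show ?thesis
    by (metis abs_norm_cancel power2_eq_iff_nonneg abs_ge_zero power2_abs norm_ge_zero)
qed

lemma cis_fraction_eq_1_iff:
  fixes p :: int and q :: nat and i :: int
  assumes "coprime p (int q)" "q > 0"
  shows "cis (2 * pi * (of_int i * of_int p / real q)) = 1 \<longleftrightarrow> int q dvd i"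
proof
  assume "int q dvd i"
  then obtain j where "i = int q * j" by auto
  then have "cis (2 * pi * (of_int i * of_int p / real q)) = cis (2 * pi * of_int (j * p))"
    using assms(2) by (simp add: field_simps)
  also have "\<dots> = 1" by (rule cis_multiple_2pi) simp
  finally show "cis (2 * pi * (of_int i * of_int p / real q)) = 1" .
next
  assume "cis (2 * pi * (of_int i * of_int p / real q)) = 1"
  then have "cos (2 * pi * (of_int i * of_int p / real q)) = 1"
    by (simp add: complex_eq_iff)
  then obtain m :: int where "2 * pi * (of_int i * of_int p / real q) = of_int m * 2 * pi"
    unfolding cos_one_2pi_int by blast
  then have "of_int i * of_int p = of_int m * real q"
    using assms(2) by (simp add: field_simps)
  then have "i * p = m * int q"
    by (metis of_int_eq_iff of_int_mult of_int_of_nat_eq)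
  then have "int q dvd i * p" by simp
  then show "int q dvd i"
    using assms(1) by (simp add: coprime_dvd_mult_left_iff coprime_commute)
qed

text \<open>The factors come from the nontrivial q-th roots of unity w. The product of all X - w is
  1 + X + ... + X^(q-1), and X = 1 gives q.\<close>

lemma prod_roots_of_unity_shift:
  fixes p :: int and q :: nat
  assumes "coprime p (int q)" "q > 0"
  shows "(\<Prod>i\<in>{1..<q}. 1 - cis (2 * pi * (real i * of_int p / real q))) = of_nat q"
proof -
  define w where "w i = cis (2 * pi * (real i * of_int p / real q))" for i :: nat
  have inj: "inj_on w {..<q}"
  proof (rule inj_onI)
    fix i j assume ij: "i \<in> {..<q}" "j \<in> {..<q}" "w i = w j"
    have "cis (2 * pi * (of_int (int i - int j) * of_int p / real q)) = w i / w j"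
      by (simp add: w_def cis_divide algebra_simps diff_divide_distrib)
    then have "int q dvd int i - int j"
      using ij(3) cis_fraction_eq_1_iff[OF assms, of "int i - int j"] by (simp add: w_def)
    moreover have "\<bar>int i - int j\<bar> < int q" using ij by auto
    ultimately show "i = j"
      by (metis dvd_imp_le_int abs_of_nat eq_iff_diff_eq_0 int_int_eq not_le)
  qed
  define g :: "complex poly" where "g = (\<Sum>i<q. monom 1 i)"
  have gval: "poly g x * (x - 1) = x ^ q - 1" for x
    by (simp add: g_def poly_sum poly_monom power_diff_1_eq mult.commute)
  have wq: "w i ^ q = 1" for i
  proof -
    have "w i ^ q = cis (2 * pi * of_int (int i * p))"
      using assms(2) by (simp add: w_def Complex.DeMoivre field_simps)
    then show ?thesis by simp
  qed
  have root: "poly g (w i) = 0" if "i \<in> {1..<q}" for i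
  proof -
    have "w i \<noteq> w 0" using inj_onD[OF inj, of i 0] that by auto
    then have "w i - 1 \<noteq> 0" by (simp add: w_def)
    moreover have "poly g (w i) * (w i - 1) = 0" by (simp add: gval wq)
    ultimately show ?thesis by simp
  qed
  have deg: "degree g \<le> q - 1"
    unfolding g_def by (intro degree_sum_le) (auto intro: order.trans[OF degree_monom_le])
  have cf: "coeff g (q - 1) = 1"
    using assms(2) by (simp add: g_def coeff_sum)
  define h where "h = (\<Prod>i\<in>{1..<q}. [:- w i, 1:])"
  have degh: "degree h = q - 1"
    unfolding h_def by (subst degree_prod_sum_eq) auto
  have lch: "coeff h (q - 1) = 1"
    using degh lead_coeff_prod[of "\<lambda>i. [:- w i, 1:]" "{1..<q}"] by (simp add: h_def)
  \<comment> \<open>A nonzero \<open>g - h\<close> would vanish at q - 1 distinct points and so have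
    degree q - 1, yet its coefficient there cancels: it is 1 in both polynomials.\<close>
  have "g = h"
  proof (rule ccontr)
    assume "g \<noteq> h"
    then have nz: "g - h \<noteq> 0" by simp
    have "w ` {1..<q} \<subseteq> {x. poly (g - h) x = 0}"
      using root by (force simp: h_def poly_prod)
    then have "card (w ` {1..<q}) \<le> card {x. poly (g - h) x = 0}"
      by (intro card_mono poly_roots_finite nz)
    also have "\<dots> \<le> degree (g - h)" by (rule card_poly_roots_bound[OF nz])
    finally have "q - 1 \<le> degree (g - h)"
      using inj by (subst (asm) card_image) (auto intro: inj_on_subset)
    moreover have "degree (g - h) \<le> q - 1"
      using degree_diff_le_max[of g h] deg degh by simp
    ultimately have "degree (g - h) = q - 1" by simp
    then have "coeff (g - h) (q - 1) \<noteq> 0" using nz by (metis leading_coeff_neq_0)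
    then show False using cf lch by simp
  qed
  then have "poly h 1 = poly g 1" by simp
  also have "\<dots> = of_nat q" by (simp add: g_def poly_sum poly_monom)
  finally show ?thesis
    by (simp add: h_def poly_prod w_def)
qed

lemma prod_abs_sin_fraction:
  fixes p :: int and q :: nat
  assumes "coprime p (int q)" "q > 0"
  shows "(\<Prod>i\<in>{1..<q}. \<bar>2 * sin (pi * (real i * of_int p / real q))\<bar>) = real q"
proof -
  have "(\<Prod>i\<in>{1..<q}. \<bar>2 * sin (pi * (real i * of_int p / real q))\<bar>)
      = norm (\<Prod>i\<in>{1..<q}. 1 - cis (2 * pi * (real i * of_int p / real q)))"
    by (simp only: norm_one_minus_cis[symmetric] prod_norm mult.assoc)
  also have "\<dots> = real q"
    unfolding prod_roots_of_unity_shift[OF assms] by simp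
  finally show ?thesis .
qed

section \<open>Harmonic bounds for sums over the nonzero residues\<close>

lemma harm_le_one_plus_ln:
  assumes "n > 0"
  shows "(\<Sum>i=1..n. 1 / real i) \<le> 1 + ln (real n)"
proof -
  obtain m where n: "n = Suc m" using assms by (cases n) auto
  have "harm (Suc m) - ln (real (Suc m)) \<le> harm (Suc 0) - ln (real (Suc 0))"
    using decseqD[OF decseq_harm_diff_ln, of 0 m] by simp
  then show ?thesis by (simp add: n harm_def inverse_eq_divide)
qed

lemma bij_betw_mult_mod:
  fixes p :: int and q :: nat
  assumes "coprime p (int q)" "q > 0"
  shows "bij_betw (\<lambda>i. nat ((int i * p) mod int q)) {1..<q} {1..<q}"
proof -
  let ?f = "\<lambda>i. nat ((int i * p) mod int q)"
  have "inj_on ?f {1..<q}"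
  proof (rule inj_onI)
    fix i j assume ij: "i \<in> {1..<q}" "j \<in> {1..<q}" "?f i = ?f j"
    then have "(int i * p) mod int q = (int j * p) mod int q"
      using assms(2) by (simp add: nat_eq_iff)
    then have "int q dvd (int i - int j) * p"
      by (simp add: mod_eq_dvd_iff left_diff_distrib)
    then have "int q dvd int i - int j"
      using assms(1) by (simp add: coprime_dvd_mult_left_iff coprime_commute)
    moreover have "\<bar>int i - int j\<bar> < int q" using ij by auto
    ultimately show "i = j"
      by (metis dvd_imp_le_int abs_of_nat eq_iff_diff_eq_0 int_int_eq not_le)
  qed
  moreover have "?f ` {1..<q} \<subseteq> {1..<q}"
  proof clarify
    fix i assume i: "i \<in> {1..<q}"
    have "(int i * p) mod int q \<noteq> 0"
    proof
      assume "(int i * p) mod int q = 0"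
      then have "int q dvd int i * p" by (rule mod_0_imp_dvd)
      then have "int q dvd int i"
        using assms(1) by (simp add: coprime_dvd_mult_left_iff coprime_commute)
      then show False using i by (auto dest: dvd_imp_le)
    qed
    moreover have "0 \<le> (int i * p) mod int q" "(int i * p) mod int q < int q"
      using assms(2) by auto
    ultimately show "?f i \<in> {1..<q}" by auto
  qed
  ultimately show ?thesis
    unfolding bij_betw_def using endo_inj_surj[of "{1..<q}" ?f] by blast
qed

lemma abs_sin_pi_frac_mod:
  fixes n :: int and q :: nat
  assumes "q > 0"
  shows "\<bar>sin (pi * (of_int (n mod int q) / real q))\<bar> = \<bar>sin (pi * (of_int n / real q))\<bar>"
proof -
  have "real_of_int n = of_int (n mod int q) + real q * of_int (n div int q)"
    by (metis mod_mult_div_eq of_int_add of_int_mult of_int_of_nat_eq)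
  then have "pi * (of_int n / real q) = pi * (of_int (n mod int q) / real q) + pi * of_int (n div int q)"
    using assms by (simp add: field_simps)
  then have "sin (pi * (of_int n / real q)) = sin (pi * (of_int (n mod int q) / real q)) * cos (pi * of_int (n div int q))"
    by (simp only: sin_add) simp
  then show ?thesis
    by (simp add: abs_mult)
qed

text \<open>Multiplication by p permutes the nonzero residues, which reduces the sum to p = 1.
  Jordan's inequality from either end of [0, pi] then bounds it by two equal harmonic sums.\<close>

lemma sum_inverse_sin_fraction_le:
  fixes p :: int and q :: nat
  assumes "coprime p (int q)" "q > 0"
  shows "(\<Sum>i\<in>{1..<q}. 1 / \<bar>sin (pi * (real i * of_int p / real q))\<bar>) \<le> real q * (1 + ln (real q))"
proof -
  define g where "g j = 1 / \<bar>sin (pi * (real j / real q))\<bar>" for j :: nat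
  have "(\<Sum>i\<in>{1..<q}. 1 / \<bar>sin (pi * (real i * of_int p / real q))\<bar>)
      = (\<Sum>i\<in>{1..<q}. g (nat ((int i * p) mod int q)))"
  proof (rule sum.cong[OF refl])
    fix i :: nat
    have "real (nat ((int i * p) mod int q)) = of_int ((int i * p) mod int q)"
      using assms(2) by simp
    then show "1 / \<bar>sin (pi * (real i * of_int p / real q))\<bar> = g (nat ((int i * p) mod int q))"
      using abs_sin_pi_frac_mod[OF assms(2), of "int i * p"] by (simp add: g_def)
  qed
  also have "\<dots> = (\<Sum>j\<in>{1..<q}. g j)"
    by (rule sum.reindex_bij_betw[OF bij_betw_mult_mod[OF assms]])
  also have "\<dots> \<le> (\<Sum>j\<in>{1..<q}. real q / 2 * (1 / real j + 1 / real (q - j)))"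
  proof (rule sum_mono)
    fix j assume j: "j \<in> {1..<q}"
    have s: "2 * (min (real j) (real (q - j)) / real q) \<le> sin (pi * (real j / real q))"
    proof (cases "2 * j \<le> q")
      case True
      have "2 / pi * (pi * (real j / real q)) \<le> sin (pi * (real j / real q))"
        using True assms(2) by (intro sin_ge_two_div_pi) (auto simp: field_simps)
      moreover have "min (real j) (real (q - j)) = real j" using True by auto
      ultimately show ?thesis by simp
    next
      case False
      have "2 / pi * (pi * (real (q - j) / real q)) \<le> sin (pi * (real (q - j) / real q))"
        using False assms(2) j by (intro sin_ge_two_div_pi) (auto simp: field_simps of_nat_diff)
      moreover have "pi * (real (q - j) / real q) = pi - pi * (real j / real q)"
        using j assms(2) by (simp add: field_simps of_nat_diff)
      moreover have "min (real j) (real (q - j)) = real (q - j)" using False by auto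
      ultimately show ?thesis by simp
    qed
    define m where "m = min (real j) (real (q - j))"
    have m: "m > 0" using j by (simp add: m_def)
    have "g j \<le> 1 / (2 * (m / real q))"
    proof -
      have "0 < 2 * (m / real q)" using m assms(2) by simp
      moreover have "2 * (m / real q) \<le> \<bar>sin (pi * (real j / real q))\<bar>"
        using s by (simp add: m_def)
      ultimately show ?thesis unfolding g_def by (intro frac_le) auto
    qed
    also have "\<dots> = real q / 2 * (1 / m)" using assms(2) m by (simp add: field_simps)
    also have "1 / m \<le> 1 / real j + 1 / real (q - j)"
      unfolding m_def min_def by auto
    finally show "g j \<le> real q / 2 * (1 / real j + 1 / real (q - j))"
      by (simp add: mult_left_mono)
  qed
  also have "\<dots> = real q / 2 * ((\<Sum>j\<in>{1..<q}. 1 / real j) + (\<Sum>j\<in>{1..<q}. 1 / real (q - j)))"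
    by (simp add: sum_distrib_left sum.distrib distrib_left)
  also have "(\<Sum>j\<in>{1..<q}. 1 / real (q - j)) = (\<Sum>j\<in>{1..<q}. 1 / real j)"
    by (rule sum.reindex_bij_witness[where i="\<lambda>j. q - j" and j="\<lambda>j. q - j"]) auto
  also have "real q / 2 * ((\<Sum>j\<in>{1..<q}. 1 / real j) + (\<Sum>j\<in>{1..<q}. 1 / real j))
      = real q * (\<Sum>j\<in>{1..<q}. 1 / real j)" by simp
  also have "(\<Sum>j\<in>{1..<q}. 1 / real j) \<le> (\<Sum>j=1..q. 1 / real j)"
    by (rule sum_mono2) auto
  also have "\<dots> \<le> 1 + ln (real q)" by (rule harm_le_one_plus_ln[OF assms(2)])
  finally show ?thesis by (simp add: mult_left_mono)
qed

text \<open>From sin(u + v) = sin u (cos v + cot u sin v) and 1 + y \<le> exp y. The hypotheses make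
  the bracket nonnegative. The cotangent keeps its sign in the exponent, so that it can cancel over
  a complete block.\<close>

lemma abs_sin_add_le:
  fixes u v :: real
  assumes "sin u \<noteq> 0" "\<bar>cot u * sin v\<bar> \<le> 1 / 2" "1 / 2 \<le> cos v"
  shows "\<bar>sin (u + v)\<bar> \<le> \<bar>sin u\<bar> * exp (cot u * sin v)"
proof -
  have "sin (u + v) = sin u * (cos v + cot u * sin v)"
    using assms(1) by (simp add: sin_add cot_def field_simps)
  moreover have "0 \<le> cos v + cot u * sin v" using assms by (auto simp: abs_le_iff)
  ultimately have "\<bar>sin (u + v)\<bar> = \<bar>sin u\<bar> * (cos v + cot u * sin v)"
    by (simp add: abs_mult)
  also have "cos v + cot u * sin v \<le> exp (cot u * sin v)"
    using exp_ge_add_one_self[of "cot u * sin v"] cos_le_one[of v] by linarith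
  finally show ?thesis by (simp add: mult_left_mono)
qed

lemma abs_cot_le: "\<bar>cot u\<bar> \<le> 1 / \<bar>sin u\<bar>" for u :: real
  by (simp add: cot_def abs_divide divide_right_mono)

text \<open>The involution i -> q - i reverses the sign of each cotangent.\<close>

lemma sum_cot_fraction:
  fixes p :: int and q :: nat
  assumes "q > 0"
  shows "(\<Sum>i\<in>{1..<q}. cot (pi * (real i * of_int p / real q))) = 0"
proof -
  let ?f = "\<lambda>i::nat. cot (pi * (real i * of_int p / real q))"
  have "(\<Sum>i\<in>{1..<q}. ?f i) = (\<Sum>i\<in>{1..<q}. ?f (q - i))"
    by (rule sum.reindex_bij_witness[where i="\<lambda>j. q - j" and j="\<lambda>j. q - j"]) auto
  also have "\<dots> = (\<Sum>i\<in>{1..<q}. - ?f i)"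
  proof (rule sum.cong[OF refl])
    fix i assume "i \<in> {1..<q}"
    then have eq: "pi * (real (q - i) * of_int p / real q) = pi * of_int p - pi * (real i * of_int p / real q)"
      using assms by (simp add: of_nat_diff field_simps)
    show "?f (q - i) = - ?f i"
      unfolding eq by (simp add: cot_def sin_diff cos_diff)
  qed
  also have "\<dots> = - (\<Sum>i\<in>{1..<q}. ?f i)" by (simp add: sum_negf)
  finally show ?thesis by simp
qed


section \<open>Sudler products near a fraction\<close>

lemma abs_sin_pi_add_int:
  fixes x :: real and m :: int
  shows "\<bar>sin (pi * (x + of_int m))\<bar> = \<bar>sin (pi * x)\<bar>"
  by (simp only: distrib_left sin_add) (simp add: abs_mult)

lemma abs_sin_diff_le: "\<bar>sin a - sin b\<bar> \<le> \<bar>a - b\<bar>" for a b :: real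
proof -
  have "\<bar>sin a - sin b\<bar> = 2 * (\<bar>sin ((a - b) / 2)\<bar> * \<bar>cos ((a + b) / 2)\<bar>)"
    by (simp add: sin_diff_sin abs_mult)
  also have "\<dots> \<le> 2 * (\<bar>(a - b) / 2\<bar> * 1)"
    by (intro mult_left_mono mult_mono abs_sin_x_le_abs_x) auto
  finally show ?thesis by simp
qed

text \<open>\<open>A\<close> measures the quality of the approximation relative to 1/q^2. Its lower
  bound is calibrated so that the exponent pi (1 + ln q) / A collected over a complete block is at
  most pi/5 < ln 2.\<close>

locale near_fraction =
  fixes p :: int and q :: nat and \<alpha> A :: real
  assumes cop: "coprime p (int q)" and q_pos: "q > 0"
    and A_ge: "A \<ge> 5 * (1 + ln (real q))"
    and close: "\<bar>\<alpha> - of_int p / real q\<bar> \<le> 1 / (real q ^ 2 * A)"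
begin

definition \<delta> where "\<delta> = \<alpha> - of_int p / real q"

lemma A_pos: "A > 0"
  using A_ge q_pos ln_ge_zero[of "real q"]
  by (smt (verit) of_nat_0_less_iff real_of_nat_ge_one_iff less_eq_Suc_le One_nat_def)

lemma abs_delta_le: "\<bar>\<delta>\<bar> \<le> 1 / (real q ^ 2 * A)"
  using close by (simp add: \<delta>_def)

text \<open>In this range of n the accumulated drift n \<delta> stays well below 1/q, the distance
  of the nonzero residues from the integers.\<close>

lemma n_delta_le:
  assumes "real n \<le> real q * A / 32"
  shows "real n * \<bar>\<delta>\<bar> \<le> 1 / (32 * real q)"
proof -
  have "real n * \<bar>\<delta>\<bar> \<le> (real q * A / 32) * (1 / (real q ^ 2 * A))"
    using assms abs_delta_le by (intro mult_mono) auto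
  also have "\<dots> = 1 / (32 * real q)"
    using A_pos q_pos by (simp add: field_simps power2_eq_square)
  finally show ?thesis .
qed

text \<open>Modulo 1, the point (jq + i) \<alpha> is ip/q shifted by (jq + i) \<delta>. Since |cot
  u| \<le> q/2 and the shift is at most 1/(32 q), the exponent is small enough for
  \<open>abs_sin_add_le\<close>.\<close>

lemma term_le:
  assumes "\<not> q dvd i" and n: "real (j * q + i) \<le> real q * A / 32"
  defines "u \<equiv> pi * (real i * of_int p / real q)"
  shows "\<bar>2 * sin (pi * real (j * q + i) * \<alpha>)\<bar>
     \<le> \<bar>2 * sin u\<bar> * exp (cot u * sin (pi * real (j * q + i) * \<delta>))"
proof -
  define v where "v = pi * real (j * q + i) * \<delta>"
  have "pi * real (j * q + i) * \<alpha> = pi * (real i * of_int p / real q + real (j * q + i) * \<delta> + of_int (int j * p))"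
    using q_pos by (simp add: \<delta>_def field_simps)
  then have "\<bar>sin (pi * real (j * q + i) * \<alpha>)\<bar> = \<bar>sin (u + v)\<bar>"
    using abs_sin_pi_add_int[of "real i * of_int p / real q + real (j * q + i) * \<delta>" "int j * p"]
    by (simp only:) (simp add: u_def v_def algebra_simps)
  moreover have "\<bar>sin (u + v)\<bar> \<le> \<bar>sin u\<bar> * exp (cot u * sin v)"
  proof (rule abs_sin_add_le)
    have s: "2 / real q \<le> \<bar>sin u\<bar>"
      unfolding u_def by (rule abs_sin_fraction_ge[OF cop q_pos assms(1)])
    then show "sin u \<noteq> 0" using q_pos by auto
    have "\<bar>v\<bar> = pi * (real (j * q + i) * \<bar>\<delta>\<bar>)" by (simp add: v_def abs_mult)
    also have "\<dots> \<le> pi * (1 / (32 * real q))"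
      using n_delta_le[OF n] by (intro mult_left_mono) auto
    finally have v: "\<bar>v\<bar> \<le> pi / (32 * real q)" by simp
    have pi4: "pi < 4" by (rule pi_less_4)
    have "\<bar>cot u\<bar> \<le> 1 / (2 / real q)"
      using order.trans[OF abs_cot_le[of u] frac_le[of 1 1 "2 / real q" "\<bar>sin u\<bar>"]] s q_pos by simp
    then have "\<bar>cot u\<bar> * \<bar>sin v\<bar> \<le> (real q / 2) * (pi / (32 * real q))"
      using v abs_sin_x_le_abs_x[of v] by (intro mult_mono) auto
    also have "\<dots> \<le> 1 / 2" using q_pos pi4 by simp
    finally show "\<bar>cot u * sin v\<bar> \<le> 1 / 2" by (simp add: abs_mult)
    have "pi / (32 * real q) \<le> pi / 3" using q_pos by (intro divide_left_mono) auto
    then have "\<bar>v\<bar> \<le> pi / 3" using v by linarith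
    then have "cos (pi / 3) \<le> cos \<bar>v\<bar>" by (intro cos_monotone_0_pi_le) auto
    then show "1 / 2 \<le> cos v" by (simp add: cos_60)
  qed
  ultimately show ?thesis by (simp add: abs_mult v_def)
qed

lemma sum_abs_cot_le:
  assumes "I \<subseteq> {1..<q}"
  shows "(\<Sum>i\<in>I. \<bar>cot (pi * (real i * of_int p / real q))\<bar>) \<le> real q * (1 + ln (real q))"
proof -
  have "(\<Sum>i\<in>I. \<bar>cot (pi * (real i * of_int p / real q))\<bar>)
     \<le> (\<Sum>i\<in>{1..<q}. \<bar>cot (pi * (real i * of_int p / real q))\<bar>)"
    using assms by (intro sum_mono2) auto
  also have "\<dots> \<le> (\<Sum>i\<in>{1..<q}. 1 / \<bar>sin (pi * (real i * of_int p / real q))\<bar>)"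
    by (intro sum_mono abs_cot_le)
  finally show ?thesis using sum_inverse_sin_fraction_le[OF cop q_pos] by simp
qed

text \<open>The q - 1 unperturbed factors multiply to q, the perturbation costs at most a factor 2,
  and the factor at the multiple of q is at most pi/(16 q). Altogether this is at most pi/8.\<close>

lemma full_block:
  assumes n: "real (j * q + q) \<le> real q * A / 32"
  shows "(\<Prod>n\<in>{j*q+1..<j*q+1+q}. \<bar>2 * sin (pi * real n * \<alpha>)\<bar>) \<le> 1 / 2"
proof -
  let ?g = "\<lambda>n::nat. \<bar>2 * sin (pi * real n * \<alpha>)\<bar>"
  let ?u = "\<lambda>i::nat. pi * (real i * of_int p / real q)"
  let ?v = "\<lambda>i::nat. pi * real (j * q + i) * \<delta>"
  have block: "{j*q+1..<j*q+1+q} = insert (j*q+q) ((\<lambda>i. j*q+i) ` {1..<q})"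
    
  proof (intro equalityI subsetI)
    fix n assume "n \<in> {j*q+1..<j*q+1+q}"
    then show "n \<in> insert (j*q+q) ((\<lambda>i. j*q+i) ` {1..<q})"
      by (cases "n = j*q+q") (auto intro!: image_eqI[of _ _ "n - j*q"])
  qed (use q_pos in auto)
  have "(\<Prod>n\<in>{j*q+1..<j*q+1+q}. ?g n) = ?g (j*q+q) * (\<Prod>i\<in>{1..<q}. ?g (j*q+i))"
  proof -
    have "(\<Prod>n\<in>insert (j*q+q) ((\<lambda>i. j*q+i) ` {1..<q}). ?g n) = ?g (j*q+q) * (\<Prod>n\<in>(\<lambda>i. j*q+i) ` {1..<q}. ?g n)"
      by (rule prod.insert) auto
    also have "(\<Prod>n\<in>(\<lambda>i. j*q+i) ` {1..<q}. ?g n) = (\<Prod>i\<in>{1..<q}. ?g (j*q+i))"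
      by (subst prod.reindex) (auto simp: inj_on_def)
    finally show ?thesis by (simp only: block)
  qed
  also have "(\<Prod>i\<in>{1..<q}. ?g (j*q+i)) \<le> (\<Prod>i\<in>{1..<q}. \<bar>2 * sin (?u i)\<bar> * exp (cot (?u i) * sin (?v i)))"
  proof (rule prod_mono)
    fix i assume i: "i \<in> {1..<q}"
    then have "\<not> q dvd i" by (auto dest: dvd_imp_le)
    moreover have "real (j * q + i) \<le> real (j * q + q)" using i by (simp only: of_nat_le_iff) auto
    with n have "real (j * q + i) \<le> real q * A / 32" by linarith
    ultimately show "0 \<le> ?g (j*q+i) \<and> ?g (j*q+i) \<le> \<bar>2 * sin (?u i)\<bar> * exp (cot (?u i) * sin (?v i))"
      using term_le by auto
  qed
  also have "\<dots> = real q * exp (\<Sum>i\<in>{1..<q}. cot (?u i) * sin (?v i))"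
    using prod_abs_sin_fraction[OF cop q_pos] by (simp add: prod.distrib exp_sum)
  \<comment> \<open>Since the cotangents sum to 0, the value at the start of the block may be
    subtracted. Only the drift inside one block remains, of size pi q |\<delta>| instead of pi n
    |\<delta>|.\<close>
  also have "(\<Sum>i\<in>{1..<q}. cot (?u i) * sin (?v i))
      = (\<Sum>i\<in>{1..<q}. cot (?u i) * (sin (?v i) - sin (?v 0)))"
    using sum_cot_fraction[OF q_pos, of p]
    by (simp add: right_diff_distrib sum_subtractf flip: sum_distrib_right)
  also have "\<dots> \<le> (\<Sum>i\<in>{1..<q}. \<bar>cot (?u i)\<bar> * (pi * real q * \<bar>\<delta>\<bar>))"
  proof (rule sum_mono)
    fix i assume i: "i \<in> {1..<q}"
    have "\<bar>sin (?v i) - sin (?v 0)\<bar> \<le> \<bar>?v i - ?v 0\<bar>"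
      by (rule abs_sin_diff_le)
    also have "?v i - ?v 0 = pi * real i * \<delta>" by (simp add: algebra_simps)
    also have "\<bar>pi * real i * \<delta>\<bar> \<le> pi * real q * \<bar>\<delta>\<bar>"
      using i by (auto simp: abs_mult intro!: mult_right_mono)
    finally have "\<bar>cot (?u i)\<bar> * \<bar>sin (?v i) - sin (?v 0)\<bar> \<le> \<bar>cot (?u i)\<bar> * (pi * real q * \<bar>\<delta>\<bar>)"
      by (intro mult_left_mono) auto
    then show "cot (?u i) * (sin (?v i) - sin (?v 0)) \<le> \<bar>cot (?u i)\<bar> * (pi * real q * \<bar>\<delta>\<bar>)"
      unfolding abs_mult[symmetric] by (rule order.trans[OF abs_ge_self])
  qed
  also have "\<dots> = (\<Sum>i\<in>{1..<q}. \<bar>cot (?u i)\<bar>) * (pi * real q * \<bar>\<delta>\<bar>)"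
    by (simp add: sum_distrib_right)
  also have "\<dots> \<le> (real q * (1 + ln (real q))) * (pi * real q * (1 / (real q ^ 2 * A)))"
    using abs_delta_le sum_abs_cot_le[of "{1..<q}"] q_pos
    by (intro mult_mono) (auto intro!: sum_nonneg)
  also have "\<dots> = pi * ((1 + ln (real q)) / A)"
    using q_pos A_pos by (simp add: field_simps power2_eq_square)
  also have "\<dots> \<le> pi * (1 / 5)"
    using A_ge A_pos by (intro mult_left_mono) (auto simp: field_simps)
  also have "\<dots> \<le> ln 2"
    using pi_approx ln2_ge_two_thirds by auto
  finally have "(\<Prod>n\<in>{j*q+1..<j*q+1+q}. ?g n) \<le> ?g (j*q+q) * (real q * exp (ln 2))"
    by (simp add: mult_left_mono)
  \<comment> \<open>Without perturbation this factor is 0, so its size is governed by the drift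
    alone. Its 1/q cancels the q of the complete product.\<close>
  also have "?g (j*q+q) \<le> 2 * (pi * (1 / (32 * real q)))"
  proof -
    have "pi * real (j*q+q) * \<alpha> = pi * (real (j*q+q) * \<delta> + of_int (int (Suc j) * p))"
      using q_pos by (simp add: \<delta>_def field_simps)
    then have "\<bar>sin (pi * real (j*q+q) * \<alpha>)\<bar> = \<bar>sin (pi * (real (j*q+q) * \<delta>))\<bar>"
      using abs_sin_pi_add_int[of "real (j*q+q) * \<delta>" "int (Suc j) * p"] by (simp only:)
    also have "\<dots> \<le> \<bar>pi * (real (j*q+q) * \<delta>)\<bar>" by (rule abs_sin_x_le_abs_x)
    also have "\<dots> = pi * (real (j*q+q) * \<bar>\<delta>\<bar>)" by (simp add: abs_mult)
    also have "\<dots> \<le> pi * (1 / (32 * real q))"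
      using n_delta_le[OF n] by (intro mult_left_mono) auto
    finally show ?thesis by (simp add: abs_mult)
  qed
  then have "?g (j*q+q) * (real q * exp (ln 2)) \<le> 2 * (pi * (1 / (32 * real q))) * (real q * 2)"
    by (intro mult_mono) auto
  also have "\<dots> = pi / 8" using q_pos by simp
  also have "\<dots> \<le> 1 / 2" using pi_less_4 by simp
  finally show ?thesis .
qed

lemma full_blocks:
  assumes "real (b * q) \<le> real q * A / 32"
  shows "sudler (b * q) \<alpha> \<le> (1 / 2) ^ b"
  using assms
proof (induction b)
  case 0
  then show ?case by (simp add: sudler_def)
next
  case (Suc b)
  have "real (b * q) \<le> real (Suc b * q)" by (simp only: of_nat_le_iff) simp
  then have IH: "sudler (b * q) \<alpha> \<le> (1 / 2) ^ b" using Suc by linarith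
  have eq: "{1..Suc b * q} = {1..b*q} \<union> {b*q+1..<b*q+1+q}" by auto
  have "sudler (Suc b * q) \<alpha> = sudler (b*q) \<alpha> * (\<Prod>n\<in>{b*q+1..<b*q+1+q}. \<bar>2 * sin (pi * real n * \<alpha>)\<bar>)"
    unfolding sudler_def eq by (rule prod.union_disjoint) auto
  also have "\<dots> \<le> (1 / 2) ^ b * (1 / 2)"
  proof (intro mult_mono full_block IH prod_nonneg)
    show "real (b * q + q) \<le> real q * A / 32" using Suc.prems by (simp add: add.commute)
  qed auto
  finally show ?case by simp
qed

text \<open>Over an incomplete block the cotangents need not cancel, so they are bounded in absolute
  value. The exponent is then at most 1 + ln q, which accounts for the factor e q.\<close>

lemma partial_block:
  assumes "r < q" "real (b * q + r) \<le> real q * A / 32"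
  shows "(\<Prod>n\<in>{b*q+1..b*q+r}. \<bar>2 * sin (pi * real n * \<alpha>)\<bar>)
     \<le> sudler r (of_int p / real q) * (exp 1 * real q)"
proof -
  let ?g = "\<lambda>n::nat. \<bar>2 * sin (pi * real n * \<alpha>)\<bar>"
  let ?u = "\<lambda>i::nat. pi * (real i * of_int p / real q)"
  let ?v = "\<lambda>i::nat. pi * real (b * q + i) * \<delta>"
  have "(\<Prod>n\<in>{b*q+1..b*q+r}. ?g n) = (\<Prod>i\<in>{1..r}. ?g (b*q+i))"
    by (rule prod.reindex_bij_witness[where i="\<lambda>i. b*q + i" and j="\<lambda>n. n - b*q"]) auto
  also have "\<dots> \<le> (\<Prod>i\<in>{1..r}. \<bar>2 * sin (?u i)\<bar> * exp (cot (?u i) * sin (?v i)))"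
  proof (rule prod_mono)
    fix i assume i: "i \<in> {1..r}"
    then have "\<not> q dvd i" using assms(1) by (auto dest: dvd_imp_le)
    moreover have "real (b * q + i) \<le> real (b * q + r)" using i by (simp only: of_nat_le_iff) auto
    with assms(2) have "real (b * q + i) \<le> real q * A / 32" by linarith
    ultimately show "0 \<le> ?g (b*q+i) \<and> ?g (b*q+i) \<le> \<bar>2 * sin (?u i)\<bar> * exp (cot (?u i) * sin (?v i))"
      using term_le by auto
  qed
  also have "\<dots> = sudler r (of_int p / real q) * exp (\<Sum>i\<in>{1..r}. cot (?u i) * sin (?v i))"
    by (simp add: prod.distrib exp_sum sudler_def mult.assoc)
  also have "(\<Sum>i\<in>{1..r}. cot (?u i) * sin (?v i)) \<le> (\<Sum>i\<in>{1..r}. \<bar>cot (?u i)\<bar> * (1 / real q))"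
  proof (rule sum_mono)
    fix i assume i: "i \<in> {1..r}"
    have "\<bar>sin (?v i)\<bar> \<le> \<bar>?v i\<bar>" by (rule abs_sin_x_le_abs_x)
    also have "\<dots> = pi * (real (b*q+i) * \<bar>\<delta>\<bar>)" by (simp add: abs_mult)
    also have "real (b * q + i) \<le> real (b * q + r)" using i by (simp only: of_nat_le_iff) auto
    with assms(2) have "real (b * q + i) \<le> real q * A / 32" by linarith
    from n_delta_le[OF this] have "pi * (real (b*q+i) * \<bar>\<delta>\<bar>) \<le> 4 * (1 / (32 * real q))"
      using pi_less_4 by (intro mult_mono) auto
    also have "\<dots> \<le> 1 / real q" using q_pos by (simp add: field_simps)
    finally have "\<bar>cot (?u i)\<bar> * \<bar>sin (?v i)\<bar> \<le> \<bar>cot (?u i)\<bar> * (1 / real q)"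
      by (intro mult_left_mono) auto
    then show "cot (?u i) * sin (?v i) \<le> \<bar>cot (?u i)\<bar> * (1 / real q)"
      unfolding abs_mult[symmetric] by (rule order.trans[OF abs_ge_self])
  qed
  also have "\<dots> = (\<Sum>i\<in>{1..r}. \<bar>cot (?u i)\<bar>) * (1 / real q)"
    by (simp only: sum_distrib_right)
  also have "\<dots> \<le> (real q * (1 + ln (real q))) * (1 / real q)"
    using assms(1) by (intro mult_right_mono sum_abs_cot_le) auto
  also have "\<dots> = 1 + ln (real q)" using q_pos by simp
  finally have "(\<Prod>n\<in>{b*q+1..b*q+r}. ?g n) \<le> sudler r (of_int p / real q) * exp (1 + ln (real q))"
    by (simp add: mult_left_mono sudler_def prod_nonneg)
  then show ?thesis using q_pos by (simp add: exp_add)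
qed

lemma sudler_le:
  assumes "r < q" "real (b * q + r) \<le> real q * A / 32"
  shows "sudler (b * q + r) \<alpha> \<le> (1 / 2) ^ b * (sudler r (of_int p / real q) * (exp 1 * real q))"
proof -
  have eq: "{1..b*q+r} = {1..b*q} \<union> {b*q+1..b*q+r}" by auto
  have "sudler (b*q+r) \<alpha> = sudler (b*q) \<alpha> * (\<Prod>n\<in>{b*q+1..b*q+r}. \<bar>2 * sin (pi * real n * \<alpha>)\<bar>)"
    unfolding sudler_def eq by (rule prod.union_disjoint) auto
  also have "\<dots> \<le> (1 / 2) ^ b * (sudler r (of_int p / real q) * (exp 1 * real q))"
  proof (intro mult_mono full_blocks partial_block assms)
    have "real (b * q) \<le> real (b * q + r)" by simp
    then show "real (b * q) \<le> real q * A / 32" using assms(2) by linarith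
  qed (auto intro!: prod_nonneg)
  finally show ?thesis .
qed

end


section \<open>Second moment of the partial products at a fraction\<close>

text \<open>The logarithm of |1 - w|, w on the unit circle, is replaced by that of |1 - \<rho> w|
  and expanded in a power series. Shrinking the radius costs at most 1/q, and cutting the series at
  q^2 costs at most another 1/q.\<close>

lemma ln_abs_sin_le_trig_poly:
  fixes x :: real and q :: nat
  assumes "q \<ge> 2" and nz: "sin (pi * x) \<noteq> 0"
  defines "\<rho> \<equiv> 1 - 1 / real q"
  shows "ln \<bar>2 * sin (pi * x)\<bar> \<le> 2 / real q - (\<Sum>h<q*q. \<rho> ^ h / real h * cos (2 * pi * real h * x))"
proof -
  define s where "s = sin (pi * x)"
  define z where "z = of_real \<rho> * cis (2 * pi * x)"
  have \<rho>: "0 < \<rho>" "\<rho> < 1" using assms(1) by (auto simp: \<rho>_def field_simps)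
  have s1: "s\<^sup>2 \<le> 1" by (simp add: s_def abs_square_le_1)
  have "(norm (1 - z))\<^sup>2 = (1 - \<rho> * cos (2 * pi * x))\<^sup>2 + (\<rho> * sin (2 * pi * x))\<^sup>2"
    by (simp add: cmod_power2 z_def)
  also have "\<dots> = 1 - 2 * \<rho> * cos (2 * pi * x) + \<rho>\<^sup>2 * ((cos (2 * pi * x))\<^sup>2 + (sin (2 * pi * x))\<^sup>2)"
    by (simp add: power2_eq_square distrib_left left_diff_distrib right_diff_distrib mult_ac del: sin_cos_squared_add sin_cos_squared_add2 sin_cos_squared_add3)
  also have "\<dots> = 1 - 2 * \<rho> * (1 - 2 * s\<^sup>2) + \<rho>\<^sup>2"
  proof -
    have c: "cos (2 * pi * x) = 1 - 2 * s\<^sup>2"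
      using cos_double_sin[of "pi * x"] by (simp add: s_def mult.assoc)
    show ?thesis unfolding sin_cos_squared_add2 by (simp only: c mult_1_right)
  qed
  finally have nz2: "(norm (1 - z))\<^sup>2 = (1 - \<rho>)\<^sup>2 + 4 * \<rho> * s\<^sup>2"
    by (simp add: power2_eq_square algebra_simps)
  \<comment> \<open>Exact error term in the comparison of |1 - w| with |1 - \<rho> w|; dropping it
    leaves only the factor 2/(1 + \<rho>), whose logarithm is at most 1 - \<rho>.\<close>
  have "((1 + \<rho>) * \<bar>s\<bar>)\<^sup>2 = (norm (1 - z))\<^sup>2 - (1 - \<rho>)\<^sup>2 * (1 - s\<^sup>2)"
    unfolding nz2 power_mult_distrib power2_abs by (simp add: power2_eq_square algebra_simps)
  also have "\<dots> \<le> (norm (1 - z))\<^sup>2" using s1 by simp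
  finally have le: "(1 + \<rho>) * \<bar>s\<bar> \<le> norm (1 - z)"
    by (rule power2_le_imp_le) simp
  have s0: "\<bar>s\<bar> > 0" using nz by (simp add: s_def)
  then have nz1: "norm (1 - z) > 0" using le \<rho> by (smt (verit) mult_pos_pos)
  have "\<bar>2 * s\<bar> = 2 / (1 + \<rho>) * ((1 + \<rho>) * \<bar>s\<bar>)" using \<rho> by (simp add: abs_mult)
  also have "\<dots> \<le> 2 / (1 + \<rho>) * norm (1 - z)" using le \<rho> by (intro mult_left_mono) auto
  finally have "ln \<bar>2 * s\<bar> \<le> ln (2 / (1 + \<rho>) * norm (1 - z))"
    using s0 by (intro ln_mono) auto
  also have "\<dots> = ln (2 / (1 + \<rho>)) + ln (norm (1 - z))"
    using \<rho> nz1 by (subst ln_mult) auto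
  also have "ln (2 / (1 + \<rho>)) \<le> 2 / (1 + \<rho>) - 1"
    using \<rho> by (intro ln_le_minus_one) auto
  also have "\<dots> = (1 - \<rho>) / (1 + \<rho>)" using \<rho> by (simp add: field_simps)
  also have "\<dots> \<le> (1 - \<rho>) / 1" using \<rho> by (intro divide_left_mono) auto
  also have "\<dots> = 1 - \<rho>" by simp
  also have "\<dots> = 1 / real q" by (simp add: \<rho>_def)
  finally have 1: "ln \<bar>2 * s\<bar> \<le> 1 / real q + ln (norm (1 - z))" by simp
  \<comment> \<open>The term at h = 0 is 0 because division by 0 yields 0, so the sum effectively
    starts at h = 1, like the logarithmic series.\<close>
  define f where "f h = \<rho> ^ h / real h * cos (2 * pi * real h * x)" for h
  have "norm (- z) < 1" using \<rho> by (simp add: z_def norm_mult)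
  from Ln_series'[OF this] have "(\<lambda>n. - (z ^ n) / of_nat n) sums Ln (1 - z)" by simp
  then have "(\<lambda>n. Re (- (z ^ n) / of_nat n)) sums Re (Ln (1 - z))" by (rule sums_Re)
  moreover have "Re (- (z ^ n) / of_nat n) = - f n" for n
    by (simp add: z_def power_mult_distrib Complex.DeMoivre Re_divide_of_nat f_def mult_ac flip: of_real_power)
  ultimately have sums: "(\<lambda>n. - f n) sums ln (norm (1 - z))"
    using nz1 by (simp add: Re_Ln)
  have tail: "(\<lambda>n. - f (n + q*q)) sums (ln (norm (1 - z)) - (\<Sum>h<q*q. - f h))"
    using sums_iff_shift[of "\<lambda>n. - f n" "q*q"] sums by simp
  \<comment> \<open>Every term of the tail is at most \<rho>^n / q^2, and 1 - \<rho> = 1/q turns the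
    geometric sum into 1/q.\<close>
  have geo: "(\<lambda>n. \<rho> ^ n * (1 / real (q*q))) sums (1 / (1 - \<rho>) * (1 / real (q*q)))"
    using \<rho> by (intro sums_mult2 geometric_sums) auto
  have "ln (norm (1 - z)) - (\<Sum>h<q*q. - f h) \<le> 1 / (1 - \<rho>) * (1 / real (q*q))"
  proof -
    have "- f (n + q*q) \<le> \<rho> ^ n * (1 / real (q*q))" for n
    proof -
      have qq: "real (q * q) > 0" using assms(1) by simp
      have "- f (n + q*q) = \<rho> ^ (n + q*q) / real (n + q*q) * (- cos (2 * pi * real (n + q*q) * x))"
        by (simp add: f_def)
      also have "\<dots> \<le> \<rho> ^ (n + q*q) / real (n + q*q) * 1"
        using \<rho> cos_ge_minus_one[of "2 * pi * real (n + q*q) * x"] by (intro mult_left_mono) auto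
      also have "\<dots> \<le> \<rho> ^ n / real (q*q)"
        using \<rho> qq power_decreasing[of n "n + q*q" \<rho>] by (simp, intro frac_le) auto
      finally show ?thesis by simp
    qed
    then show ?thesis
      using sums_le[OF _ tail geo] by simp
  qed
  also have "\<dots> = 1 / real q" using assms(1) by (simp add: \<rho>_def)
  finally show ?thesis
    using 1 by (simp add: s_def f_def sum_negf)
qed

text \<open>Orthogonality of the characters of Z/q: the quotient of two of them is generated by a
  q-th root of unity, which is 1 only when the indices agree; otherwise its geometric sum over r
  vanishes.\<close>

lemma parseval_residues:
  fixes p :: int and q :: nat and b :: "nat \<Rightarrow> complex"
  assumes "coprime p (int q)" "q > 0" and I: "I \<subseteq> {..<q}"
  shows "(\<Sum>r<q. (norm (\<Sum>i\<in>I. b i * cis (2 * pi * (real i * of_int p / real q)) ^ r))\<^sup>2)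
       = real q * (\<Sum>i\<in>I. (norm (b i))\<^sup>2)"
proof -
  define w where "w i = cis (2 * pi * (real i * of_int p / real q))" for i :: nat
  have fin: "finite I" using I finite_subset by blast
  have geo: "(\<Sum>r<q. (w i * cnj (w j)) ^ r) = (if i = j then of_nat q else 0)" if "i \<in> I" "j \<in> I" for i j
  proof -
    have eq: "w i * cnj (w j) = cis (2 * pi * (of_int (int i - int j) * of_int p / real q))"
      by (simp add: w_def cis_cnj cis_mult algebra_simps diff_divide_distrib)
    have iff: "w i * cnj (w j) = 1 \<longleftrightarrow> i = j"
    proof -
      have "\<bar>int i - int j\<bar> < int q" using that I by (auto simp: subset_iff abs_if)
      then have "int q dvd int i - int j \<longleftrightarrow> i = j"
        by (metis dvd_0_right dvd_imp_le_int abs_of_nat eq_iff_diff_eq_0 int_int_eq not_le)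
      then show ?thesis unfolding eq cis_fraction_eq_1_iff[OF assms(1,2)] .
    qed
    have "(w i * cnj (w j)) ^ q = cis (2 * pi * of_int ((int i - int j) * p))"
    proof -
      have "real q * (2 * pi * (of_int (int i - int j) * of_int p / real q)) = 2 * pi * of_int ((int i - int j) * p)"
        using assms(2) by simp
      then show ?thesis unfolding eq Complex.DeMoivre by simp
    qed
    also have "\<dots> = 1" by (rule cis_multiple_2pi) simp
    finally show ?thesis using iff by (simp add: sum_gp_strict)
  qed
  have "complex_of_real (\<Sum>r<q. (norm (\<Sum>i\<in>I. b i * w i ^ r))\<^sup>2)
      = (\<Sum>r<q. (\<Sum>i\<in>I. b i * w i ^ r) * cnj (\<Sum>j\<in>I. b j * w j ^ r))"
    by (simp only: complex_norm_square of_real_sum)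
  also have "\<dots> = (\<Sum>r<q. \<Sum>i\<in>I. \<Sum>j\<in>I. b i * cnj (b j) * (w i * cnj (w j)) ^ r)"
    by (simp add: sum_product power_mult_distrib mult_ac)
  also have "\<dots> = (\<Sum>i\<in>I. \<Sum>j\<in>I. \<Sum>r<q. b i * cnj (b j) * (w i * cnj (w j)) ^ r)"
    by (subst sum.swap, rule sum.cong[OF refl], subst sum.swap, rule refl)
  also have "\<dots> = (\<Sum>i\<in>I. \<Sum>j\<in>I. if i = j then b i * cnj (b j) * of_nat q else 0)"
    by (intro sum.cong refl) (simp add: geo flip: sum_distrib_left)
  also have "\<dots> = (\<Sum>i\<in>I. b i * cnj (b i) * of_nat q)"
    using fin by (simp add: sum.delta)
  also have "\<dots> = complex_of_real (real q * (\<Sum>i\<in>I. (norm (b i))\<^sup>2))"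
    by (simp add: sum_distrib_left mult_ac flip: complex_norm_square)
  finally show ?thesis unfolding w_def of_real_eq_iff .
qed

text \<open>The Dirichlet kernel: each product is a difference of consecutive sines, and the sum
  telescopes.\<close>

lemma two_sin_times_sum_cos:
  fixes x :: real
  shows "2 * sin (x / 2) * (\<Sum>n=1..r. cos (real n * x)) = sin ((2 * real r + 1) * (x / 2)) - sin (x / 2)"
proof (induction r)
  case (Suc r)
  have "2 * sin (x / 2) * cos (real (Suc r) * x)
      = sin (real (Suc r) * x + x / 2) - sin (real (Suc r) * x - x / 2)"
    by (simp add: sin_add sin_diff)
  also have "real (Suc r) * x + x / 2 = (2 * real (Suc r) + 1) * (x / 2)"
    by (simp add: algebra_simps)
  also have "real (Suc r) * x - x / 2 = (2 * real r + 1) * (x / 2)"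
    by (simp add: algebra_simps)
  finally show ?case
    using Suc.IH by (simp add: distrib_left)
qed simp

text \<open>At p/q the frequencies congruent to i modulo q coincide, so their coefficients are added
  up. As \<rho>^q \<le> 1/e \<le> 1/2, the terms with m \<ge> 1 contribute at most 1/q \<le>
  1/i.\<close>

lemma folded_coefficient_le:
  fixes q i :: nat
  assumes "q \<ge> 2" "1 \<le> i" "i < q"
  defines "\<rho> \<equiv> 1 - 1 / real q"
  shows "(\<Sum>m<q. \<rho> ^ (m*q+i) / real (m*q+i)) \<le> 2 / real i"
proof -
  have \<rho>: "0 < \<rho>" "\<rho> < 1" using assms(1) by (auto simp: \<rho>_def field_simps)
  have "\<rho> \<le> exp (- 1 / real q)"
    using exp_ge_add_one_self[of "- 1 / real q"] by (simp add: \<rho>_def)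
  then have "\<rho> ^ q \<le> exp (- 1 / real q) ^ q" using \<rho> by (intro power_mono) auto
  also have "\<dots> = exp (- 1)" using assms(1) by (simp flip: exp_of_nat_mult)
  also have "\<dots> \<le> 1 / 2"
    using exp_ge_add_one_self[of 1] by (simp add: exp_minus field_simps)
  finally have \<rho>q: "\<rho> ^ q \<le> 1 / 2" .
  have summand: "\<rho> ^ (m*q+i) / real (m*q+i) \<le> (if m = 0 then 1 / real i else 0) + (1/2) ^ m / real q * (if m = 0 then 0 else 1)" for m
  proof (cases m)
    case 0
    then show ?thesis using \<rho> assms(2) by (simp add: divide_right_mono power_le_one)
  next
    case (Suc k)
    have "\<rho> ^ (m*q+i) \<le> \<rho> ^ (q*m)" using \<rho> by (intro power_decreasing) auto
    also have "\<dots> \<le> (1/2) ^ m" unfolding power_mult using \<rho>q \<rho> by (intro power_mono) auto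
    finally have a: "\<rho> ^ (m*q+i) \<le> (1/2) ^ m" .
    have "real q \<le> real (m*q+i)" unfolding of_nat_le_iff using Suc by simp
    with a have "\<rho> ^ (m*q+i) / real (m*q+i) \<le> (1/2) ^ m / real q"
      using assms(1) by (intro frac_le) auto
    then show ?thesis using Suc by simp
  qed
  have "(\<Sum>m<q. \<rho> ^ (m*q+i) / real (m*q+i))
     \<le> (\<Sum>m<q. (if m = 0 then 1 / real i else 0) + (1/2) ^ m / real q * (if m = 0 then 0 else 1))"
    by (rule sum_mono) (rule summand)
  also have "\<dots> = 1 / real i + (\<Sum>m<q. (1/2) ^ m / real q * (if m = 0 then 0 else 1))"
    using assms(1) by (simp add: sum.distrib)
  also have "(\<Sum>m<q. (1/2) ^ m / real q * (if m = 0 then 0 else 1)) = (\<Sum>m\<in>{1..<q}. (1/2) ^ m / real q)"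
    by (rule sum.mono_neutral_cong_right) (use assms(1) in auto)
  also have "\<dots> = ((\<Sum>m\<in>{1..<q}. (1/2) ^ m)) / real q" by (simp add: sum_divide_distrib)
  also have "(\<Sum>m\<in>{1..<q}. (1/2::real) ^ m) \<le> 1"
  proof -
    have "(\<Sum>m\<in>{1..<q}. (1/2::real) ^ m) = (\<Sum>m<q. (1/2) ^ m) - 1"
      using assms(1) by (simp add: sum.atLeast1_atMost_eq lessThan_atLeast0 sum.atLeast_Suc_lessThan)
    also have "\<dots> \<le> 1" by (simp add: sum_gp_strict)
    finally show ?thesis .
  qed
  also have "1 / real q \<le> 1 / real i" using assms(2,3) by (simp add: frac_le)
  finally show ?thesis by (simp add: divide_right_mono)
qed

text \<open>The majorant is summed over n \<le> r and its frequencies are folded modulo q. The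
  Dirichlet kernel gives the sine quotients in \<open>S\<close>. The errors of the majorant add up
  to at most 2, and the constants -1/2 of the kernel contribute at most 1 + ln q.\<close>

lemma ln_sudler_fraction_le:
  fixes p :: int and q :: nat
  assumes cop: "coprime p (int q)" and q: "q \<ge> 2"
  obtains C S :: "nat \<Rightarrow> real" where
    "\<And>i. i \<in> {1..<q} \<Longrightarrow> 0 \<le> C i \<and> C i \<le> 2 / real i"
    "\<And>r. S r = (\<Sum>i\<in>{1..<q}. C i * (sin ((2 * real r + 1) * (pi * (real i * of_int p / real q))) / sin (pi * (real i * of_int p / real q))))"
    "\<And>r. r < q \<Longrightarrow> ln (sudler r (of_int p / real q)) \<le> 3 + ln (real q) - S r / 2"
proof -
  have q0: "q > 0" using q by simp
  define \<rho> where "\<rho> = 1 - 1 / real q"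
  have \<rho>: "0 < \<rho>" "\<rho> < 1" using q by (auto simp: \<rho>_def field_simps)
  define C where "C i = (\<Sum>m<q. \<rho> ^ (m*q+i) / real (m*q+i))" for i
  define u where "u i = pi * (real i * of_int p / real q)" for i :: nat
  define S where "S r = (\<Sum>i\<in>{1..<q}. C i * (sin ((2 * real r + 1) * u i) / sin (u i)))" for r :: nat
  define D where "D r h = (\<Sum>n=1..r. cos (2 * pi * real h * (real n * of_int p / real q)))" for r h :: nat
  have C0: "0 \<le> C i" for i unfolding C_def using \<rho> by (intro sum_nonneg) auto
  have C2: "C i \<le> 2 / real i" if "i \<in> {1..<q}" for i
    using folded_coefficient_le[OF q, of i] that by (simp add: C_def \<rho>_def)
  have Dper: "D r (m*q+i) = D r i" for r m i
    unfolding D_def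
  proof (rule sum.cong[OF refl])
    fix n :: nat
    have "2 * pi * real (m*q+i) * (real n * of_int p / real q)
        = 2 * pi * real i * (real n * of_int p / real q) + 2 * pi * of_int (int m * int n * p)"
      using q0 by (simp add: field_simps)
    then show "cos (2 * pi * real (m*q+i) * (real n * of_int p / real q)) = cos (2 * pi * real i * (real n * of_int p / real q))"
      by (simp only: cos_add cos_int_2pin sin_int_2pin)
  qed
  have Dval: "D r i = sin ((2 * real r + 1) * u i) / sin (u i) / 2 - 1 / 2" if "i \<in> {1..<q}" for r i
  proof -
    have "\<not> q dvd i" using that by (auto dest: dvd_imp_le)
    then have nz: "sin (u i) \<noteq> 0"
      using abs_sin_fraction_ge[OF cop q0, of i] q0 by (auto simp: u_def)
    have "D r i = (\<Sum>n=1..r. cos (real n * (2 * u i)))"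
      unfolding D_def u_def by (intro sum.cong refl arg_cong[of _ _ cos]) simp
    then show ?thesis
      using two_sin_times_sum_cos[of "2 * u i" r] nz by (simp add: field_simps)
  qed
  have "ln (sudler r (of_int p / real q)) \<le> 3 + ln (real q) - S r / 2" if r: "r < q" for r
  proof -
    have nz: "sin (pi * (real n * of_int p / real q)) \<noteq> 0" if "n \<in> {1..r}" for n
    proof -
      have "\<not> q dvd n" using that r by (auto dest: dvd_imp_le)
      then show ?thesis using abs_sin_fraction_ge[OF cop q0, of n] q0 by auto
    qed
    have "ln (sudler r (of_int p / real q)) = (\<Sum>n=1..r. ln \<bar>2 * sin (pi * (real n * of_int p / real q))\<bar>)"
      unfolding sudler_def using nz by (subst ln_prod) (auto simp: mult.assoc)
    also have "\<dots> \<le> (\<Sum>n=1..r. 2 / real q - (\<Sum>h<q*q. \<rho> ^ h / real h * cos (2 * pi * real h * (real n * of_int p / real q))))"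
      unfolding \<rho>_def by (intro sum_mono ln_abs_sin_le_trig_poly q nz)
    also have "\<dots> = real r * (2 / real q) - (\<Sum>h<q*q. \<rho> ^ h / real h * D r h)"
      unfolding sum_subtractf D_def sum_distrib_left by (subst sum.swap) simp
    also have "real r * (2 / real q) \<le> 2" using r by (simp add: field_simps)
    also have "(\<Sum>h<q*q. \<rho> ^ h / real h * D r h) = (\<Sum>i<q. C i * D r i)"
    proof -
      have "(\<Sum>h<q*q. \<rho> ^ h / real h * D r h) = (\<Sum>m<q. \<Sum>h\<in>{m*q..<m*q+q}. \<rho> ^ h / real h * D r h)"
        by (rule sum.nat_group[symmetric])
      also have "\<dots> = (\<Sum>m<q. \<Sum>i<q. \<rho> ^ (m*q+i) / real (m*q+i) * D r (m*q+i))"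
      proof (rule sum.cong[OF refl])
        fix m
        show "(\<Sum>h\<in>{m*q..<m*q+q}. \<rho> ^ h / real h * D r h) = (\<Sum>i<q. \<rho> ^ (m*q+i) / real (m*q+i) * D r (m*q+i))"
          by (rule sum.reindex_bij_witness[where i="\<lambda>i. m * q + i" and j="\<lambda>h. h - m * q"]) auto
      qed
      also have "\<dots> = (\<Sum>i<q. C i * D r i)"
        unfolding Dper C_def sum_distrib_right by (rule sum.swap)
      finally show ?thesis .
    qed
    also have "(\<Sum>i<q. C i * D r i) = C 0 * D r 0 + (\<Sum>i\<in>{1..<q}. C i * D r i)"
      using q0 by (simp add: lessThan_atLeast0 sum.atLeast_Suc_lessThan)
    also have "D r 0 = real r" by (simp add: D_def)
    also have "(\<Sum>i\<in>{1..<q}. C i * D r i) = S r / 2 - (\<Sum>i\<in>{1..<q}. C i) / 2"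
      by (simp add: Dval S_def sum_divide_distrib sum_subtractf right_diff_distrib)
    finally have "ln (sudler r (of_int p / real q)) \<le> 2 - (C 0 * real r + (S r / 2 - (\<Sum>i\<in>{1..<q}. C i) / 2))"
      by simp
    moreover have "0 \<le> C 0 * real r" using C0 by simp
    moreover have "(\<Sum>i\<in>{1..<q}. C i) \<le> 2 * (1 + ln (real q))"
    proof -
      have "(\<Sum>i\<in>{1..<q}. C i) \<le> (\<Sum>i\<in>{1..<q}. 2 * (1 / real i))"
        by (rule sum_mono) (use C2 in auto)
      also have "\<dots> \<le> (\<Sum>i=1..q. 2 * (1 / real i))"
        by (rule sum_mono2) auto
      also have "\<dots> = 2 * (\<Sum>i=1..q. 1 / real i)" by (simp only: sum_distrib_left)
      finally show ?thesis using harm_le_one_plus_ln[OF q0] by simp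
    qed
    ultimately show ?thesis by argo
  qed
  then show thesis
    using that[of C S] C0 C2 by (simp add: S_def u_def)
qed

text \<open>Chebyshev's inequality: every exceptional r has |S r| \<ge> 2t, and the second moment of
  S over all residues is given by Parseval.\<close>

lemma few_large_sudler:
  fixes p :: int and q :: nat and t :: real
  assumes cop: "coprime p (int q)" and q: "q \<ge> 2" and t: "t > 0"
  shows "real (card {r. r < q \<and> exp (3 + ln (real q) + t) < sudler r (of_int p / real q)}) * (4 * t\<^sup>2)
      \<le> real q * (\<Sum>i\<in>{1..<q}. 1 / (real i * int_dist (real i * of_int p / real q))\<^sup>2)"
proof -
  have q0: "q > 0" using q by simp
  obtain C S :: "nat \<Rightarrow> real" where
    C: "\<And>i. i \<in> {1..<q} \<Longrightarrow> 0 \<le> C i \<and> C i \<le> 2 / real i" and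
    S: "\<And>r. S r = (\<Sum>i\<in>{1..<q}. C i * (sin ((2 * real r + 1) * (pi * (real i * of_int p / real q))) / sin (pi * (real i * of_int p / real q))))" and
    le: "\<And>r. r < q \<Longrightarrow> ln (sudler r (of_int p / real q)) \<le> 3 + ln (real q) - S r / 2"
    using ln_sudler_fraction_le[OF cop q] by blast
  define u where "u i = pi * (real i * of_int p / real q)" for i :: nat
  define b where "b i = of_real (C i / sin (u i)) * cis (u i)" for i
  define B where "B = {r. r < q \<and> exp (3 + ln (real q) + t) < sudler r (of_int p / real q)}"
  have fin: "finite B" by (simp add: B_def)
  \<comment> \<open>The odd multiple (2r + 1) u splits into a phase u, absorbed into
    \<open>b\<close>, and the r-th power of a character, so Parseval applies.\<close>
  have SIm: "S r = Im (\<Sum>i\<in>{1..<q}. b i * cis (2 * pi * (real i * of_int p / real q)) ^ r)" for r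
  proof -
    have "b i * cis (2 * pi * (real i * of_int p / real q)) ^ r
        = of_real (C i / sin (u i)) * cis ((2 * real r + 1) * u i)" for i
    proof -
      have "u i + real r * (2 * pi * (real i * of_int p / real q)) = (2 * real r + 1) * u i"
        by (simp add: u_def algebra_simps add_divide_distrib)
      then show ?thesis by (simp only: b_def Complex.DeMoivre cis_mult mult.assoc)
    qed
    then show ?thesis by (simp add: S u_def)
  qed
  have "real (card B) * (4 * t\<^sup>2) = (\<Sum>r\<in>B. (2 * t)\<^sup>2)" by simp
  also have "\<dots> \<le> (\<Sum>r\<in>B. (S r)\<^sup>2)"
  proof (rule sum_mono)
    fix r assume "r \<in> B"
    then have r: "r < q" "exp (3 + ln (real q) + t) < sudler r (of_int p / real q)" by (auto simp: B_def)
    from r(2) have "ln (exp (3 + ln (real q) + t)) < ln (sudler r (of_int p / real q))"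
      by (subst ln_less_cancel_iff) (auto intro: less_trans[OF exp_gt_zero])
    with le[OF r(1)] have "2 * t \<le> - S r" by simp
    then have "(2 * t)\<^sup>2 \<le> (- S r)\<^sup>2" using t by (intro power_mono) auto
    then show "(2 * t)\<^sup>2 \<le> (S r)\<^sup>2" by simp
  qed
  also have "\<dots> \<le> (\<Sum>r<q. (S r)\<^sup>2)" by (rule sum_mono2) (auto simp: B_def)
  also have "\<dots> \<le> (\<Sum>r<q. (norm (\<Sum>i\<in>{1..<q}. b i * cis (2 * pi * (real i * of_int p / real q)) ^ r))\<^sup>2)"
  proof (rule sum_mono)
    fix r
    have "\<bar>S r\<bar>\<^sup>2 \<le> (norm (\<Sum>i\<in>{1..<q}. b i * cis (2 * pi * (real i * of_int p / real q)) ^ r))\<^sup>2"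
      unfolding SIm by (intro power_mono abs_Im_le_cmod) simp
    then show "(S r)\<^sup>2 \<le> (norm (\<Sum>i\<in>{1..<q}. b i * cis (2 * pi * (real i * of_int p / real q)) ^ r))\<^sup>2"
      by simp
  qed
  also have "\<dots> = real q * (\<Sum>i\<in>{1..<q}. (norm (b i))\<^sup>2)"
    by (rule parseval_residues[OF cop q0]) auto
  also have "\<dots> \<le> real q * (\<Sum>i\<in>{1..<q}. 1 / (real i * int_dist (real i * of_int p / real q))\<^sup>2)"
  proof (intro mult_left_mono sum_mono)
    fix i assume i: "i \<in> {1..<q}"
    then have "\<not> q dvd i" by (auto dest: dvd_imp_le)
    from int_dist_fraction_ge[OF cop q0 this] have n0: "0 < int_dist (real i * of_int p / real q)"
      using q0 by (smt (verit) divide_pos_pos of_nat_0_less_iff)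
    have "norm (b i) = C i / \<bar>sin (u i)\<bar>"
      using C[OF i] by (simp add: b_def norm_mult norm_divide)
    also have "\<dots> \<le> (2 / real i) / (2 * int_dist (real i * of_int p / real q))"
      using C[OF i] n0 abs_sin_pi_ge[of "real i * of_int p / real q"]
      by (intro frac_le) (auto simp: u_def)
    also have "\<dots> = 1 / (real i * int_dist (real i * of_int p / real q))" by simp
    finally have "(norm (b i))\<^sup>2 \<le> (1 / (real i * int_dist (real i * of_int p / real q)))\<^sup>2"
      by (rule power_mono) simp
    then show "(norm (b i))\<^sup>2 \<le> 1 / (real i * int_dist (real i * of_int p / real q))\<^sup>2"
      by (simp add: power_divide)
  qed auto
  finally show ?thesis by (simp add: B_def)
qed


section \<open>Distance to the nearest integer: metric estimates\<close>

lemma int_dist_measurable [measurable]: "int_dist \<in> borel_measurable borel"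
  unfolding int_dist_def[abs_def] round_def by measurable

lemma fmeasurable_Icc_sep:
  fixes a b :: real
  assumes "Measurable.pred borel P"
  shows "{x \<in> {a..b}. P x} \<in> fmeasurable lborel"
proof (rule fmeasurableI2)
  show "{a..b} \<in> fmeasurable lborel" by (auto intro!: fmeasurableI simp: emeasure_lborel_Icc_eq)
  show "{x \<in> {a..b}. P x} \<in> sets lborel" using assms by measurable
qed auto

lemma card_int_between:
  fixes x y :: real
  assumes "x \<le> y"
  shows "real (card {\<lceil>x\<rceil>..\<lfloor>y\<rfloor>}) \<le> y - x + 1"
proof -
  have "real (card {\<lceil>x\<rceil>..\<lfloor>y\<rfloor>}) = real (nat (\<lfloor>y\<rfloor> - \<lceil>x\<rceil> + 1))" by simp
  also have "\<dots> \<le> y - x + 1"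
  proof (cases "\<lfloor>y\<rfloor> - \<lceil>x\<rceil> + 1 \<ge> 0")
    case True
    then have "real (nat (\<lfloor>y\<rfloor> - \<lceil>x\<rceil> + 1)) = of_int (\<lfloor>y\<rfloor> - \<lceil>x\<rceil> + 1)" by simp
    then show ?thesis using of_int_floor_le[of y] le_of_int_ceiling[of x] by linarith
  qed (use assms in auto)
  finally show ?thesis .
qed

text \<open>The set is covered by intervals of radius t/h about fractions j/h, where j ranges over
  the integers from ha - 1/2 to hb + 1/2.\<close>

lemma measure_int_dist_le:
  fixes a b t :: real and h :: nat
  assumes "a \<le> b" "h \<ge> 1" "t \<ge> 0"
  shows "measure lborel {x \<in> {a..b}. int_dist (real h * x) \<le> t} \<le> (real h * (b - a) + 2) * (2 * t / real h)"
proof -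
  define J where "J = {\<lceil>real h * a - 1/2\<rceil>..\<lfloor>real h * b + 1/2\<rfloor>}"
  define I where "I j = {of_int j / real h - t / real h..of_int j / real h + t / real h}" for j :: int
  have h: "real h > 0" using assms by simp
  have sub: "{x \<in> {a..b}. int_dist (real h * x) \<le> t} \<subseteq> (\<Union>j\<in>J. I j)"
  proof
    fix x assume "x \<in> {x \<in> {a..b}. int_dist (real h * x) \<le> t}"
    then have x: "a \<le> x" "x \<le> b" "int_dist (real h * x) \<le> t" by auto
    define j where "j = round (real h * x)"
    have "real h * a \<le> real h * x" "real h * x \<le> real h * b"
      using x h by (auto intro!: mult_left_mono)
    moreover have "\<bar>of_int j - real h * x\<bar> \<le> 1/2" unfolding j_def by (rule of_int_round_abs_le)
    ultimately have "real h * a - 1/2 \<le> of_int j" "of_int j \<le> real h * b + 1/2" by linarith+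
    then have "j \<in> J" by (simp add: J_def ceiling_le_iff le_floor_iff)
    moreover have "\<bar>real h * x - of_int j\<bar> \<le> t" using x(3) by (simp add: int_dist_def j_def)
    then have "x \<in> I j" using h by (auto simp: I_def field_simps abs_le_iff)
    ultimately show "x \<in> (\<Union>j\<in>J. I j)" by auto
  qed
  have fin: "finite J" by (simp add: J_def)
  have "measure lborel {x \<in> {a..b}. int_dist (real h * x) \<le> t} \<le> measure lborel (\<Union>j\<in>J. I j)"
  proof (rule measure_mono_fmeasurable[OF sub])
    show "{x \<in> {a..b}. int_dist (real h * x) \<le> t} \<in> sets lborel"
      by (rule fmeasurableD, rule fmeasurable_Icc_sep) measurable
    show "(\<Union>j\<in>J. I j) \<in> fmeasurable lborel"
      using fin by (intro fmeasurable.finite_UN) (auto simp: I_def emeasure_lborel_Icc_eq intro!: fmeasurableI)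
  qed
  also have "\<dots> \<le> (\<Sum>j\<in>J. measure lborel (I j))"
    using fin by (intro measure_UNION_le) (auto simp: I_def)
  also have "\<dots> = (\<Sum>j\<in>J. 2 * t / real h)"
    using assms h by (intro sum.cong refl) (simp add: I_def field_simps)
  also have "\<dots> = real (card J) * (2 * t / real h)" by simp
  also have "\<dots> \<le> (real h * (b - a) + 2) * (2 * t / real h)"
  proof (rule mult_right_mono)
    have "real h * a \<le> real h * b" using assms by (intro mult_left_mono) auto
    then have "real (card J) \<le> (real h * b + 1/2) - (real h * a - 1/2) + 1"
      unfolding J_def by (intro card_int_between) auto
    then show "real (card J) \<le> real h * (b - a) + 2" by (simp add: algebra_simps)
  qed (use assms in auto)
  finally show ?thesis .
qed

lemma markov_indicator_sum:
  fixes c :: "'i \<Rightarrow> real" and A :: "'i \<Rightarrow> real set"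
  assumes "finite I" "\<And>i. i \<in> I \<Longrightarrow> 0 \<le> c i" "\<And>i. i \<in> I \<Longrightarrow> A i \<in> fmeasurable lborel" "T > 0"
  shows "{x. T \<le> (\<Sum>i\<in>I. c i * indicator (A i) x)} \<in> sets lborel"
    and "measure lborel {x. T \<le> (\<Sum>i\<in>I. c i * indicator (A i) x)} \<le> (\<Sum>i\<in>I. c i * measure lborel (A i)) / T"
proof -
  let ?f = "\<lambda>x. \<Sum>i\<in>I. c i * indicator (A i) x"
  have ind: "integrable lborel (indicator (A i) :: real \<Rightarrow> real)" if "i \<in> I" for i
    using assms(3)[OF that] by (auto simp: fmeasurable_def)
  have int: "integrable lborel ?f"
    by (intro Bochner_Integration.integrable_sum integrable_mult_right ind)
  have [measurable]: "?f \<in> borel_measurable borel" using int by auto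
  have m: "{x \<in> space lborel. T \<le> ?f x} \<in> sets lborel" by measurable
  then show "{x. T \<le> ?f x} \<in> sets lborel" by simp
  have "measure lborel {x \<in> space lborel. T \<le> ?f x} \<le> (\<integral>x. ?f x \<partial>lborel) / T"
  proof (rule integral_Markov_inequality_measure[OF int, where A="{}"])
    show "AE x in lborel. 0 \<le> ?f x" by (intro AE_I2 sum_nonneg) (use assms(2) in auto)
  qed (use assms(4) in auto)
  also have "(\<integral>x. ?f x \<partial>lborel) = (\<Sum>i\<in>I. c i * measure lborel (A i))"
    by (subst Bochner_Integration.integral_sum) (auto intro!: integrable_mult_right ind sum.cong)
  finally show "measure lborel {x. T \<le> ?f x} \<le> (\<Sum>i\<in>I. c i * measure lborel (A i)) / T"
    by simp
qed

text \<open>With m the integer part of 1/t, the odd numbers up to 2m + 1 sum to (m + 1)^2. This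
  writes an inverse square as a combination of indicators of t \<le> 1/n, whose measures are easy;
  the lower bound on t keeps the combination finite.\<close>

lemma inverse_square_le_sum:
  fixes t :: real and X :: nat
  assumes "t > 0" "1 / t \<le> real X"
  shows "1 / t\<^sup>2 \<le> (\<Sum>n\<in>{..X}. (2 * real n + 1) * of_bool (real n * t \<le> 1))"
proof -
  define m where "m = nat \<lfloor>1 / t\<rfloor>"
  have m: "real m \<le> 1 / t" "1 / t < real m + 1" using assms(1) by (auto simp: m_def)
  then have "m \<le> X" using assms(2) by linarith
  have odd: "(\<Sum>n\<in>{..m}. 2 * real n + 1) = (real m + 1)\<^sup>2"
    by (induction m) (simp_all add: power2_eq_square algebra_simps)
  have "1 / t\<^sup>2 = (1 / t)\<^sup>2" by (simp add: power_divide)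
  also have "\<dots> \<le> (real m + 1)\<^sup>2" using m assms(1) by (intro power_mono) auto
  also have "\<dots> = (\<Sum>n\<in>{..m}. (2 * real n + 1) * of_bool (real n * t \<le> 1))"
    unfolding odd[symmetric]
  proof (rule sum.cong[OF refl])
    fix n assume "n \<in> {..m}"
    then have "real n \<le> 1 / t" using m by (meson atMost_iff of_nat_le_iff order.trans)
    then have "real n * t \<le> 1" using assms(1) by (simp add: pos_le_divide_eq)
    then show "2 * real n + 1 = (2 * real n + 1) * of_bool (real n * t \<le> 1)" by simp
  qed
  also have "\<dots> \<le> (\<Sum>n\<in>{..X}. (2 * real n + 1) * of_bool (real n * t \<le> 1))"
    using \<open>m \<le> X\<close> by (intro sum_mono2) auto
  finally show ?thesis .
qed

section \<open>Exceptional sets at scale 8^k\<close>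

lemma one_plus_ln_8_power: "k \<ge> 1 \<Longrightarrow> 1 + ln (real (8 ^ k)) \<le> 4 * real k"
proof -
  assume k: "k \<ge> 1"
  have "ln (real (8 ^ k)) = real k * (3 * ln 2)"
    using ln_realpow[of 2 3] by (simp add: ln_realpow)
  also have "\<dots> \<le> real k * (3 * 1)" using ln_2_less_1 by (intro mult_left_mono) auto
  finally show ?thesis using k by simp
qed

lemma harm_8_power_le:
  assumes "k \<ge> 1"
  shows "(\<Sum>h\<in>{1..<8 ^ k}. 1 / real h) \<le> 4 * real k"
proof -
  have "(\<Sum>h\<in>{1..<8 ^ k}. 1 / real h) \<le> (\<Sum>h=1..8 ^ k. 1 / real h)" by (rule sum_mono2) auto
  also have "\<dots> \<le> 1 + ln (real (8 ^ k))" by (rule harm_le_one_plus_ln) simp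
  finally show ?thesis using one_plus_ln_8_power[OF assms] by simp
qed

text \<open>The threshold makes the h-th set of measure about 1/(h K k); the harmonic sum over h <
  8^k is at most 4k and cancels the k.\<close>

lemma measure_small_int_dist_le:
  fixes a b :: real and k K :: nat
  assumes "a \<le> b" "k \<ge> 1" "K \<ge> 1"
  defines "B \<equiv> (\<Union>h\<in>{1..<8 ^ k}. {x \<in> {a..b}. int_dist (real h * x) \<le> 1 / real (h * K * k)})"
  shows "B \<in> fmeasurable lborel" "measure lborel B \<le> 8 * (b - a + 2) / real K"
proof -
  have fm: "{x \<in> {a..b}. int_dist (real h * x) \<le> 1 / real (h * K * k)} \<in> fmeasurable lborel" for h
    by (rule fmeasurable_Icc_sep) measurable
  then show "B \<in> fmeasurable lborel" unfolding B_def by (intro fmeasurable.finite_UN) auto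
  have "measure lborel B \<le> (\<Sum>h\<in>{1..<8 ^ k}. measure lborel {x \<in> {a..b}. int_dist (real h * x) \<le> 1 / real (h * K * k)})"
    unfolding B_def by (intro measure_UNION_le) (auto intro: fmeasurableD fm)
  also have "\<dots> \<le> (\<Sum>h\<in>{1..<8 ^ k}. 2 * (b - a + 2) / real (K * k) * (1 / real h))"
  proof (rule sum_mono)
    fix h :: nat assume "h \<in> {1..<8 ^ k}"
    then have h: "real h \<ge> 1" by simp
    have Kk: "real (K * k) > 0" using assms by simp
    have "measure lborel {x \<in> {a..b}. int_dist (real h * x) \<le> 1 / real (h * K * k)}
       \<le> (real h * (b - a) + 2) * (2 * (1 / real (h * K * k)) / real h)"
      using h assms(1) by (intro measure_int_dist_le) auto
    also have "\<dots> \<le> (real h * (b - a + 2)) * (2 * (1 / real (h * K * k)) / real h)"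
      using h by (intro mult_right_mono) (auto simp: algebra_simps)
    also have "\<dots> = 2 * (b - a + 2) / real (K * k) * (1 / real h)"
      using h Kk by (simp add: mult_ac)
    finally show "measure lborel {x \<in> {a..b}. int_dist (real h * x) \<le> 1 / real (h * K * k)}
       \<le> 2 * (b - a + 2) / real (K * k) * (1 / real h)" .
  qed
  also have "\<dots> = 2 * (b - a + 2) / real (K * k) * (\<Sum>h\<in>{1..<8 ^ k}. 1 / real h)"
    by (simp only: sum_distrib_left)
  also have "\<dots> \<le> 2 * (b - a + 2) / real (K * k) * (4 * real k)"
    using assms harm_8_power_le[OF assms(2)] by (intro mult_left_mono) auto
  also have "\<dots> = 8 * (b - a + 2) / real K" using assms by (simp add: field_simps)
  finally show "measure lborel B \<le> 8 * (b - a + 2) / real K" .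
qed

text \<open>The inverse square of \<open>int_dist\<close> is not integrable, so the points with
  \<open>int_dist (h x)\<close> at most 1/(h K k) are removed first, as \<open>B1\<close>. Elsewhere
  the sum is dominated by a combination of indicators with integral O(K k^2), and Markov's
  inequality at level (K k)^2 gives \<open>B2\<close> of measure O(1/K).\<close>

lemma measure_exceptional_le:
  fixes a b :: real and k K :: nat
  assumes ab: "a \<le> b" and k: "k \<ge> 1" and K: "K \<ge> 1"
  obtains B where "B \<in> fmeasurable lborel" "measure lborel B \<le> 36 * (b - a + 2) / real K"
    "\<And>x h. x \<in> {a..b} - B \<Longrightarrow> h \<in> {1..<8 ^ k} \<Longrightarrow> 0 < int_dist (real h * x)"
    "\<And>x. x \<in> {a..b} - B \<Longrightarrow> (\<Sum>h\<in>{1..<8 ^ k}. 1 / (real h * int_dist (real h * x))\<^sup>2) \<le> (real K * real k)\<^sup>2"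
proof -
  define B1 where "B1 = (\<Union>h\<in>{1..<8 ^ k}. {x \<in> {a..b}. int_dist (real h * x) \<le> 1 / real (h * K * k)})"
  \<comment> \<open>The truncation outside \<open>B1\<close> is exactly what allows n to stop at h K
    k.\<close>
  define I where "I = Sigma {1..<8 ^ k} (\<lambda>h::nat. {..h * K * k})"
  define c where "c = (\<lambda>(h::nat, n::nat). (2 * real n + 1) / (real h)\<^sup>2)"
  define A where "A = (\<lambda>(h::nat, n::nat). {x \<in> {a..b}. real n * int_dist (real h * x) \<le> 1})"
  define T where "T = (real K * real k)\<^sup>2"
  define B2 where "B2 = {x. T \<le> (\<Sum>i\<in>I. c i * indicator (A i) x)}"
  have T: "T > 0" using k K by (simp add: T_def)
  have fin: "finite I" by (simp add: I_def)
  have c0: "\<And>i. i \<in> I \<Longrightarrow> 0 \<le> c i" by (auto simp: c_def I_def)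
  have Am: "A i \<in> fmeasurable lborel" for i
  proof -
    have "{x \<in> {a..b}. real n * int_dist (real h * x) \<le> 1} \<in> fmeasurable lborel" for n h :: nat
      by (rule fmeasurable_Icc_sep) measurable
    then show ?thesis by (cases i) (simp add: A_def)
  qed
  have B2s: "B2 \<in> sets lborel" unfolding B2_def by (rule markov_indicator_sum(1)) (use fin c0 Am T in auto)
  have hb: "0 \<le> b - a" using ab by simp
  \<comment> \<open>The weight 2n + 1 balances the measure of order 1/n, so each n contributes a
    bounded multiple of 1/h^2 and the h K k values of n together contribute O(K k / h).\<close>
  have Al: "c (h, n) * measure lborel (A (h, n)) \<le> (b - a + 2) * (if n = 0 then 1 else 6) / (real h)\<^sup>2" if "h \<ge> 1" for h n
  proof (cases "n = 0")
    case True
    then have "A (h, n) = {a..b}" by (auto simp: A_def)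
    then have "measure lborel (A (h, n)) = b - a" using ab by simp
    then show ?thesis using True by (simp add: c_def divide_right_mono)
  next
    case False
    have "A (h, n) = {x \<in> {a..b}. int_dist (real h * x) \<le> 1 / real n}"
      using False by (auto simp: A_def field_simps)
    then have "measure lborel (A (h, n)) \<le> (real h * (b - a) + 2) * (2 * (1 / real n) / real h)"
      using measure_int_dist_le[OF ab that, of "1 / real n"] by simp
    also have "\<dots> \<le> (real h * (b - a + 2)) * (2 * (1 / real n) / real h)"
      using that by (intro mult_right_mono) (auto simp: algebra_simps)
    also have "\<dots> = 2 * (b - a + 2) / real n" using that by simp
    finally have "c (h, n) * measure lborel (A (h, n)) \<le> c (h, n) * (2 * (b - a + 2) / real n)"
      by (intro mult_left_mono) (auto simp: c_def)
    also have "\<dots> = (b - a + 2) * (2 * ((2 * real n + 1) / real n)) / (real h)\<^sup>2"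
      using False that by (simp add: c_def field_simps)
    also have "\<dots> \<le> (b - a + 2) * (2 * 3) / (real h)\<^sup>2"
      using False hb by (intro divide_right_mono mult_left_mono) (auto simp: field_simps)
    finally show ?thesis using False by simp
  qed
  have "(\<Sum>i\<in>I. c i * measure lborel (A i)) = (\<Sum>h\<in>{1..<8 ^ k}. \<Sum>n\<in>{..h * K * k}. c (h, n) * measure lborel (A (h, n)))"
    unfolding I_def by (subst sum.Sigma) auto
  also have "\<dots> \<le> (\<Sum>h\<in>{1..<8 ^ k}. 7 * (b - a + 2) * (real K * real k) * (1 / real h))"
  proof (rule sum_mono)
    fix h :: nat assume "h \<in> {1..<8 ^ k}"
    then have h: "h \<ge> 1" by simp
    have "(\<Sum>n\<in>{..h * K * k}. c (h, n) * measure lborel (A (h, n)))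
       \<le> (\<Sum>n\<in>{..h * K * k}. (b - a + 2) * (if n = 0 then 1 else 6) / (real h)\<^sup>2)"
      by (rule sum_mono) (rule Al[OF h])
    also have "\<dots> = (b - a + 2) / (real h)\<^sup>2 * (\<Sum>n\<in>{..h * K * k}. if n = 0 then 1 else 6)"
      by (simp add: sum_distrib_left)
    also have "(\<Sum>n\<in>{..h * K * k}. if n = 0 then 1 else 6) = 1 + 6 * real (h * K * k)"
      by (subst sum.atMost_shift) simp
    also have "1 + 6 * real (h * K * k) \<le> 7 * real (h * K * k)"
    proof -
      have "1 \<le> h * K * k" using h k K by simp
      then have "1 \<le> real (h * K * k)" by linarith
      then show ?thesis by linarith
    qed
    then have "(b - a + 2) / (real h)\<^sup>2 * (1 + 6 * real (h * K * k)) \<le> (b - a + 2) / (real h)\<^sup>2 * (7 * real (h * K * k))"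
      using hb by (intro mult_left_mono) auto
    also have "\<dots> = 7 * (b - a + 2) * (real K * real k) * (1 / real h)"
      using h by (simp add: field_simps power2_eq_square)
    finally show "(\<Sum>n\<in>{..h * K * k}. c (h, n) * measure lborel (A (h, n))) \<le> 7 * (b - a + 2) * (real K * real k) * (1 / real h)" .
  qed
  also have "\<dots> = 7 * (b - a + 2) * (real K * real k) * (\<Sum>h\<in>{1..<8 ^ k}. 1 / real h)"
    by (simp only: sum_distrib_left)
  also have "\<dots> \<le> 7 * (b - a + 2) * (real K * real k) * (4 * real k)"
    using hb harm_8_power_le[OF k] by (intro mult_left_mono) auto
  also have "\<dots> = 28 * (b - a + 2) / real K * T"
    using K by (simp add: T_def power2_eq_square field_simps)
  finally have "(\<Sum>i\<in>I. c i * measure lborel (A i)) / T \<le> 28 * (b - a + 2) / real K"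
    using T by (simp add: pos_divide_le_eq)
  moreover have "measure lborel B2 \<le> (\<Sum>i\<in>I. c i * measure lborel (A i)) / T"
    unfolding B2_def by (rule markov_indicator_sum(2)) (use fin c0 Am T in auto)
  ultimately have B2m: "measure lborel B2 \<le> 28 * (b - a + 2) / real K" by linarith
  have B2sub: "B2 \<subseteq> {a..b}"
  proof
    fix x assume x: "x \<in> B2"
    show "x \<in> {a..b}"
    proof (rule ccontr)
      assume "x \<notin> {a..b}"
      then have "indicator (A i) x = (0::real)" for i
        by (cases i) (auto simp: A_def)
      then have "(\<Sum>i\<in>I. c i * indicator (A i) x) = 0" by simp
      then show False using x T by (simp add: B2_def)
    qed
  qed
  have B2f: "B2 \<in> fmeasurable lborel"
    by (rule fmeasurableI2[OF _ B2sub B2s]) (auto intro!: fmeasurableI simp: emeasure_lborel_Icc_eq)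
  note B1 = measure_small_int_dist_le[OF ab k K, folded B1_def]
  have pos: "1 / real (h * K * k) < int_dist (real h * x)" if "x \<in> {a..b} - (B1 \<union> B2)" "h \<in> {1..<8 ^ k}" for x h
  proof (rule ccontr)
    assume "\<not> ?thesis"
    then have "x \<in> {x \<in> {a..b}. int_dist (real h * x) \<le> 1 / real (h * K * k)}" using that(1) by simp
    then have "x \<in> B1" unfolding B1_def using that(2) by blast
    then show False using that(1) by simp
  qed
  show thesis
  proof (rule that[of "B1 \<union> B2"])
    show "B1 \<union> B2 \<in> fmeasurable lborel" using B1(1) B2f by (rule fmeasurable.Un)
    have "measure lborel (B1 \<union> B2) \<le> measure lborel B1 + measure lborel B2"
      by (rule measure_Un_le) (use B1(1) B2s in \<open>auto dest: fmeasurableD\<close>)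
    then show "measure lborel (B1 \<union> B2) \<le> 36 * (b - a + 2) / real K"
      using B1(2) B2m by (simp add: add_divide_distrib diff_divide_distrib)
    show "0 < int_dist (real h * x)" if "x \<in> {a..b} - (B1 \<union> B2)" "h \<in> {1..<8 ^ k}" for x h
      using pos[OF that] by (rule le_less_trans[rotated]) simp
    show "(\<Sum>h\<in>{1..<8 ^ k}. 1 / (real h * int_dist (real h * x))\<^sup>2) \<le> (real K * real k)\<^sup>2"
      if x: "x \<in> {a..b} - (B1 \<union> B2)" for x
    proof -
      have "(\<Sum>h\<in>{1..<8 ^ k}. 1 / (real h * int_dist (real h * x))\<^sup>2)
         \<le> (\<Sum>h\<in>{1..<8 ^ k}. \<Sum>n\<in>{..h * K * k}. c (h, n) * indicator (A (h, n)) x)"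
      proof (rule sum_mono)
        fix h :: nat assume h: "h \<in> {1..<8 ^ k}"
        define t where "t = int_dist (real h * x)"
        have hKk: "real (h * K * k) > 0" using h k K by simp
        have tp: "1 / real (h * K * k) < t" unfolding t_def by (rule pos[OF x h])
        then have t0: "t > 0" using hKk by (smt (verit) divide_pos_pos)
        have "1 / t \<le> real (h * K * k)" using tp t0 hKk by (simp add: field_simps)
        from inverse_square_le_sum[OF t0 this]
        have "1 / (real h)\<^sup>2 * (1 / t\<^sup>2) \<le> 1 / (real h)\<^sup>2 * (\<Sum>n\<in>{..h * K * k}. (2 * real n + 1) * of_bool (real n * t \<le> 1))"
          by (intro mult_left_mono) auto
        also have "\<dots> = (\<Sum>n\<in>{..h * K * k}. c (h, n) * indicator (A (h, n)) x)"
          unfolding sum_distrib_left using x by (intro sum.cong refl) (auto simp: c_def A_def t_def indicator_def)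
        finally show "1 / (real h * int_dist (real h * x))\<^sup>2 \<le> (\<Sum>n\<in>{..h * K * k}. c (h, n) * indicator (A (h, n)) x)"
          by (simp add: t_def power_mult_distrib)
      qed
      also have "\<dots> = (\<Sum>i\<in>I. c i * indicator (A i) x)"
        unfolding I_def by (subst sum.Sigma) auto
      also have "\<dots> \<le> T" using x by (auto simp: B2_def)
      finally show ?thesis by (simp add: T_def)
    qed
  qed
qed

text \<open>These are the points that a denominator at most 8^(k-1) approximates as well as
  Dirichlet's theorem with bound 8^k promises. Scales grow by 8 because 8^(k-1) * 2/8^k = 1/4 leaves
  most of the interval.\<close>

lemma measure_small_denominator_le:
  fixes a b :: real and k :: nat
  assumes "a \<le> b" "k \<ge> 1"
  defines "B \<equiv> (\<Union>h\<in>{1..8 ^ (k - 1)}. {x \<in> {a..b}. int_dist (real h * x) \<le> 1 / 8 ^ k})"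
  shows "B \<in> fmeasurable lborel" "measure lborel B \<le> (b - a) / 4 + 16 * real k / 8 ^ k"
proof -
  have fm: "{x \<in> {a..b}. int_dist (real h * x) \<le> 1 / 8 ^ k} \<in> fmeasurable lborel" for h
    by (rule fmeasurable_Icc_sep) measurable
  then show "B \<in> fmeasurable lborel" unfolding B_def by (intro fmeasurable.finite_UN) auto
  have "measure lborel B \<le> (\<Sum>h\<in>{1..8 ^ (k - 1)}. measure lborel {x \<in> {a..b}. int_dist (real h * x) \<le> 1 / 8 ^ k})"
    unfolding B_def by (intro measure_UNION_le) (auto intro: fmeasurableD fm)
  also have "\<dots> \<le> (\<Sum>h\<in>{1..8 ^ (k - 1)}. (real h * (b - a) + 2) * (2 * (1 / 8 ^ k) / real h))"
    using assms(1) by (intro sum_mono measure_int_dist_le) auto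
  also have "\<dots> = (\<Sum>h\<in>{1..8 ^ (k - 1)}. 2 * (b - a) / 8 ^ k + 4 / 8 ^ k * (1 / real h))"
    by (intro sum.cong refl) (auto simp: field_simps)
  also have "\<dots> = real (8 ^ (k - 1)) * (2 * (b - a) / 8 ^ k) + 4 / 8 ^ k * (\<Sum>h\<in>{1..8 ^ (k - 1)}. 1 / real h)"
    by (simp only: sum.distrib sum_distrib_left[symmetric]) simp
  also have "real (8 ^ (k - 1)) * (2 * (b - a) / 8 ^ k) = (b - a) / 4"
    using assms(2) by (cases k) auto
  also have "(\<Sum>h\<in>{1..8 ^ (k - 1)}. 1 / real h) \<le> (\<Sum>h\<in>{1..<8 ^ k}. 1 / real h)"
  proof (rule sum_mono2)
    have "(8::nat) ^ (k - 1) < 8 ^ k" using assms(2) by (intro power_strict_increasing) auto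
    then show "{1..8 ^ (k - 1)} \<subseteq> {1..<8 ^ k :: nat}" by (meson atLeastAtMost_iff atLeastLessThan_iff le_less_trans subsetI)
  qed auto
  also have "\<dots> \<le> 4 * real k" by (rule harm_8_power_le[OF assms(2)])
  finally show "measure lborel B \<le> (b - a) / 4 + 16 * real k / 8 ^ k"
    by (simp add: divide_right_mono)
qed


section \<open>Abundance of good fractions\<close>

text \<open>Denominators are sorted into disjoint ranges, one for each scale k. As log q has order
  k, the threshold exp(T k) expresses a bound O(log q) for the logarithm of the product.\<close>

definition good_fraction :: "real \<Rightarrow> real \<Rightarrow> nat \<Rightarrow> int \<Rightarrow> nat \<Rightarrow> bool" where
  "good_fraction \<epsilon> T k p q \<longleftrightarrow> coprime p (int q) \<and> 8 ^ (k - 1) < q \<and> q \<le> 8 ^ k \<and>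
     real (card {r. r < q \<and> exp (T * real k) < sudler r (of_int p / real q)}) \<le> \<epsilon> * real q"

definition good_points :: "real \<Rightarrow> real \<Rightarrow> nat \<Rightarrow> real \<Rightarrow> real \<Rightarrow> real set" where
  "good_points \<epsilon> T k a b = {x \<in> {a..b}. \<exists>p q. good_fraction \<epsilon> T k p q \<and> x = of_int p / real q}"

section \<open>Separation and counting of good points\<close>

lemma separated_card_le:
  fixes X :: "real set" and a b d :: real
  assumes "X \<subseteq> {a..b}" "d > 0" "a \<le> b"
    and sep: "\<And>x y. x \<in> X \<Longrightarrow> y \<in> X \<Longrightarrow> x \<noteq> y \<Longrightarrow> d \<le> \<bar>x - y\<bar>"
  shows "finite X" "real (card X) \<le> (b - a) / d + 1"
proof -
  let ?f = "\<lambda>x. \<lfloor>(x - a) / d\<rfloor>"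
  have inj: "inj_on ?f X"
  proof (rule inj_onI, rule ccontr)
    fix x y assume xy: "x \<in> X" "y \<in> X" "?f x = ?f y" "x \<noteq> y"
    have "\<bar>(x - a) / d - (y - a) / d\<bar> < 1"
      using xy(3) by linarith
    then have "\<bar>x - y\<bar> / d < 1"
      using assms(2) by (simp add: diff_divide_distrib[symmetric] abs_divide)
    then have "\<bar>x - y\<bar> < d" using assms(2) by (simp add: field_simps)
    with sep[OF xy(1,2,4)] show False by simp
  qed
  have img: "?f ` X \<subseteq> {\<lceil>0::real\<rceil>..\<lfloor>(b - a) / d\<rfloor>}"
  proof
    fix j assume "j \<in> ?f ` X"
    then obtain x where x: "x \<in> X" "j = ?f x" by auto
    then have "0 \<le> (x - a) / d" "(x - a) / d \<le> (b - a) / d"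
      using assms(1,2) by (auto intro!: divide_right_mono)
    then show "j \<in> {\<lceil>0::real\<rceil>..\<lfloor>(b - a) / d\<rfloor>}" using x(2) by (auto intro: floor_mono)
  qed
  show "finite X" using inj img by (metis finite_atLeastAtMost_int finite_imageD finite_subset)
  have "card X = card (?f ` X)" using inj by (simp add: card_image)
  also have "\<dots> \<le> card {\<lceil>0::real\<rceil>..\<lfloor>(b - a) / d\<rfloor>}" using img by (rule card_mono[rotated]) simp
  finally have "real (card X) \<le> real (card {\<lceil>0::real\<rceil>..\<lfloor>(b - a) / d\<rfloor>})" by simp
  also have "\<dots> \<le> (b - a) / d - 0 + 1"
    using assms(2,3) by (intro card_int_between) auto
  finally show "real (card X) \<le> (b - a) / d + 1" by simp
qed

lemma fraction_separation:
  fixes p p' :: int and q q' :: nat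
  assumes "q > 0" "q' > 0" "of_int p / real q \<noteq> of_int p' / real q'"
  shows "1 / (real q * real q') \<le> \<bar>of_int p / real q - of_int p' / real q'\<bar>"
proof -
  have "p * int q' - p' * int q \<noteq> 0"
  proof
    assume "p * int q' - p' * int q = 0"
    then have "real_of_int (p * int q') = real_of_int (p' * int q)" by simp
    then have "of_int p * real q' = of_int p' * real q" by simp
    then show False using assms by (simp add: field_simps)
  qed
  then have "1 \<le> \<bar>p * int q' - p' * int q\<bar>" by linarith
  then have "1 \<le> \<bar>real_of_int (p * int q' - p' * int q)\<bar>" by linarith
  then have "1 / (real q * real q') \<le> \<bar>real_of_int (p * int q' - p' * int q)\<bar> / (real q * real q')"
    by (intro divide_right_mono) auto
  also have "\<dots> = \<bar>real_of_int (p * int q' - p' * int q) / (real q * real q')\<bar>"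
    by (simp add: abs_divide abs_mult)
  also have "real_of_int (p * int q' - p' * int q) / (real q * real q') = of_int p / real q - of_int p' / real q'"
    using assms by (simp add: field_simps)
  finally show ?thesis .
qed

lemma reduced_fraction_denominator_unique:
  fixes p p' :: int and q q' :: nat
  assumes "coprime p (int q)" "coprime p' (int q')" "q > 0" "q' > 0"
    and eq: "of_int p / real q = of_int p' / real q'"
  shows "q = q'"
proof -
  have "of_int p * real q' = of_int p' * real q" using eq assms by (simp add: field_simps)
  then have e: "p * int q' = p' * int q" by (metis of_int_eq_iff of_int_mult of_int_of_nat_eq)
  have "int q dvd p * int q'" "int q' dvd p' * int q" using e by (metis dvd_triv_right)+
  then have "int q dvd int q'" "int q' dvd int q"
    using assms by (simp_all add: coprime_dvd_mult_right_iff coprime_commute)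
  then show ?thesis by (simp add: dvd_antisym)
qed

lemma good_points_separated:
  assumes "x \<in> good_points \<epsilon> T k a b" "y \<in> good_points \<epsilon> T j a b" "x \<noteq> y"
  shows "1 / 8 ^ (k + j) \<le> \<bar>x - y\<bar>"
proof -
  obtain p q where 1: "good_fraction \<epsilon> T k p q" "x = of_int p / real q"
    using assms(1) by (auto simp: good_points_def)
  obtain p' q' where 2: "good_fraction \<epsilon> T j p' q'" "y = of_int p' / real q'"
    using assms(2) by (auto simp: good_points_def)
  have q: "0 < q" "q \<le> 8 ^ k" "0 < q'" "q' \<le> 8 ^ j" using 1 2 by (auto simp: good_fraction_def)
  have "real q \<le> real (8 ^ k)" "real q' \<le> real (8 ^ j)" using q by (simp_all only: of_nat_le_iff)
  then have "real q * real q' \<le> 8 ^ k * 8 ^ j" by (intro mult_mono) auto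
  then have "1 / 8 ^ (k + j) \<le> 1 / (real q * real q')"
    using q by (intro divide_left_mono) (auto simp: power_add)
  also have "\<dots> \<le> \<bar>x - y\<bar>" using fraction_separation[of q q' p p'] q 1 2 assms(3) by simp
  finally show ?thesis .
qed

text \<open>A reduced fraction determines its denominator, and the denominator ranges of different
  scales are disjoint. Hence the separation bound applies to good points of two different scales as
  well.\<close>

lemma good_points_disjoint:
  assumes "x \<in> good_points \<epsilon> T k a b" "y \<in> good_points \<epsilon> T j a b" "k < j"
  shows "x \<noteq> y"
proof
  assume "x = y"
  obtain p q where 1: "good_fraction \<epsilon> T k p q" "x = of_int p / real q"
    using assms(1) by (auto simp: good_points_def)
  obtain p' q' where 2: "good_fraction \<epsilon> T j p' q'" "y = of_int p' / real q'"
    using assms(2) by (auto simp: good_points_def)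
  have "q = q'"
    by (rule reduced_fraction_denominator_unique[of p q p' q'])
       (use 1 2 \<open>x = y\<close> in \<open>auto simp: good_fraction_def\<close>)
  moreover have "(8::nat) ^ k \<le> 8 ^ (j - 1)" using assms(3) by (intro power_increasing) auto
  moreover have "q \<le> 8 ^ k" "8 ^ (j - 1) < q'" using 1 2 by (auto simp: good_fraction_def)
  ultimately show False by linarith
qed

lemma good_points_card_le:
  assumes "u \<le> v"
  shows "finite (good_points \<epsilon> T k a b \<inter> {u..v})"
    "real (card (good_points \<epsilon> T k a b \<inter> {u..v})) \<le> (v - u) * 64 ^ k + 1"
proof -
  have sep: "1 / 64 ^ k \<le> \<bar>x - y\<bar>"
    if "x \<in> good_points \<epsilon> T k a b \<inter> {u..v}" "y \<in> good_points \<epsilon> T k a b \<inter> {u..v}" "x \<noteq> y" for x y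
    using good_points_separated[of x \<epsilon> T k a b y k] that by (simp add: power_add flip: power_mult_distrib)
  show "finite (good_points \<epsilon> T k a b \<inter> {u..v})"
    by (rule separated_card_le(1)[of _ u v "1 / 64 ^ k"]) (use sep assms in auto)
  have "real (card (good_points \<epsilon> T k a b \<inter> {u..v})) \<le> (v - u) / (1 / 64 ^ k) + 1"
    by (rule separated_card_le(2)) (use sep assms in auto)
  then show "real (card (good_points \<epsilon> T k a b \<inter> {u..v})) \<le> (v - u) * 64 ^ k + 1" by simp
qed

text \<open>For i < q, replacing x by p/q moves ix by at most 1/q \<le>
  \<open>int_dist (i p/q)\<close>. Thus \<open>int_dist (i x)\<close> is at most twice that
  distance, and the variance bound at p/q is at most 4 times the one at x.\<close>

lemma good_fractionI:
  fixes p :: int and q k K :: nat and x \<epsilon> :: real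
  assumes cop: "coprime p (int q)" and q: "8 ^ (k - 1) < q" "q \<le> 8 ^ k" and k: "k \<ge> 2" and K: "K \<ge> 1"
    and \<epsilon>: "\<epsilon> > 0"
    and close: "\<bar>real q * x - of_int p\<bar> \<le> 1 / 8 ^ k"
    and pos: "\<And>h. h \<in> {1..<8 ^ k} \<Longrightarrow> 0 < int_dist (real h * x)"
    and V: "(\<Sum>h\<in>{1..<8 ^ k}. 1 / (real h * int_dist (real h * x))\<^sup>2) \<le> (real K * real k)\<^sup>2"
  shows "good_fraction \<epsilon> (6 + real K / sqrt \<epsilon>) k p q"
proof -
  have "(8::nat) ^ 1 \<le> 8 ^ (k - 1)" using k by (intro power_increasing) auto
  then have q2: "q \<ge> 2" using q by simp
  then have q0: "q > 0" by simp
  have q8: "real q \<le> 8 ^ k" using q(2) by (metis of_nat_le_iff of_nat_numeral of_nat_power)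
  have cmp: "int_dist (real i * x) \<le> 2 * int_dist (real i * of_int p / real q)" if i: "i \<in> {1..<q}" for i
  proof -
    have "\<not> q dvd i" using i by (auto dest: dvd_imp_le)
    note lower = int_dist_fraction_ge[OF cop q0 this]
    have "int_dist (real i * x) \<le> int_dist (real i * of_int p / real q) + \<bar>real i * (x - of_int p / real q)\<bar>"
      using int_dist_add_le[of "real i * of_int p / real q" "real i * (x - of_int p / real q)"]
      by (simp add: right_diff_distrib)
    also have "\<bar>real i * (x - of_int p / real q)\<bar> = real i / real q * \<bar>real q * x - of_int p\<bar>"
    proof -
      have "real i * (x - of_int p / real q) = real i / real q * (real q * x - of_int p)"
        using q0 by (simp add: field_simps)
      then show ?thesis by (simp add: abs_mult)
    qed
    also have "\<dots> \<le> 1 * (1 / 8 ^ k)"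
      using i close by (intro mult_mono) auto
    also have "1 * (1 / 8 ^ k) \<le> 1 / real q" using q8 q0 by (simp add: frac_le)
    also have "\<dots> \<le> int_dist (real i * of_int p / real q)" by (rule lower)
    finally show ?thesis by simp
  qed
  \<comment> \<open>Chosen so that 4 (K k)^2 = 4 t^2 \<epsilon>, which turns Chebyshev's bound into
    the proportion \<epsilon>.\<close>
  define t where "t = real K * real k / sqrt \<epsilon>"
  have t: "t > 0" using K k \<epsilon> by (simp add: t_def)
  have "(\<Sum>i\<in>{1..<q}. 1 / (real i * int_dist (real i * of_int p / real q))\<^sup>2)
     \<le> (\<Sum>i\<in>{1..<q}. 4 * (1 / (real i * int_dist (real i * x))\<^sup>2))"
  proof (rule sum_mono)
    fix i assume i: "i \<in> {1..<q}"
    have n: "0 < int_dist (real i * x)" using pos[of i] i q(2) by auto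
    have "1 / (real i * int_dist (real i * of_int p / real q))\<^sup>2 \<le> 1 / (real i * (int_dist (real i * x) / 2))\<^sup>2"
      using cmp[OF i] n i by (intro divide_left_mono power_mono mult_left_mono mult_pos_pos zero_less_power) auto
    also have "\<dots> = 4 * (1 / (real i * int_dist (real i * x))\<^sup>2)" by (simp add: power_mult_distrib power_divide)
    finally show "1 / (real i * int_dist (real i * of_int p / real q))\<^sup>2 \<le> 4 * (1 / (real i * int_dist (real i * x))\<^sup>2)" .
  qed
  also have "\<dots> \<le> (\<Sum>i\<in>{1..<8 ^ k}. 4 * (1 / (real i * int_dist (real i * x))\<^sup>2))"
    using q(2) by (intro sum_mono2) auto
  also have "\<dots> = 4 * (\<Sum>i\<in>{1..<8 ^ k}. 1 / (real i * int_dist (real i * x))\<^sup>2)" by (simp only: sum_distrib_left)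
  also have "\<dots> \<le> 4 * (real K * real k)\<^sup>2" using V by simp
  also have "\<dots> = 4 * t\<^sup>2 * \<epsilon>" using \<epsilon> by (simp add: t_def power_divide)
  finally have W: "(\<Sum>i\<in>{1..<q}. 1 / (real i * int_dist (real i * of_int p / real q))\<^sup>2) \<le> 4 * t\<^sup>2 * \<epsilon>" .
  let ?B = "{r. r < q \<and> exp (3 + ln (real q) + t) < sudler r (of_int p / real q)}"
  have "real (card ?B) * (4 * t\<^sup>2) \<le> real q * (4 * t\<^sup>2 * \<epsilon>)"
    using few_large_sudler[OF cop q2 t] mult_left_mono[OF W, of "real q"] by linarith
  then have "real (card ?B) * (4 * t\<^sup>2) \<le> (\<epsilon> * real q) * (4 * t\<^sup>2)" by (simp add: mult_ac)
  then have cB: "real (card ?B) \<le> \<epsilon> * real q" using t by (simp add: mult_le_cancel_right)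
  have "3 + ln (real q) + t \<le> (6 + real K / sqrt \<epsilon>) * real k"
  proof -
    have "ln (real q) \<le> ln (real (8 ^ k))" using q0 q(2) by (subst ln_le_cancel_iff) auto
    then have "ln (real q) \<le> 4 * real k - 1" using one_plus_ln_8_power[of k] k by simp
    moreover have "2 \<le> real k" using k by simp
    ultimately have "3 + ln (real q) \<le> 6 * real k" by linarith
    then show ?thesis by (simp add: t_def distrib_right)
  qed
  then have "{r. r < q \<and> exp ((6 + real K / sqrt \<epsilon>) * real k) < sudler r (of_int p / real q)} \<subseteq> ?B"
    by (auto intro: le_less_trans)
  then have "card {r. r < q \<and> exp ((6 + real K / sqrt \<epsilon>) * real k) < sudler r (of_int p / real q)} \<le> card ?B"
    by (intro card_mono) auto
  then have "real (card {r. r < q \<and> exp ((6 + real K / sqrt \<epsilon>) * real k) < sudler r (of_int p / real q)}) \<le> \<epsilon> * real q"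
    using cB by linarith
  then show ?thesis unfolding good_fraction_def using cop q by blast
qed

text \<open>Outside two small exceptional sets, every x is within 8/64^k of a good fraction, namely
  its Dirichlet approximation. Comparing measures then forces many good fractions. Only T depends on
  \<epsilon> and on the interval; the proportion 1/64 does not.\<close>

lemma many_good_points:
  fixes a b \<epsilon> :: real
  assumes ab: "a < b" and \<epsilon>: "\<epsilon> > 0"
  obtains T where "T \<ge> 0"
    "\<forall>\<^sub>F k in sequentially. (b - a) * 64 ^ k / 64 \<le> real (card (good_points \<epsilon> T k a b))"
proof -
  define l where "l = b - a"
  have l: "l > 0" using ab by (simp add: l_def)
  \<comment> \<open>A margin of l/8 on both sides keeps the approximating fraction inside the
    original interval.\<close>
  define a' where "a' = a + l / 8"
  define b' where "b' = b - l / 8"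
  have l': "b' - a' = 3 * l / 4" by (simp add: a'_def b'_def l_def field_simps)
  then have ab': "a' \<le> b'" using l by linarith
  \<comment> \<open>Here 576 = 36 * 16, so that 36 (l + 2)/K is at most l/16.\<close>
  obtain K0 :: nat where K0: "576 * (l + 2) / l \<le> real K0" using real_arch_simple by blast
  define K where "K = max 1 K0"
  have K: "K \<ge> 1" "576 * (l + 2) / l \<le> real K" using K0 by (auto simp: K_def)
  define T where "T = 6 + real K / sqrt \<epsilon>"
  have main: "(b - a) * 64 ^ k / 64 \<le> real (card (good_points \<epsilon> T k a b))"
    if k: "k \<ge> 2" "16 * real k / 8 ^ k \<le> l / 16" "1 / 8 ^ k \<le> l / 8" for k
  proof -
    have k1: "k \<ge> 1" using k by simp
    obtain B where B: "B \<in> fmeasurable lborel" "measure lborel B \<le> 36 * (b' - a' + 2) / real K"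
      "\<And>x h. x \<in> {a'..b'} - B \<Longrightarrow> h \<in> {1..<8 ^ k} \<Longrightarrow> 0 < int_dist (real h * x)"
      "\<And>x. x \<in> {a'..b'} - B \<Longrightarrow> (\<Sum>h\<in>{1..<8 ^ k}. 1 / (real h * int_dist (real h * x))\<^sup>2) \<le> (real K * real k)\<^sup>2"
      using measure_exceptional_le[OF ab' k1 K(1)] by blast
    define B' where "B' = (\<Union>h\<in>{1..8 ^ (k - 1)}. {x \<in> {a'..b'}. int_dist (real h * x) \<le> 1 / 8 ^ k})"
    note B' = measure_small_denominator_le[OF ab' k1, folded B'_def]
    have Bs: "measure lborel B \<le> l / 16"
    proof -
      have "36 * (b' - a' + 2) / real K \<le> 36 * (l + 2) / real K"
        using l l' by (intro divide_right_mono) auto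
      also have "\<dots> \<le> l / 16"
      proof -
        have "576 * (l + 2) \<le> real K * l" using K(2) l by (simp add: pos_divide_le_eq)
        then show ?thesis using K(1) by (simp add: pos_divide_le_eq field_simps)
      qed
      finally show ?thesis using B(2) by linarith
    qed
    let ?G = "good_points \<epsilon> T k a b"
    have fin: "finite ?G"
      using good_points_card_le(1)[of a b \<epsilon> T k a b] ab by (simp add: good_points_def Int_def conj_ac)
    have sub: "{a'..b'} \<subseteq> (\<Union>y\<in>?G. {y - 8 / 64 ^ k..y + 8 / 64 ^ k}) \<union> (B \<union> B')"
    proof
      fix x assume x: "x \<in> {a'..b'}"
      show "x \<in> (\<Union>y\<in>?G. {y - 8 / 64 ^ k..y + 8 / 64 ^ k}) \<union> (B \<union> B')"
      proof (cases "x \<in> B \<union> B'")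
        case False
        \<comment> \<open>Dirichlet approximation with bound 8^k. Off \<open>B'\<close> its
          denominator exceeds 8^(k-1), so it belongs to scale k; off \<open>B\<close> the criterion
          \<open>good_fractionI\<close> applies.\<close>
        obtain p kk where pk: "coprime p kk" "0 < kk" "kk \<le> int (8 ^ k)" "\<bar>of_int kk * x - of_int p\<bar> < 1 / real (8 ^ k)"
          using Dirichlet_approx_coprime[of "8 ^ k" x] by auto
        define q where "q = nat kk"
        have kk: "kk = int q" using pk(2) by (simp add: q_def)
        have q: "coprime p (int q)" "0 < q" "q \<le> 8 ^ k" "\<bar>real q * x - of_int p\<bar> \<le> 1 / 8 ^ k"
          using pk unfolding kk by auto
        have big: "8 ^ (k - 1) < q"
        proof (rule ccontr)
          assume "\<not> 8 ^ (k - 1) < q"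
          then have "q \<in> {1..8 ^ (k - 1)}" using q by auto
          moreover have "int_dist (real q * x) \<le> 1 / 8 ^ k" using int_dist_le[of "real q * x" p] q(4) by linarith
          ultimately have "x \<in> B'" using x unfolding B'_def by blast
          then show False using False by simp
        qed
        have good: "good_fraction \<epsilon> T k p q"
          unfolding T_def using q big k(1) K(1) \<epsilon> B(3)[of x] B(4)[of x] x False
          by (intro good_fractionI[where x=x]) auto
        have "\<bar>x - of_int p / real q\<bar> = \<bar>real q * x - of_int p\<bar> / real q"
        proof -
          have "x - of_int p / real q = (real q * x - of_int p) / real q" using q(2) by (simp add: field_simps)
          then show ?thesis by (metis abs_divide abs_of_nat)
        qed
        also have "\<dots> \<le> (1 / 8 ^ k) / real q" using q(4) by (intro divide_right_mono) auto
        finally have d: "\<bar>x - of_int p / real q\<bar> \<le> (1 / 8 ^ k) / real q" .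
        also have "\<dots> \<le> (1 / 8 ^ k) / (8 ^ k / 8)"
        proof -
          have "8 ^ k / 8 = real (8 ^ (k - 1))" using k1 by (cases k) auto
          also have "\<dots> \<le> real q" using big by (simp only: of_nat_le_iff)
          finally show ?thesis using q(2) by (intro divide_left_mono) auto
        qed
        also have "\<dots> = 8 / 64 ^ k" by (simp flip: power_mult_distrib)
        finally have d2: "\<bar>x - of_int p / real q\<bar> \<le> 8 / 64 ^ k" .
        have "(1 / 8 ^ k) / real q \<le> (1 / 8 ^ k) / 1" using q(2) by (intro divide_left_mono) auto
        then have "\<bar>x - of_int p / real q\<bar> \<le> l / 8" using d k(3) by linarith
        moreover have "a + l / 8 \<le> x" "x \<le> b - l / 8" using x by (auto simp: a'_def b'_def)
        ultimately have "of_int p / real q \<in> {a..b}" unfolding atLeastAtMost_iff by linarith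
        then have "of_int p / real q \<in> ?G" using good by (auto simp: good_points_def)
        moreover have "x \<in> {of_int p / real q - 8 / 64 ^ k..of_int p / real q + 8 / 64 ^ k}"
          unfolding atLeastAtMost_iff using d2 by linarith
        ultimately show ?thesis by blast
      qed auto
    qed
    have BB: "B \<in> sets lborel" "B' \<in> sets lborel" using B(1) B'(1) by (auto dest: fmeasurableD)
    have "3 * l / 4 = measure lborel {a'..b'}" using ab' l' by simp
    also have "\<dots> \<le> measure lborel ((\<Union>y\<in>?G. {y - 8 / 64 ^ k..y + 8 / 64 ^ k}) \<union> (B \<union> B'))"
    proof (rule measure_mono_fmeasurable[OF sub])
      show "(\<Union>y\<in>?G. {y - 8 / 64 ^ k..y + 8 / 64 ^ k}) \<union> (B \<union> B') \<in> fmeasurable lborel"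
        using B(1) B'(1) fin
        by (intro fmeasurable.Un fmeasurable.finite_UN) (auto intro!: fmeasurableI simp: emeasure_lborel_Icc_eq)
    qed auto
    also have "\<dots> \<le> measure lborel (\<Union>y\<in>?G. {y - 8 / 64 ^ k..y + 8 / 64 ^ k}) + measure lborel (B \<union> B')"
      using BB fin by (intro measure_Un_le sets.finite_UN sets.Un) auto
    also have "measure lborel (B \<union> B') \<le> measure lborel B + measure lborel B'"
      using BB by (intro measure_Un_le) auto
    also have "measure lborel (\<Union>y\<in>?G. {y - 8 / 64 ^ k..y + 8 / 64 ^ k}) \<le> (\<Sum>y\<in>?G. measure lborel {y - 8 / 64 ^ k..y + 8 / 64 ^ k})"
      using fin by (intro measure_UNION_le) auto
    also have "\<dots> = real (card ?G) * (16 / 64 ^ k)" by simp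
    finally have "3 * l / 4 \<le> real (card ?G) * (16 / 64 ^ k) + (measure lborel B + measure lborel B')" by simp
    also have "measure lborel B' \<le> l / 4"
    proof -
      have "measure lborel B' \<le> (3 * l / 4) / 4 + 16 * real k / 8 ^ k" using B'(2) unfolding l' .
      also have "\<dots> \<le> (3 * l / 4) / 4 + l / 16" using k(2) by (rule add_left_mono)
      finally show ?thesis by simp
    qed
    \<comment> \<open>Of the length 3l/4, at most l/16 is lost to \<open>B\<close> and l/4 to
      \<open>B'\<close>; the rest is covered by intervals of length 16/64^k.\<close>
    finally have "7 * l / 16 \<le> real (card ?G) * (16 / 64 ^ k)" using Bs by linarith
    then have "7 * l / 256 * 64 ^ k \<le> real (card ?G)" by (simp add: field_simps)
    moreover have "l / 64 * 64 ^ k \<le> 7 * l / 256 * 64 ^ k" using l by (intro mult_right_mono) auto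
    ultimately have "l / 64 * 64 ^ k \<le> real (card ?G)" by linarith
    then show ?thesis by (simp add: l_def)
  qed
  have lim: "(\<lambda>k. 16 * real k / 8 ^ k) \<longlonglongrightarrow> 0" "(\<lambda>k. 1 / 8 ^ k :: real) \<longlonglongrightarrow> 0" by real_asymp+
  have "\<forall>\<^sub>F k in sequentially. 16 * real k / 8 ^ k < l / 16" "\<forall>\<^sub>F k in sequentially. 1 / 8 ^ k < l / 8"
    by (rule order_tendstoD(2)[OF lim(1)], use l in simp) (rule order_tendstoD(2)[OF lim(2)], use l in simp)
  then have "\<forall>\<^sub>F k in sequentially. (b - a) * 64 ^ k / 64 \<le> real (card (good_points \<epsilon> T k a b))"
    using eventually_ge_at_top[of 2] by eventually_elim (rule main; simp)
  moreover have "T \<ge> 0" using \<epsilon> by (simp add: T_def)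
  ultimately show thesis using that by blast
qed


section \<open>The limsup set\<close>

text \<open>The second-moment lower bound is \<open>\<integral>(\<lambda>X - 1\<^sub>U)\<^sup>2 \<ge> 0\<close> with \<open>X\<close> the counting function of the
  sets and \<open>U\<close> their union, at a near-optimal constant \<open>\<lambda> = t\<close>.\<close>

lemma measure_Union_ge_second_moment:
  fixes E :: "nat \<Rightarrow> real set" and t :: real
  assumes "finite F" and E: "\<And>k. k \<in> F \<Longrightarrow> E k \<in> fmeasurable lborel" and t: "t \<ge> 0"
  shows "2 * t * (\<Sum>k\<in>F. measure lborel (E k)) - t\<^sup>2 * (\<Sum>k\<in>F. \<Sum>j\<in>F. measure lborel (E k \<inter> E j))
     \<le> measure lborel (\<Union>k\<in>F. E k)"
proof -
  let ?U = "\<Union>k\<in>F. E k"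
  let ?f = "\<lambda>x. 2 * t * (\<Sum>k\<in>F. indicator (E k) x) - t\<^sup>2 * (\<Sum>k\<in>F. \<Sum>j\<in>F. indicator (E k \<inter> E j) x) :: real"
  have U: "?U \<in> fmeasurable lborel" using assms by (intro fmeasurable.finite_UN) auto
  have int: "integrable lborel (indicator S :: real \<Rightarrow> real)" if "S \<in> fmeasurable lborel" for S
    using that by (auto simp: fmeasurable_def)
  have EE: "E k \<inter> E j \<in> fmeasurable lborel" if "k \<in> F" "j \<in> F" for k j
    by (intro fmeasurable_Int_fmeasurable fmeasurableD E that)
  have "(\<integral>x. ?f x \<partial>lborel) \<le> (\<integral>x. indicator ?U x \<partial>lborel)"
  proof (rule integral_mono)
    show "integrable lborel ?f"
      by (intro Bochner_Integration.integrable_diff integrable_mult_right Bochner_Integration.integrable_sum int E EE)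
    show "integrable lborel (indicator ?U :: real \<Rightarrow> real)" by (rule int[OF U])
    fix x :: real
    define X where "X = (\<Sum>k\<in>F. indicator (E k) x :: real)"
    have XX: "(\<Sum>k\<in>F. \<Sum>j\<in>F. indicator (E k \<inter> E j) x) = X\<^sup>2"
      unfolding X_def power2_eq_square by (simp only: indicator_inter_arith sum_product)
    show "?f x \<le> indicator ?U x"
    proof (cases "x \<in> ?U")
      case True
      have "0 \<le> (t * X - 1)\<^sup>2" by simp
      then have "2 * t * X - t\<^sup>2 * X\<^sup>2 \<le> 1" by (simp add: power2_eq_square algebra_simps)
      then show ?thesis using True unfolding XX by (simp add: X_def)
    next
      case False
      then have "X = 0" by (auto simp: X_def indicator_def intro!: sum.neutral)
      then show ?thesis using False unfolding XX by (simp add: X_def)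
    qed
  qed
  also have "(\<integral>x. indicator ?U x \<partial>lborel) = measure lborel ?U" by simp
  also have "(\<integral>x. ?f x \<partial>lborel) = 2 * t * (\<Sum>k\<in>F. measure lborel (E k)) - t\<^sup>2 * (\<Sum>k\<in>F. \<Sum>j\<in>F. measure lborel (E k \<inter> E j))"
    by (subst Bochner_Integration.integral_diff)
       (auto intro!: integrable_mult_right Bochner_Integration.integrable_sum int E EE
          simp: Bochner_Integration.integral_sum int E EE integrable_mult_right Bochner_Integration.integrable_sum)
  finally show ?thesis .
qed

text \<open>A Borel-Cantelli lemma for quasi-independent sets. The second moment bound for finite
  unions is uniform in the starting index, so it survives the decreasing limit of the tail
  unions.\<close>

lemma measure_limsup_ge:
  fixes E :: "nat \<Rightarrow> real set" and w :: "nat \<Rightarrow> real" and c1 c2 c3 :: real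
  assumes E: "\<And>k. E k \<in> sets lborel" "\<And>k. E k \<subseteq> {u..v}"
    and w: "\<And>k. 0 \<le> w k" "\<not> summable w"
    and c: "c1 > 0" "c2 > 0" "c3 > 0"
    and lower: "\<And>k. k \<ge> k0 \<Longrightarrow> c1 * w k \<le> measure lborel (E k)"
    and upper: "\<And>k. k \<ge> k0 \<Longrightarrow> measure lborel (E k) \<le> c2 * w k"
    and pair: "\<And>k j. k \<ge> k0 \<Longrightarrow> k < j \<Longrightarrow> measure lborel (E k \<inter> E j) \<le> c3 * (w k * w j)"
  shows "c1\<^sup>2 / (c2 + c3) \<le> measure lborel (\<Inter>n. \<Union>k\<in>{n..}. E k)"
proof -
  have uv: "{u..v} \<in> fmeasurable lborel" by (auto intro!: fmeasurableI simp: emeasure_lborel_Icc_eq)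
  have Ef: "E k \<in> fmeasurable lborel" for k by (rule fmeasurableI2[OF uv E(2) E(1)])
  define U where "U n = (\<Union>k\<in>{n..}. E k)" for n
  have Us: "U n \<in> sets lborel" for n unfolding U_def using E(1) by auto
  have Usub: "U n \<subseteq> {u..v}" for n unfolding U_def using E(2) by auto
  have Uf: "U n \<in> fmeasurable lborel" for n by (rule fmeasurableI2[OF uv Usub Us])
  have ge: "c1\<^sup>2 / (c2 + c3) \<le> measure lborel (U n)" if n: "n \<ge> k0" for n
  proof -
    \<comment> \<open>Total weight at least 1 lets the diagonal contribution c2 W be absorbed into
      c2 W^2.\<close>
    have "\<exists>m. 1 \<le> (\<Sum>k\<in>{n..<m}. w k)"
    proof (rule ccontr)
      assume "\<not> ?thesis"
      then have less: "(\<Sum>k\<in>{n..<m}. w k) < 1" for m by (meson not_le)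
      have "summable (\<lambda>k. w (k + n))"
      proof (rule bounded_imp_summable)
        show "0 \<le> w (k + n)" for k by (rule w)
        show "(\<Sum>k\<le>m. w (k + n)) \<le> 1" for m
        proof -
          have "(\<Sum>k\<le>m. w (k + n)) = (\<Sum>k\<in>{n..<n + Suc m}. w k)"
            by (rule sum.reindex_bij_witness[where i="\<lambda>k. k - n" and j="\<lambda>k. k + n"]) auto
          then show ?thesis using less[of "n + Suc m"] by simp
        qed
      qed
      then show False using w(2) by (simp add: summable_iff_shift)
    qed
    then obtain m where m: "1 \<le> (\<Sum>k\<in>{n..<m}. w k)" by blast
    define F where "F = {n..<m}"
    define W where "W = (\<Sum>k\<in>F. w k)"
    have W1: "1 \<le> W" using m by (simp add: W_def F_def)
    have Fge: "k \<ge> k0" if "k \<in> F" for k using that n by (auto simp: F_def)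
    \<comment> \<open>The maximiser of 2 t c1 W - t^2 (c2 + c3) W^2; the maximum no longer contains
      W.\<close>
    define t where "t = c1 / ((c2 + c3) * W)"
    have t: "t \<ge> 0" using c W1 by (simp add: t_def)
    have s1: "c1 * W \<le> (\<Sum>k\<in>F. measure lborel (E k))"
      unfolding W_def sum_distrib_left by (intro sum_mono lower Fge)
    have s2: "(\<Sum>k\<in>F. \<Sum>j\<in>F. measure lborel (E k \<inter> E j)) \<le> (c2 + c3) * W\<^sup>2"
    proof -
      have "(\<Sum>k\<in>F. \<Sum>j\<in>F. measure lborel (E k \<inter> E j)) \<le> (\<Sum>k\<in>F. \<Sum>j\<in>F. (if j = k then c2 * w k else 0) + c3 * (w k * w j))"
      proof (intro sum_mono)
        fix k j assume kj: "k \<in> F" "j \<in> F"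
        have ww: "0 \<le> c3 * (w k * w j)" using c w(1) by simp
        consider "k < j" | "j < k" | "j = k" by linarith
        then show "measure lborel (E k \<inter> E j) \<le> (if j = k then c2 * w k else 0) + c3 * (w k * w j)"
        proof cases
          case 1
          then show ?thesis using pair[OF Fge[OF kj(1)] 1] by simp
        next
          case 2
          then show ?thesis using pair[OF Fge[OF kj(2)] 2] by (simp add: Int_commute mult_ac)
        next
          case 3
          then show ?thesis using upper[OF Fge[OF kj(1)]] ww by simp
        qed
      qed
      also have "\<dots> = c2 * W + c3 * W\<^sup>2"
      proof -
        have "finite F" by (simp add: F_def)
        then have "(\<Sum>k\<in>F. \<Sum>j\<in>F. if j = k then c2 * w k else 0) = c2 * W"
          by (simp add: W_def sum_distrib_left)
        moreover have "(\<Sum>k\<in>F. \<Sum>j\<in>F. c3 * (w k * w j)) = c3 * W\<^sup>2"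
          unfolding W_def power2_eq_square sum_product by (simp only: sum_distrib_left)
        ultimately show ?thesis by (simp only: sum.distrib)
      qed
      also have "\<dots> \<le> c2 * W\<^sup>2 + c3 * W\<^sup>2"
        using W1 c by (simp add: power2_eq_square)
      finally show ?thesis by (simp add: distrib_right)
    qed
    have "c1\<^sup>2 / (c2 + c3) = 2 * t * (c1 * W) - t\<^sup>2 * ((c2 + c3) * W\<^sup>2)"
    proof -
      define d where "d = c2 + c3"
      have "d > 0" using c by (simp add: d_def)
      then have "2 * t * (c1 * W) = 2 * (c1\<^sup>2 / d)" "t\<^sup>2 * (d * W\<^sup>2) = c1\<^sup>2 / d"
        using W1 by (simp_all add: t_def field_simps power2_eq_square flip: d_def)
      then show ?thesis unfolding d_def[symmetric] by linarith
    qed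
    also have "\<dots> \<le> 2 * t * (\<Sum>k\<in>F. measure lborel (E k)) - t\<^sup>2 * (\<Sum>k\<in>F. \<Sum>j\<in>F. measure lborel (E k \<inter> E j))"
      using s1 s2 t by (intro diff_mono mult_left_mono) auto
    also have "\<dots> \<le> measure lborel (\<Union>k\<in>F. E k)"
      by (rule measure_Union_ge_second_moment) (use Ef t in \<open>auto simp: F_def\<close>)
    also have "\<dots> \<le> measure lborel (U n)"
      by (rule measure_mono_fmeasurable) (use Uf E(1) in \<open>auto simp: U_def F_def\<close>)
    finally show ?thesis .
  qed
  have "(\<lambda>n. measure lborel (U n)) \<longlonglongrightarrow> measure lborel (\<Inter>n. U n)"
  proof (rule Lim_measure_decseq)
    show "range U \<subseteq> sets lborel" using Us by auto
    show "decseq U" unfolding decseq_def U_def by fastforce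
    show "emeasure lborel (U n) \<noteq> \<infinity>" for n using Uf[of n] by (auto simp: fmeasurable_def)
  qed
  then have "c1\<^sup>2 / (c2 + c3) \<le> measure lborel (\<Inter>n. U n)"
    by (rule LIMSEQ_le_const) (use ge in blast)
  then show ?thesis by (simp add: U_def)
qed

lemma measure_separated_intervals:
  fixes X :: "real set" and s :: real
  assumes "finite X" "s \<ge> 0" "\<And>x y. x \<in> X \<Longrightarrow> y \<in> X \<Longrightarrow> x \<noteq> y \<Longrightarrow> 2 * s < \<bar>x - y\<bar>"
  shows "measure lborel (\<Union>x\<in>X. {x - s..x + s}) = 2 * s * real (card X)"
proof -
  have "measure lborel (\<Union>x\<in>X. {x - s..x + s}) = (\<Sum>x\<in>X. measure lborel {x - s..x + s})"
  proof (rule measure_finite_Union[OF assms(1)])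
    show "disjoint_family_on (\<lambda>x. {x - s..x + s}) X"
      unfolding disjoint_family_on_def
    proof (intro ballI impI)
      fix x y assume "x \<in> X" "y \<in> X" "x \<noteq> y"
      from assms(3)[OF this] show "{x - s..x + s} \<inter> {y - s..y + s} = {}" by auto
    qed
  qed (auto simp: emeasure_lborel_Icc_eq)
  then show ?thesis using assms(2) by simp
qed

text \<open>With l = b - a and k, j in I, the neighbourhoods of scale k have measure of order l/A_k
  and those of scales k < j overlap in O(l/(A_k A_j)). The constants l/32, 4l and 24l give
  (l/32)^2/(28 l) = l/28672, free of \<epsilon> and T.\<close>

lemma limsup_near_good_fractions:
  fixes a b \<epsilon> T :: real and A :: "nat \<Rightarrow> real" and I :: "nat set"
  assumes ab: "a < b"
    and many: "\<forall>\<^sub>F k in sequentially. (b - a) * 64 ^ k / 64 \<le> real (card (good_points \<epsilon> T k a b))"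
    and A: "\<And>k. A k > 2" "mono A" "\<not> summable (\<lambda>k. of_bool (k \<in> I) / A k)"
  obtains L where "L \<in> sets lborel" "L \<subseteq> {a..b}" "(b - a) / 28672 \<le> measure lborel L"
    "\<And>x n. x \<in> L \<Longrightarrow> \<exists>k\<ge>n. k \<in> I \<and> (\<exists>p q. good_fraction \<epsilon> T k p q \<and> \<bar>x - of_int p / real q\<bar> \<le> 1 / (64 ^ k * A k))"
proof -
  define l where "l = b - a"
  have l: "l > 0" using ab by (simp add: l_def)
  define G where "G k = good_points \<epsilon> T k a b" for k
  define s where "s k = 1 / (64 ^ k * A k)" for k
  have Apos: "A k > 0" for k using A(1)[of k] by linarith
  have spos: "s k > 0" for k using Apos by (simp add: s_def)
  have s64: "s k * 64 ^ k = 1 / A k" for k using Apos by (simp add: s_def)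
  \<comment> \<open>Good points of one scale are at least 1/64^k apart, so their intervals are
    disjoint.\<close>
  have sle: "2 * s k < 1 / 64 ^ k" for k using A(1)[of k] by (simp add: s_def field_simps)
  have s1: "s k \<le> 1" for k
  proof -
    have "1 / 64 ^ k \<le> (1::real)" by (simp add: divide_le_eq)
    then show ?thesis using sle[of k] spos[of k] by linarith
  qed
  have smono: "s j \<le> s k" if "k \<le> j" for k j
  proof -
    have "64 ^ k * A k \<le> 64 ^ j * A j"
      using that monoD[OF A(2) that] Apos[of k] by (intro mult_mono power_increasing) auto
    then show ?thesis unfolding s_def using Apos by (intro divide_left_mono) auto
  qed
  have fin: "finite (G k)" for k
    using good_points_card_le(1)[of a b \<epsilon> T k a b] ab by (simp add: G_def good_points_def Int_def conj_ac)
  have sep: "2 * s k < \<bar>x - y\<bar>" if "x \<in> G k" "y \<in> G k" "x \<noteq> y" for x y k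
    using good_points_separated[of x \<epsilon> T k a b y k] that sle[of k]
    by (simp add: G_def power_add flip: power_mult_distrib)
  define N where "N k = (\<Union>x\<in>G k. {x - s k..x + s k})" for k
  have Ns: "N k \<in> sets lborel" for k unfolding N_def using fin by (intro sets.finite_UN) auto
  have Nm: "measure lborel (N k) = 2 * s k * real (card (G k))" for k
    unfolding N_def by (rule measure_separated_intervals) (use fin sep spos in \<open>auto intro: less_imp_le\<close>)
  define E where "E k = (if k \<in> I then N k else {})" for k
  define w where "w k = of_bool (k \<in> I) / A k" for k
  have "(\<lambda>k. 1 / 64 ^ k :: real) \<longlonglongrightarrow> 0" by real_asymp
  then have "\<forall>\<^sub>F k in sequentially. 1 / 64 ^ k < l" using l by (rule order_tendstoD(2))
  with many obtain k0 where k0: "\<And>k. k \<ge> k0 \<Longrightarrow> l * 64 ^ k / 64 \<le> real (card (G k))" "\<And>k. k \<ge> k0 \<Longrightarrow> 1 / 64 ^ k < l"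
    unfolding eventually_sequentially G_def l_def by (metis nle_le order.trans)
  have cardG: "real (card (G k)) \<le> 2 * l * 64 ^ k" if "k \<ge> k0" for k
  proof -
    have "G k \<inter> {a..b} = G k" by (auto simp: G_def good_points_def)
    then have "real (card (G k)) \<le> l * 64 ^ k + 1"
      using good_points_card_le(2)[of a b \<epsilon> T k a b] ab by (simp add: G_def l_def)
    moreover have "1 \<le> l * 64 ^ k" using k0(2)[OF that] by (simp add: field_simps)
    ultimately show ?thesis by linarith
  qed
  have main: "(l / 32)\<^sup>2 / (4 * l + 24 * l) \<le> measure lborel (\<Inter>n. \<Union>k\<in>{n..}. E k)"
  proof (rule measure_limsup_ge[where w=w and u="a - 1" and v="b + 1" and ?k0.0=k0])
    show "E k \<in> sets lborel" for k using Ns by (simp add: E_def)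
    show "E k \<subseteq> {a - 1..b + 1}" for k
    proof
      fix z assume "z \<in> E k"
      then obtain x where "x \<in> G k" "x - s k \<le> z" "z \<le> x + s k" by (auto simp: E_def N_def split: if_splits)
      then show "z \<in> {a - 1..b + 1}" using s1[of k] by (auto simp: G_def good_points_def)
    qed
    show "0 \<le> w k" for k using Apos[of k] by (simp add: w_def)
    show "\<not> summable w" using A(3) by (simp add: w_def[abs_def])
    show "l / 32 * w k \<le> measure lborel (E k)" if "k \<ge> k0" for k
    proof (cases "k \<in> I")
      case True
      have "l / 32 * (1 / A k) = 2 * s k * (l * 64 ^ k / 64)" using s64[of k] by (simp add: field_simps)
      also have "\<dots> \<le> 2 * s k * real (card (G k))" using k0(1)[OF that] spos[of k] by (intro mult_left_mono) auto
      finally show ?thesis using True by (simp add: E_def w_def Nm)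
    qed (simp add: E_def w_def)
    show "measure lborel (E k) \<le> 4 * l * w k" if "k \<ge> k0" for k
    proof (cases "k \<in> I")
      case True
      have "2 * s k * real (card (G k)) \<le> 2 * s k * (2 * l * 64 ^ k)"
        using cardG[OF that] spos[of k] by (intro mult_left_mono) auto
      also have "\<dots> = 4 * l * (s k * 64 ^ k)" by simp
      finally show ?thesis using True by (simp add: E_def w_def Nm s64)
    qed (simp add: E_def w_def)
    show "measure lborel (E k \<inter> E j) \<le> 24 * l * (w k * w j)" if kj: "k \<ge> k0" "k < j" for k j
    proof (cases "k \<in> I \<and> j \<in> I")
      case True
      \<comment> \<open>An interval of scale j can meet the one around x only if the centres differ
        by at most s_k + s_j \<le> 2 s_k.\<close>
      define Y where "Y x = G j \<inter> {x - 2 * s k..x + 2 * s k}" for x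
      have Yfin: "finite (Y x)" for x unfolding Y_def using fin by auto
      have Ycard: "real (card (Y x)) \<le> 6 * s k * 64 ^ j" if x: "x \<in> G k" for x
      proof (cases "Y x = {}")
        case False
        then obtain y where y': "y \<in> G j" "x - 2 * s k \<le> y" "y \<le> x + 2 * s k" by (auto simp: Y_def)
        then have y: "y \<in> G j" "\<bar>x - y\<bar> \<le> 2 * s k" by linarith+
        \<comment> \<open>A single point in the window already forces 1 \<le> 2 s_k 8^(k+j) \<le> 2
          s_k 64^j, which absorbs the +1 of the counting bound. An empty window costs
          nothing.\<close>
        have "1 / 8 ^ (k + j) \<le> \<bar>x - y\<bar>"
          using x y(1) good_points_disjoint[of x \<epsilon> T k a b y j] kj(2)
          by (intro good_points_separated[of x \<epsilon> T k a b y j]) (auto simp: G_def)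
        then have "1 / 8 ^ (k + j) \<le> 2 * s k" using y(2) by linarith
        then have "1 \<le> 2 * s k * 8 ^ (k + j)" by (simp add: field_simps)
        also have "\<dots> \<le> 2 * s k * 64 ^ j"
        proof (rule mult_left_mono)
          have "(8::real) ^ (k + j) \<le> 8 ^ (j + j)" using kj(2) by (intro power_increasing) auto
          also have "\<dots> = 64 ^ j" by (simp add: power_add flip: power_mult_distrib)
          finally show "(8::real) ^ (k + j) \<le> 64 ^ j" .
        qed (use spos[of k] in auto)
        finally have one: "1 \<le> 2 * s k * 64 ^ j" .
        have "real (card (Y x)) \<le> ((x + 2 * s k) - (x - 2 * s k)) * 64 ^ j + 1"
          unfolding Y_def G_def using spos[of k] by (intro good_points_card_le(2)) auto
        then show ?thesis using one by (simp add: algebra_simps)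
      qed (use spos[of k] in auto)
      have sub: "N k \<inter> N j \<subseteq> (\<Union>x\<in>G k. \<Union>y\<in>Y x. {y - s j..y + s j})"
      proof
        fix z assume "z \<in> N k \<inter> N j"
        then obtain x y where xy: "x \<in> G k" "x - s k \<le> z" "z \<le> x + s k" "y \<in> G j" "y - s j \<le> z" "z \<le> y + s j"
          by (auto simp: N_def)
        moreover have "y \<in> Y x" using xy smono[of k j] kj(2) by (auto simp: Y_def)
        ultimately show "z \<in> (\<Union>x\<in>G k. \<Union>y\<in>Y x. {y - s j..y + s j})" by auto
      qed
      have "measure lborel (N k \<inter> N j) \<le> measure lborel (\<Union>x\<in>G k. \<Union>y\<in>Y x. {y - s j..y + s j})"
        using Ns fin Yfin
        by (intro measure_mono_fmeasurable[OF sub] fmeasurable.finite_UN)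
           (auto intro!: fmeasurableI simp: emeasure_lborel_Icc_eq)
      also have "\<dots> \<le> (\<Sum>x\<in>G k. measure lborel (\<Union>y\<in>Y x. {y - s j..y + s j}))"
        using fin Yfin by (intro measure_UNION_le sets.finite_UN) auto
      also have "\<dots> \<le> (\<Sum>x\<in>G k. 12 * s k * (1 / A j))"
      proof (rule sum_mono)
        fix x assume x: "x \<in> G k"
        have "measure lborel (\<Union>y\<in>Y x. {y - s j..y + s j}) \<le> (\<Sum>y\<in>Y x. measure lborel {y - s j..y + s j})"
          using Yfin by (intro measure_UNION_le) auto
        also have "\<dots> = real (card (Y x)) * (2 * s j)" using spos[of j] by simp
        also have "\<dots> \<le> (6 * s k * 64 ^ j) * (2 * s j)"
          using Ycard[OF x] spos[of j] by (intro mult_right_mono) auto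
        also have "\<dots> = 12 * s k * (s j * 64 ^ j)" by simp
        finally show "measure lborel (\<Union>y\<in>Y x. {y - s j..y + s j}) \<le> 12 * s k * (1 / A j)" by (simp add: s64)
      qed
      also have "\<dots> = real (card (G k)) * (12 * s k * (1 / A j))" by simp
      also have "\<dots> \<le> (2 * l * 64 ^ k) * (12 * s k * (1 / A j))"
        using cardG[OF kj(1)] spos[of k] Apos[of j] by (intro mult_right_mono) auto
      also have "\<dots> = 24 * l * ((s k * 64 ^ k) * (1 / A j))" by simp
      finally show ?thesis using True by (simp add: E_def w_def s64)
    next
      case False
      then have "E k \<inter> E j = {}" by (auto simp: E_def)
      then show ?thesis using l Apos[of k] Apos[of j] by (simp add: w_def)
    qed
  qed (use l in auto)
  define L where "L = (\<Inter>n. \<Union>k\<in>{n..}. E k)"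
  have nearL: "\<exists>k\<ge>n. k \<in> I \<and> (\<exists>x\<in>G k. \<bar>z - x\<bar> \<le> s k)" if "z \<in> L" for z n
  proof -
    from that obtain k where "k \<ge> n" "z \<in> E k" unfolding L_def by auto
    then show ?thesis by (auto simp: E_def N_def abs_le_iff split: if_splits intro!: exI[of _ k]) force
  qed
  show thesis
  proof (rule that[of L])
    show "L \<in> sets lborel" unfolding L_def E_def using Ns by auto
    show "(b - a) / 28672 \<le> measure lborel L"
    proof -
      have "(l / 32)\<^sup>2 / (4 * l + 24 * l) = l / 28672" using l by (simp add: power2_eq_square field_simps)
      then show ?thesis using main unfolding L_def[symmetric] l_def by linarith
    qed
    show "\<exists>k\<ge>n. k \<in> I \<and> (\<exists>p q. good_fraction \<epsilon> T k p q \<and> \<bar>z - of_int p / real q\<bar> \<le> 1 / (64 ^ k * A k))" if "z \<in> L" for z n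
      using nearL[OF that, of n] unfolding G_def good_points_def s_def by blast
    show "L \<subseteq> {a..b}"
    proof
      fix z assume z: "z \<in> L"
      have lim: "(\<lambda>k. 1 / 64 ^ k :: real) \<longlonglongrightarrow> 0" by real_asymp
      \<comment> \<open>The neighbourhoods may stick out of [a, b], but their radii tend to 0, so
        points lying in infinitely many of them remain in the closed interval.\<close>
      have close: "a - e \<le> z \<and> z \<le> b + e" if e: "e > 0" for e
      proof -
        obtain n where n: "\<And>k. k \<ge> n \<Longrightarrow> 1 / 64 ^ k < e"
          using order_tendstoD(2)[OF lim e] by (auto simp: eventually_sequentially)
        obtain k x where k: "k \<ge> n" "x \<in> G k" "\<bar>z - x\<bar> \<le> s k" using nearL[OF z, of n] by blast
        have "s k < e" using n[OF k(1)] sle[of k] spos[of k] by linarith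
        moreover have "a \<le> x" "x \<le> b" using k(2) by (auto simp: G_def good_points_def)
        ultimately show ?thesis using k(3) by linarith
      qed
      have "a \<le> z" by (rule field_le_epsilon) (use close in force)
      moreover have "z \<le> b" by (rule field_le_epsilon) (use close in force)
      ultimately show "z \<in> {a..b}" by simp
    qed
  qed
qed


section \<open>Full measure, divergent series, upper density\<close>

text \<open>Let X be the part of the complement of S in a bounded interval. Cover X by
  nonoverlapping intervals of total length at most (1 + c)|X|. X fills at most the proportion 1 - c
  of each, so |X| \<le> (1 - c^2)|X| and X is null.\<close>

lemma AE_if_positive_proportion:
  fixes S :: "real set" and c :: real
  assumes S: "S \<in> sets borel" and c: "0 < c"
    and dense: "\<And>a b. a < b \<Longrightarrow> \<exists>L \<in> sets lborel. L \<subseteq> {a..b} \<inter> S \<and> c * (b - a) \<le> measure lborel L"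
  shows "AE x in lborel. x \<in> S"
proof -
  have leb: "measure lebesgue X = measure lborel X" if "X \<in> sets borel" for X :: "real set"
    using that by (simp add: measure_completion)
  have part: "measure lebesgue (({- real m..real m} - S) \<inter> {u..v}) \<le> (1 - c) * (v - u)" if uv: "u < v" for u v :: real and m :: nat
  proof -
    obtain L where L: "L \<in> sets lborel" "L \<subseteq> {u..v} \<inter> S" "c * (v - u) \<le> measure lborel L"
      using dense[OF uv] by blast
    have fm: "{u..v} \<in> fmeasurable lborel" by (auto intro!: fmeasurableI simp: emeasure_lborel_Icc_eq)
    have Lf: "L \<in> fmeasurable lborel" by (rule fmeasurableI2[OF fm]) (use L in auto)
    have "measure lborel (({- real m..real m} - S) \<inter> {u..v}) \<le> measure lborel ({u..v} - L)"
      by (rule measure_mono_fmeasurable) (use L S fm Lf in \<open>auto intro!: fmeasurable_Diff\<close>)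
    also have "\<dots> = measure lborel {u..v} - measure lborel L"
      by (rule measurable_measure_Diff) (use L fm in auto)
    also have "\<dots> \<le> (v - u) - c * (v - u)" using L(3) uv by simp
    finally have "measure lborel (({- real m..real m} - S) \<inter> {u..v}) \<le> (1 - c) * (v - u)"
      by (simp add: algebra_simps)
    then show ?thesis using S by (subst leb) auto
  qed
  have null: "measure lebesgue ({- real m..real m} - S) = 0" for m :: nat
  proof (rule ccontr)
    define X where "X = {- real m..real m} - S"
    assume "measure lebesgue ({- real m..real m} - S) \<noteq> 0"
    then have pos: "measure lebesgue X > 0" by (simp add: X_def zero_less_measure_iff)
    have Xm: "X \<in> lmeasurable"
      by (rule fmeasurableI2[of "cbox (- real m) (real m)"]) (use S in \<open>auto simp: X_def\<close>)
    have Xsub: "X \<subseteq> cbox (- real m) (real m)" by (auto simp: X_def)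
    have e: "c * measure lebesgue X > 0" using c pos by simp
    obtain \<D> where D: "countable \<D>"
        "\<And>K. K \<in> \<D> \<Longrightarrow> K \<subseteq> cbox (- real m) (real m) \<and> K \<noteq> {} \<and> (\<exists>c d. K = cbox c d)"
        "pairwise (\<lambda>A B. interior A \<inter> interior B = {}) \<D>"
        "\<And>K. \<lbrakk>K \<in> \<D>; box (- real m) (real m) \<noteq> {}\<rbrakk> \<Longrightarrow> interior K \<noteq> {}"
        "X \<subseteq> \<Union>\<D>" "\<Union>\<D> \<in> lmeasurable" "measure lebesgue (\<Union>\<D>) \<le> measure lebesgue X + c * measure lebesgue X"
      by (rule measurable_outer_intervals_bounded[OF Xm Xsub e], rule that; assumption)
    \<comment> \<open>A nonempty open box is what makes the covering intervals nondegenerate; for m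
      = 0 the set is at most a point.\<close>
    have m: "m > 0"
    proof (rule ccontr)
      assume "\<not> m > 0"
      then have "X \<subseteq> {0}" by (auto simp: X_def)
      then have "measure lebesgue X \<le> measure lebesgue {0::real}"
        by (rule measure_mono_fmeasurable) (use Xm in \<open>auto dest: fmeasurableD intro: lmeasurable_compact\<close>)
      then show False using pos by simp
    qed
    have Dne: "\<D> \<noteq> {}" using D(5) pos by auto
    define f where "f = from_nat_into \<D>"
    have rf: "range f = \<D>" unfolding f_def using Dne D(1) by (rule range_from_nat_into)
    have int: "\<exists>u v. u < v \<and> K = {u..v}" if K: "K \<in> \<D>" for K
    proof -
      obtain u v where uv: "K = cbox u v" using D(2)[OF K] by blast
      have "interior K \<noteq> {}" using D(4)[OF K] m by simp
      then have "u < v" unfolding uv by (metis box_real(1) empty_iff equals0I greaterThanLessThan_empty_iff interior_cbox not_le)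
      then show ?thesis using uv by auto
    qed
    \<comment> \<open>The estimate is made for finitely many covering intervals; X is the increasing
      union of its traces on the initial segments of the enumeration \<open>f\<close>.\<close>
    have partial: "measure lebesgue (X \<inter> (\<Union>i<n. f i)) \<le> (1 - c) * measure lebesgue (\<Union>\<D>)" for n
    proof -
      define F where "F = f ` {..<n}"
      have FD: "F \<subseteq> \<D>" using rf by (auto simp: F_def)
      have Fm: "K \<in> lmeasurable" if "K \<in> F" for K using int[of K] FD that by auto
      have XK: "measure lebesgue (X \<inter> K) \<le> (1 - c) * measure lebesgue K" if K: "K \<in> F" for K
      proof -
        obtain u v where uv: "u < v" "K = {u..v}" using int[of K] FD K by auto
        then show ?thesis using part[OF uv(1), of m] by (simp add: X_def)
      qed
      have "X \<inter> (\<Union>i<n. f i) = (\<Union>K\<in>F. X \<inter> K)" by (auto simp: F_def)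
      also have "measure lebesgue \<dots> \<le> (\<Sum>K\<in>F. measure lebesgue (X \<inter> K))"
        by (rule measure_UNION_le) (use Xm Fm in \<open>auto simp: F_def dest: fmeasurableD\<close>)
      also have "\<dots> \<le> (\<Sum>K\<in>F. (1 - c) * measure lebesgue K)" by (rule sum_mono) (rule XK)
      also have "\<dots> = (1 - c) * (\<Sum>K\<in>F. measure lebesgue K)" by (simp add: sum_distrib_left)
      also have "(\<Sum>K\<in>F. measure lebesgue K) = measure lebesgue (\<Union>F)"
      proof (rule measure_negligible_finite_Union[symmetric])
        show "pairwise (\<lambda>S T. negligible (S \<inter> T)) F"
        proof (rule pairwiseI)
          fix K K' assume KK: "K \<in> F" "K' \<in> F" "K \<noteq> K'"
          obtain u v where uv: "u < v" "K = {u..v}" using int[of K] FD KK by auto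
          obtain u' v' where uv': "u' < v'" "K' = {u'..v'}" using int[of K'] FD KK by auto
          have "interior K \<inter> interior K' = {}" using D(3) KK FD by (auto simp: pairwise_def)
          then have "{u<..<v} \<inter> {u'<..<v'} = {}" using uv uv' by (simp add: interior_atLeastAtMost_real)
          then have "K \<inter> K' \<subseteq> {u, v, u', v'}" unfolding uv(2) uv'(2) by force
          then show "negligible (K \<inter> K')" by (meson finite.emptyI finite.insertI finite_subset negligible_finite)
        qed
      qed (use Fm in \<open>auto simp: F_def\<close>)
      also have "(1 - c) * measure lebesgue (\<Union>F) \<le> (1 - c) * measure lebesgue (\<Union>\<D>)"
      proof (rule mult_left_mono)
        show "measure lebesgue (\<Union>F) \<le> measure lebesgue (\<Union>\<D>)"
          using FD Fm D(6) by (intro measure_mono_fmeasurable) (auto simp: F_def dest: fmeasurableD)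
        \<comment> \<open>Applying \<open>part\<close> to [0, 1] bounds a nonnegative measure by 1 -
          c.\<close>
        have "0 \<le> (1 - c) * (1 - 0 :: real)" by (rule order.trans[OF measure_nonneg part[of 0 1 m]]) simp
        then show "0 \<le> 1 - c" by simp
      qed
      finally show ?thesis .
    qed
    have "(\<lambda>n. measure lebesgue (X \<inter> (\<Union>i<n. f i))) \<longlonglongrightarrow> measure lebesgue (\<Union>n. X \<inter> (\<Union>i<n. f i))"
    proof (rule Lim_measure_incseq)
      have fm: "f i \<in> sets lebesgue" for i
      proof -
        have "f i \<in> \<D>" using rf by blast
        then obtain u v where "f i = {u..v}" using int by blast
        then show ?thesis by simp
      qed
      show "range (\<lambda>n. X \<inter> (\<Union>i<n. f i)) \<subseteq> sets lebesgue"
        by (intro image_subsetI sets.Int sets.finite_UN fm fmeasurableD[OF Xm]) auto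
      show "incseq (\<lambda>n. X \<inter> (\<Union>i<n. f i))"
        unfolding incseq_def by (intro allI impI Int_mono UN_mono) auto
      have eq: "(\<Union>n. X \<inter> (\<Union>i<n. f i)) = X" using D(5) unfolding rf[symmetric] by blast
      show "emeasure lebesgue (\<Union>n. X \<inter> (\<Union>i<n. f i)) \<noteq> \<infinity>"
        unfolding eq using Xm by (auto simp: fmeasurable_def)
    qed
    moreover have "(\<Union>n. X \<inter> (\<Union>i<n. f i)) = X" using D(5) unfolding rf[symmetric] by blast
    ultimately have "measure lebesgue X \<le> (1 - c) * measure lebesgue (\<Union>\<D>)"
      using partial by (intro LIMSEQ_le_const2[where X="\<lambda>n. measure lebesgue (X \<inter> (\<Union>i<n. f i))"]) auto
    also have "\<dots> \<le> (1 - c) * (measure lebesgue X + c * measure lebesgue X)"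
    proof (rule mult_left_mono[OF D(7)])
      have "0 \<le> (1 - c) * (1 - 0 :: real)" by (rule order.trans[OF measure_nonneg part[of 0 1 m]]) simp
      then show "0 \<le> 1 - c" by simp
    qed
    also have "\<dots> = measure lebesgue X - c\<^sup>2 * measure lebesgue X" by (simp add: power2_eq_square algebra_simps)
    finally show False using c pos by (simp add: mult_le_0_iff)
  qed
  have "AE x in lborel. \<forall>m::nat. x \<notin> {- real m..real m} - S"
    unfolding AE_all_countable
  proof
    fix m :: nat
    have "{- real m..real m} - S \<in> fmeasurable lborel"
      by (rule fmeasurableI2[of "{- real m..real m}"]) (use S in \<open>auto intro!: fmeasurableI simp: emeasure_lborel_Icc_eq\<close>)
    then have "emeasure lborel ({- real m..real m} - S) = ennreal (measure lborel ({- real m..real m} - S))"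
      by (rule emeasure_eq_measure2)
    also have "\<dots> = 0" using null[of m] leb[of "{- real m..real m} - S"] S by simp
    finally have "{- real m..real m} - S \<in> null_sets lborel" using S by (auto simp: null_sets_def)
    then show "AE x in lborel. x \<notin> {- real m..real m} - S" by (rule AE_not_in)
  qed
  then show ?thesis
  proof eventually_elim
    case (elim x)
    obtain m :: nat where "\<bar>x\<bar> \<le> real m" using real_arch_simple by blast
    then show ?case using elim[rule_format, of m] by auto
  qed
qed

text \<open>If the capped series converged, comparison with the sum of 1/(k+1)^2 on the removed
  indices would give convergence of the sum of 1/\<Psi>. By monotonicity the linear term of the
  maximum could then win only finitely often, so the sum of 1/\<psi>(5(k+1)), and hence the original
  series, would converge.\<close>

lemma not_summable_capped:
  fixes \<psi> :: "real \<Rightarrow> real"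
  assumes pos: "\<And>x. x > 0 \<Longrightarrow> \<psi> x > 0"
    and mono: "\<And>x y. 0 < x \<Longrightarrow> x \<le> y \<Longrightarrow> \<psi> x \<le> \<psi> y"
    and div: "\<not> summable (\<lambda>k::nat. 1 / \<psi> (real (Suc k)))"
  defines "\<Psi> \<equiv> \<lambda>k::nat. max (\<psi> (5 * real (Suc k))) (5 * real (Suc k))"
  shows "\<not> summable (\<lambda>k. of_bool (\<psi> (5 * real (Suc k)) \<le> (real (Suc k))\<^sup>2) / \<Psi> k)"
proof
  let ?g = "\<lambda>k::nat. of_bool (\<psi> (5 * real (Suc k)) \<le> (real (Suc k))\<^sup>2) / \<Psi> k"
  assume sm: "summable ?g"
  have \<Psi>pos: "\<Psi> k > 0" for k by (simp add: \<Psi>_def less_max_iff_disj)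
  have \<Psi>mono: "\<Psi> j \<le> \<Psi> k" if "j \<le> k" for j k
    unfolding \<Psi>_def using that by (intro max.mono mono) auto
  have sq: "summable (\<lambda>k. 1 / (real (Suc k))\<^sup>2)"
    using summable_Suc_iff[of "\<lambda>k. 1 / (real k)\<^sup>2"] inverse_power_summable[of 2, where ?'a=real]
    by (simp add: inverse_eq_divide)
  have s\<Psi>: "summable (\<lambda>k. 1 / \<Psi> k)"
  proof (rule summable_comparison_test'[OF summable_add[OF sm sq]])
    fix k :: nat
    show "norm (1 / \<Psi> k) \<le> ?g k + 1 / (real (Suc k))\<^sup>2"
    proof (cases "\<psi> (5 * real (Suc k)) \<le> (real (Suc k))\<^sup>2")
      case False
      then have "(real (Suc k))\<^sup>2 \<le> \<Psi> k" unfolding \<Psi>_def by linarith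
      then have "1 / \<Psi> k \<le> 1 / (real (Suc k))\<^sup>2" by (intro divide_left_mono mult_pos_pos \<Psi>pos) auto
      then show ?thesis using False \<Psi>pos[of k] by simp
    qed (use \<Psi>pos[of k] in simp)
  qed
  obtain N0 where N0: "\<And>m n. m \<ge> N0 \<Longrightarrow> norm (\<Sum>k\<in>{m..<n}. 1 / \<Psi> k) < 1 / 10"
    using s\<Psi>[unfolded summable_Cauchy, rule_format, of "1 / 10"] by auto
  \<comment> \<open>Otherwise each of the at least (k+1)/2 terms from k div 2 to k is at least
    1/(5(k+1)). Their sum is at least 1/10, against the Cauchy criterion.\<close>
  have large: "5 * real (Suc k) < \<psi> (5 * real (Suc k))" if k: "k \<ge> 2 * N0" for k
  proof (rule ccontr)
    assume "\<not> ?thesis"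
    then have \<Psi>k: "\<Psi> k = 5 * real (Suc k)" by (simp add: \<Psi>_def)
    define m where "m = k div 2"
    have m: "m \<ge> N0" "real m \<le> real k / 2" using k by (auto simp: m_def)
    have "1 / 10 \<le> real (Suc k - m) * (1 / (5 * real (Suc k)))"
    proof -
      have "real (Suc k - m) = real (Suc k) - real m" using m_def by simp
      then have "real (Suc k) / 2 \<le> real (Suc k - m)" using m(2) by simp
      then have "real (Suc k) / 2 * (1 / (5 * real (Suc k))) \<le> real (Suc k - m) * (1 / (5 * real (Suc k)))"
        by (intro mult_right_mono) auto
      moreover have "real (Suc k) / 2 * (1 / (5 * real (Suc k))) = 1 / 10" by (simp add: field_simps)
      ultimately show ?thesis by linarith
    qed
    also have "\<dots> = (\<Sum>j\<in>{m..<Suc k}. 1 / \<Psi> k)" by (simp only: \<Psi>k sum_constant card_atLeastLessThan)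
    also have "\<dots> \<le> (\<Sum>j\<in>{m..<Suc k}. 1 / \<Psi> j)"
      by (intro sum_mono divide_left_mono \<Psi>mono mult_pos_pos \<Psi>pos) auto
    also have "\<dots> \<le> norm (\<Sum>j\<in>{m..<Suc k}. 1 / \<Psi> j)" by simp
    also have "\<dots> < 1 / 10" by (rule N0[OF m(1)])
    finally show False by simp
  qed
  define g where "g k = 1 / \<psi> (5 * real (Suc k))" for k :: nat
  have gpos: "0 \<le> g k" for k unfolding g_def using pos[of "5 * real (Suc k)"] by simp
  have "summable g"
  proof (rule summable_comparison_test'[OF s\<Psi>, of "2 * N0"])
    fix k assume "2 * N0 \<le> k"
    then have "\<Psi> k = \<psi> (5 * real (Suc k))" using large[of k] by (simp add: \<Psi>_def)
    then show "norm (g k) \<le> 1 / \<Psi> k" using gpos[of k] by (simp add: g_def)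
  qed
  define f where "f k = 1 / \<psi> (real (Suc k))" for k :: nat
  have fpos: "0 \<le> f k" for k unfolding f_def using pos[of "real (Suc k)"] by simp
  have "summable f"
  proof (rule bounded_imp_summable)
    show "0 \<le> f k" for k by (rule fpos)
    \<comment> \<open>In groups of five: for 5(m+1) \<le> k < 5(m+2), monotonicity of \<psi> gives f
      k \<le> g m. The first group is kept as a constant.\<close>
    show "(\<Sum>k\<le>n. f k) \<le> (\<Sum>k<5. f k) + 5 * suminf g" for n
    proof -
      have "(\<Sum>k\<le>n. f k) \<le> (\<Sum>k<Suc n * 5. f k)" using fpos by (intro sum_mono2) auto
      also have "\<dots> = (\<Sum>m<Suc n. \<Sum>k\<in>{m * 5..<m * 5 + 5}. f k)" by (rule sum.nat_group[symmetric])
      also have "\<dots> = (\<Sum>k<5. f k) + (\<Sum>m<n. \<Sum>k\<in>{Suc m * 5..<Suc m * 5 + 5}. f k)"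
        by (subst sum.lessThan_Suc_shift) (simp add: lessThan_atLeast0)
      also have "(\<Sum>m<n. \<Sum>k\<in>{Suc m * 5..<Suc m * 5 + 5}. f k) \<le> (\<Sum>m<n. \<Sum>k\<in>{Suc m * 5..<Suc m * 5 + 5}. g m)"
      proof (intro sum_mono)
        fix m k assume k: "k \<in> {Suc m * 5..<Suc m * 5 + 5}"
        then have "5 * Suc m \<le> Suc k" by simp
        then have "real (5 * Suc m) \<le> real (Suc k)" by (simp only: of_nat_le_iff)
        then have "\<psi> (5 * real (Suc m)) \<le> \<psi> (real (Suc k))" by (intro mono) auto
        then show "f k \<le> g m" unfolding f_def g_def
          by (intro divide_left_mono mult_pos_pos pos) auto
      qed
      also have "\<dots> = 5 * (\<Sum>m<n. g m)" by (simp add: sum_distrib_left)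
      also have "\<dots> \<le> 5 * suminf g" using sum_le_suminf[OF \<open>summable g\<close>, of "{..<n}"] gpos by simp
      finally show ?thesis by simp
    qed
  qed
  then show False using div by (simp add: f_def[abs_def])
qed

section \<open>Counting residues and the upper density\<close>

lemma card_residues_le:
  fixes q M :: nat and R :: "nat set"
  assumes "q > 0" "finite R"
  shows "card {N \<in> {1..M}. N mod q \<in> R} \<le> (M div q + 1) * card R"
proof -
  have "card {N \<in> {1..M}. N mod q \<in> R} \<le> card ({..M div q} \<times> R)"
  proof (rule card_inj_on_le)
    show "inj_on (\<lambda>N. (N div q, N mod q)) {N \<in> {1..M}. N mod q \<in> R}"
      by (rule inj_onI) (metis div_mult_mod_eq prod.inject)
    show "(\<lambda>N. (N div q, N mod q)) ` {N \<in> {1..M}. N mod q \<in> R} \<subseteq> {..M div q} \<times> R"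
      by (auto intro: div_le_mono)
  qed (use assms in auto)
  then show ?thesis by (simp add: card_cartesian_product)
qed

lemma upper_density_measurable:
  fixes c :: "nat \<Rightarrow> real"
  shows "(\<lambda>x. upper_density {N. N \<ge> 2 \<and> sudler N x \<le> c N}) \<in> borel_measurable borel"
proof -
  have eq: "real (card ({N. N \<ge> 2 \<and> sudler N x \<le> c N} \<inter> {1..M})) = (\<Sum>N\<in>{1..M}. if N \<ge> 2 \<and> sudler N x \<le> c N then 1 else 0)" for x M
  proof -
    have "{N. N \<ge> 2 \<and> sudler N x \<le> c N} \<inter> {1..M} = {N \<in> {1..M}. N \<ge> 2 \<and> sudler N x \<le> c N}" by auto
    moreover have "(\<Sum>N\<in>{1..M}. if N \<ge> 2 \<and> sudler N x \<le> c N then 1 else 0) = (\<Sum>N\<in>{N \<in> {1..M}. N \<ge> 2 \<and> sudler N x \<le> c N}. 1::real)"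
      by (rule sum.inter_filter[symmetric]) simp
    ultimately show ?thesis by (simp only: real_of_card)
  qed
  have [measurable]: "sudler N \<in> borel_measurable borel" for N
    unfolding sudler_def[abs_def] by measurable
  show ?thesis unfolding upper_density_def eq by measurable
qed

lemma upper_density_le_1: "upper_density A \<le> 1"
  unfolding upper_density_def
proof (rule Limsup_bounded)
  show "\<forall>\<^sub>F M in sequentially. ereal (real (card (A \<inter> {1..M})) / real M) \<le> 1"
  proof (rule eventually_sequentiallyI)
    fix M :: nat
    have "card (A \<inter> {1..M}) \<le> card {1..M}" by (intro card_mono) auto
    then show "ereal (real (card (A \<inter> {1..M})) / real M) \<le> 1" by (simp add: divide_le_eq)
  qed
qed

lemma upper_density_geI:
  assumes "\<And>n. \<exists>M\<ge>n. M > 0 \<and> c * real M \<le> real (card (A \<inter> {1..M}))"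
  shows "ereal c \<le> upper_density A"
  unfolding upper_density_def
proof (rule ccontr)
  assume "\<not> ereal c \<le> limsup (\<lambda>M. ereal (real (card (A \<inter> {1..M})) / real M))"
  then have "limsup (\<lambda>M. ereal (real (card (A \<inter> {1..M})) / real M)) < ereal c" by simp
  from Limsup_lessD[OF this] obtain n where
    n: "\<And>M. M \<ge> n \<Longrightarrow> ereal (real (card (A \<inter> {1..M})) / real M) < ereal c"
    by (auto simp: eventually_sequentially)
  obtain M where M: "M \<ge> n" "M > 0" "c * real M \<le> real (card (A \<inter> {1..M}))" using assms by blast
  then have "c \<le> real (card (A \<inter> {1..M})) / real M" by (simp add: le_divide_eq)
  with n[OF M(1)] show False by simp
qed


section \<open>Upper density near good fractions\<close>

lemma sudler_nonneg: "0 \<le> sudler N x"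
  unfolding sudler_def by (intro prod_nonneg) simp

text \<open>The b complete blocks gain 2^(-b) \<le> exp(-b/2), with b at least about \<epsilon> A/32
  by the lower bound on N. The incomplete block loses at most exp(T k) e q \<le> exp((T + 4) k). The
  hypothesis on Y is the balance of the two.\<close>

lemma sudler_small_near_good_fraction:
  fixes \<epsilon> T A x Y :: real and p :: int and q k N :: nat
  assumes good: "good_fraction \<epsilon> T k p q" and \<epsilon>: "0 < \<epsilon>" "\<epsilon> \<le> 1" and k: "k \<ge> 1"
    and near: "\<bar>x - of_int p / real q\<bar> \<le> 1 / (64 ^ k * A)"
    and A: "20 * real k \<le> A" and Y: "Y + 1 + (T + 4) * real k \<le> \<epsilon> * A / 64"
    and N: "real N \<le> real q * A / 32" "\<epsilon> * (real q * A / 32 - 1) \<le> real N"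
    and r: "sudler (N mod q) (of_int p / real q) \<le> exp (T * real k)"
  shows "sudler N x \<le> exp (- Y)"
proof -
  have cop: "coprime p (int q)" and q: "0 < q" "q \<le> 8 ^ k" using good by (auto simp: good_fraction_def)
  have q8: "real q \<le> 8 ^ k" using q(2) by (metis of_nat_le_iff of_nat_numeral of_nat_power)
  have lnq: "1 + ln (real q) \<le> 4 * real k"
  proof -
    have "ln (real q) \<le> ln (real (8 ^ k))" using q by (subst ln_le_cancel_iff) auto
    then show ?thesis using one_plus_ln_8_power[OF k] by linarith
  qed
  have A0: "A > 0" using A k by (smt (verit) of_nat_1 of_nat_le_iff)
  interpret near_fraction p q x A
  proof
    show "coprime p (int q)" "q > 0" by (fact cop q)+
    have "5 * (1 + ln (real q)) \<le> 5 * (4 * real k)" using lnq by (intro mult_left_mono) auto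
    then show "5 * (1 + ln (real q)) \<le> A" using A by simp
    have "(real q)\<^sup>2 \<le> 64 ^ k"
    proof -
      have "(real q)\<^sup>2 \<le> (8 ^ k)\<^sup>2" using q8 by (intro power_mono) auto
      also have "\<dots> = (64::real) ^ k" by (simp add: power2_eq_square flip: power_mult_distrib)
      finally show ?thesis .
    qed
    then have "1 / (64 ^ k * A) \<le> 1 / ((real q)\<^sup>2 * A)"
      using A0 q by (intro divide_left_mono mult_right_mono mult_pos_pos) auto
    then show "\<bar>x - of_int p / real q\<bar> \<le> 1 / ((real q)\<^sup>2 * A)" using near by linarith
  qed
  define b where "b = N div q"
  define r where "r = N mod q"
  have Neq: "N = b * q + r" and rq: "r < q" using q by (auto simp: b_def r_def)
  have "sudler N x \<le> (1 / 2) ^ b * (sudler r (of_int p / real q) * (exp 1 * real q))"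
    using sudler_le[OF rq, of b] N(1) by (simp add: Neq)
  also have "\<dots> \<le> exp (- (real b / 2)) * (exp (T * real k) * (exp 1 * exp (4 * real k - 1)))"
  proof (intro mult_mono)
    have half: "(1 / 2 :: real) = exp (- ln 2)" by (simp add: exp_minus)
    have "(1 / 2 :: real) ^ b = exp (- (real b * ln 2))"
      unfolding half by (simp flip: exp_of_nat_mult)
    also have "\<dots> \<le> exp (- (real b / 2))"
    proof -
      have "real b * (1 / 2) \<le> real b * ln 2" using ln2_ge_two_thirds by (intro mult_left_mono) auto
      then show ?thesis by simp
    qed
    finally show "(1 / 2 :: real) ^ b \<le> exp (- (real b / 2))" .
    show "sudler r (of_int p / real q) \<le> exp (T * real k)" using assms(10) by (simp add: r_def)
    have "real q = exp (ln (real q))" using q by simp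
    also have "\<dots> \<le> exp (4 * real k - 1)" using lnq by simp
    finally show "real q \<le> exp (4 * real k - 1)" .
  qed (auto simp: sudler_nonneg)
  also have "\<dots> = exp (- (real b / 2) + (T + 4) * real k)"
    by (simp add: algebra_simps flip: exp_add)
  also have "\<dots> \<le> exp (- Y)"
  proof -
    have "real N < (real b + 1) * real q"
    proof -
      have "N < (b + 1) * q" using Neq rq by simp
      then have "real N < real ((b + 1) * q)" by (simp only: of_nat_less_iff)
      then show ?thesis by (simp add: algebra_simps)
    qed
    with N(2) have "\<epsilon> * (real q * A / 32 - 1) < (real b + 1) * real q" by linarith
    moreover have "\<epsilon> * (real q * A / 32 - 1) \<ge> (\<epsilon> * A / 32 - 1) * real q"
    proof -
      have "\<epsilon> \<le> real q" using \<epsilon> q by (smt (verit) of_nat_1 of_nat_le_iff less_eq_Suc_le One_nat_def)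
      then show ?thesis by (simp add: algebra_simps)
    qed
    ultimately have "(\<epsilon> * A / 32 - 1) * real q < (real b + 1) * real q" by linarith
    then have "\<epsilon> * A / 32 - 1 < real b + 1" using q by simp
    then have "\<epsilon> * A / 64 - 1 < real b / 2" by linarith
    then show ?thesis unfolding exp_le_cancel_iff using Y by linarith
  qed
  finally show ?thesis .
qed

text \<open>Two kinds of N \<le> M are discarded: at most \<epsilon> M with N \<le> \<epsilon> M,
  which contain too few blocks, and at most 2 \<epsilon> M with a bad residue, since (M/q + 1)
  \<epsilon> q \<le> 2 \<epsilon> M. For the others ln N \<le> Z, so the bound with \<psi>(Z)
  suffices.\<close>

lemma density_near_good_fraction:
  fixes \<epsilon> T A x Z :: real and \<psi> :: "real \<Rightarrow> real" and p :: int and q k :: nat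
  assumes mono: "\<And>x y. 0 < x \<Longrightarrow> x \<le> y \<Longrightarrow> \<psi> x \<le> \<psi> y"
    and good: "good_fraction \<epsilon> T k p q" and \<epsilon>: "0 < \<epsilon>" "\<epsilon> \<le> 1" and k: "k \<ge> 1"
    and near: "\<bar>x - of_int p / real q\<bar> \<le> 1 / (64 ^ k * A)"
    and A: "20 * real k \<le> A" "128 / \<epsilon> \<le> A" and Y: "\<psi> Z + 1 + (T + 4) * real k \<le> \<epsilon> * A / 64"
    and Z: "8 ^ k * A \<le> exp Z"
  defines "M \<equiv> nat \<lfloor>real q * A / 32\<rfloor>"
  shows "(1 - 3 * \<epsilon>) * real M \<le> real (card ({N. N \<ge> 2 \<and> sudler N x \<le> exp (- \<psi> (ln (real N)))} \<inter> {1..M}))"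
    and "q \<le> M"
proof -
  let ?S = "{N. N \<ge> 2 \<and> sudler N x \<le> exp (- \<psi> (ln (real N)))}"
  define R where "R = {r. r < q \<and> exp (T * real k) < sudler r (of_int p / real q)}"
  have q: "0 < q" "q \<le> 8 ^ k" and R: "real (card R) \<le> \<epsilon> * real q" "finite R"
    using good by (auto simp: good_fraction_def R_def)
  have q8: "real q \<le> 8 ^ k" using q(2) by (metis of_nat_le_iff of_nat_numeral of_nat_power)
  have q1: "real q \<ge> 1" using q by simp
  have "128 * 1 \<le> 128 / \<epsilon>" using \<epsilon> by (simp add: le_divide_eq)
  then have A128: "128 \<le> A" using A(2) by linarith
  have qA: "real q * 128 \<le> real q * A" using A128 by (intro mult_left_mono) auto
  have M: "real M \<le> real q * A / 32" "real q * A / 32 < real M + 1"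
  proof -
    have "0 \<le> real q * A / 32" using A128 by simp
    then have "real M = of_int \<lfloor>real q * A / 32\<rfloor>" by (simp add: M_def)
    then show "real M \<le> real q * A / 32" "real q * A / 32 < real M + 1" by linarith+
  qed
  have "4 * real q < real M + 1" using M(2) qA by linarith
  then have "real q \<le> real M" using q1 by linarith
  then show qM: "q \<le> M" by simp
  \<comment> \<open>Hence N > \<epsilon> M implies N \<ge> 2, so that ln N is positive and
    monotonicity of \<psi> applies.\<close>
  have eM: "1 \<le> \<epsilon> * real M"
  proof -
    have "128 \<le> \<epsilon> * A" using A(2) \<epsilon> by (simp add: divide_le_eq mult.commute)
    moreover have "A \<le> real q * A" using q1 A128 by simp
    then have "A / 32 - 1 < real M" using M(2) by linarith
    then have "\<epsilon> * (A / 32 - 1) \<le> \<epsilon> * real M" using \<epsilon> by (intro mult_left_mono) auto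
    ultimately show ?thesis using \<epsilon> by (simp add: algebra_simps)
  qed
  define B1 where "B1 = {N \<in> {1..M}. real N \<le> \<epsilon> * real M}"
  define B2 where "B2 = {N \<in> {1..M}. N mod q \<in> R}"
  have sub: "{1..M} \<subseteq> (?S \<inter> {1..M}) \<union> (B1 \<union> B2)"
  proof
    fix N assume N: "N \<in> {1..M}"
    show "N \<in> (?S \<inter> {1..M}) \<union> (B1 \<union> B2)"
    proof (cases "N \<in> B1 \<union> B2")
      case False
      then have big: "\<epsilon> * real M < real N" and notR: "N mod q \<notin> R" using N by (auto simp: B1_def B2_def)
      have N2: "N \<ge> 2" using big eM by linarith
      have NM: "real N \<le> real q * A / 32" using M(1) N by (meson atLeastAtMost_iff of_nat_le_iff order.trans)
      have low: "\<epsilon> * (real q * A / 32 - 1) \<le> real N"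
      proof -
        have "\<epsilon> * (real q * A / 32 - 1) \<le> \<epsilon> * real M" using M(2) \<epsilon> by (intro mult_left_mono) auto
        then show ?thesis using big by linarith
      qed
      have "sudler (N mod q) (of_int p / real q) \<le> exp (T * real k)"
        using notR q by (auto simp: R_def)
      from sudler_small_near_good_fraction[OF good \<epsilon> k near A(1) Y NM low this]
      have "sudler N x \<le> exp (- \<psi> Z)" .
      moreover have "\<psi> (ln (real N)) \<le> \<psi> Z"
      proof (rule mono)
        show "0 < ln (real N)" using N2 by simp
        have "real q * A / 32 \<le> 8 ^ k * A"
        proof -
          have "real q * A \<le> 8 ^ k * A" using q8 A128 by (intro mult_right_mono) auto
          moreover have "0 \<le> real q * A" using A128 by simp
          ultimately show ?thesis by linarith
        qed
        then have "real N \<le> exp Z" using NM Z by linarith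
        then have "ln (real N) \<le> ln (exp Z)" using N2 by (intro ln_mono) auto
        then show "ln (real N) \<le> Z" by simp
      qed
      ultimately have "N \<in> ?S" using N2 by (auto intro: order.trans)
      then show ?thesis using N by simp
    qed auto
  qed
  have cB1: "real (card B1) \<le> \<epsilon> * real M"
  proof -
    have "B1 \<subseteq> {1..nat \<lfloor>\<epsilon> * real M\<rfloor>}" by (auto simp: B1_def le_nat_floor)
    then have "card B1 \<le> card {1..nat \<lfloor>\<epsilon> * real M\<rfloor>}" by (intro card_mono) auto
    then have "real (card B1) \<le> real (nat \<lfloor>\<epsilon> * real M\<rfloor>)" by simp
    also have "\<dots> \<le> \<epsilon> * real M" using \<epsilon> by simp
    finally show ?thesis .
  qed
  have cB2: "real (card B2) \<le> 2 * (\<epsilon> * real M)"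
  proof -
    have "card B2 \<le> (M div q + 1) * card R" unfolding B2_def by (rule card_residues_le[OF q(1) R(2)])
    then have "real (card B2) \<le> real ((M div q + 1) * card R)" by (simp only: of_nat_le_iff)
    also have "\<dots> = (real (M div q) + 1) * real (card R)" by (simp add: algebra_simps)
    also have "\<dots> \<le> (real M / real q + 1) * (\<epsilon> * real q)"
      using R(1) of_nat_div_le_of_nat[of M q, where ?'a=real] by (intro mult_mono add_right_mono) auto
    also have "\<dots> = \<epsilon> * real M + \<epsilon> * real q" using q by (simp add: field_simps)
    also have "\<epsilon> * real q \<le> \<epsilon> * real M" using qM \<epsilon> by (intro mult_left_mono) auto
    finally show ?thesis by simp
  qed
  have "card {1..M} \<le> card ((?S \<inter> {1..M}) \<union> (B1 \<union> B2))"
    by (rule card_mono[OF _ sub]) (auto simp: B1_def B2_def)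
  also have "\<dots> \<le> card (?S \<inter> {1..M}) + (card B1 + card B2)"
    using card_Un_le[of "?S \<inter> {1..M}" "B1 \<union> B2"] card_Un_le[of B1 B2] by linarith
  finally have "real M \<le> real (card (?S \<inter> {1..M})) + (real (card B1) + real (card B2))" by simp
  then have "real M \<le> real (card (?S \<inter> {1..M})) + 3 * (\<epsilon> * real M)" using cB1 cB2 by linarith
  then show "(1 - 3 * \<epsilon>) * real M \<le> real (card (?S \<inter> {1..M}))" by (simp add: algebra_simps)
qed

text \<open>T comes from \<open>many_good_points\<close> and may depend on the interval, but it
  enters only through the constant factor C of A. This affects neither the divergence nor the
  proportion 1/28672.\<close>

lemma positive_proportion_large_upper_density:
  fixes \<psi> :: "real \<Rightarrow> real" and \<epsilon> a b :: real
  assumes pos: "\<And>x. x > 0 \<Longrightarrow> \<psi> x > 0"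
    and mono: "\<And>x y. 0 < x \<Longrightarrow> x \<le> y \<Longrightarrow> \<psi> x \<le> \<psi> y"
    and div: "\<not> summable (\<lambda>k::nat. 1 / \<psi> (real (Suc k)))"
    and \<epsilon>: "0 < \<epsilon>" "\<epsilon> \<le> 1" and ab: "a < b"
  shows "\<exists>L \<in> sets lborel. L \<subseteq> {a..b} \<inter> {x. ereal (1 - 3 * \<epsilon>) \<le> upper_density {N. N \<ge> 2 \<and> sudler N x \<le> exp (- \<psi> (ln (real N)))}}
     \<and> 1 / 28672 * (b - a) \<le> measure lborel L"
proof -
  obtain T where T: "T \<ge> 0"
    "\<forall>\<^sub>F k in sequentially. (b - a) * 64 ^ k / 64 \<le> real (card (good_points \<epsilon> T k a b))"
    using many_good_points[OF ab \<epsilon>(1)] by blast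
  define \<Psi> where "\<Psi> k = max (\<psi> (5 * real (Suc k))) (5 * real (Suc k))" for k :: nat
  \<comment> \<open>On these scales A grows at most quadratically, which controls log N;
    \<open>not_summable_capped\<close> keeps the series divergent.\<close>
  define I where "I = {k::nat. \<psi> (5 * real (Suc k)) \<le> (real (Suc k))\<^sup>2}"
  \<comment> \<open>Makes \<epsilon> A_k/64 equal to (T + 6) \<Psi>_k, enough for \<psi>(5(k+1)),
    the 1 and (T + 4) k together.\<close>
  define C where "C = 64 * (T + 6) / \<epsilon>"
  define A where "A k = C * \<Psi> k" for k
  have "64 * 6 \<le> 64 * (T + 6) / \<epsilon>"
  proof -
    have "64 * 6 * \<epsilon> \<le> 64 * 6 * 1" using \<epsilon> by (intro mult_left_mono) auto
    also have "\<dots> \<le> 64 * (T + 6)" using T by simp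
    finally show ?thesis using \<epsilon> by (simp add: le_divide_eq)
  qed
  then have C: "C \<ge> 384" by (simp add: C_def)
  have \<Psi>5: "5 * real (Suc k) \<le> \<Psi> k" for k by (simp add: \<Psi>_def)
  have \<Psi>mono: "\<Psi> j \<le> \<Psi> k" if "j \<le> k" for j k
    unfolding \<Psi>_def using that by (intro max.mono mono) auto
  have AC: "384 * \<Psi> k \<le> A k" for k unfolding A_def using C \<Psi>5[of k] by (intro mult_right_mono) auto
  have nsum: "\<not> summable (\<lambda>k. of_bool (k \<in> I) / A k)"
  proof
    assume "summable (\<lambda>k. of_bool (k \<in> I) / A k)"
    then have "summable (\<lambda>k. C * (of_bool (k \<in> I) / A k))" by (rule summable_mult)
    moreover have "C * (of_bool (k \<in> I) / A k) = of_bool (k \<in> I) / \<Psi> k" for k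
      using C by (simp add: A_def)
    ultimately have "summable (\<lambda>k. of_bool (k \<in> I) / \<Psi> k)" by simp
    then show False using not_summable_capped[of \<psi>, OF pos mono div] by (simp add: I_def \<Psi>_def)
  qed
  have "A k > 2" for k using AC[of k] \<Psi>5[of k] by (smt (verit) of_nat_0_le_iff of_nat_Suc)
  moreover have "mono A" unfolding A_def using C \<Psi>mono by (intro monoI mult_left_mono) auto
  ultimately obtain L where L: "L \<in> sets lborel" "L \<subseteq> {a..b}" "(b - a) / 28672 \<le> measure lborel L"
    "\<And>x n. x \<in> L \<Longrightarrow> \<exists>k\<ge>n. k \<in> I \<and> (\<exists>p q. good_fraction \<epsilon> T k p q \<and> \<bar>x - of_int p / real q\<bar> \<le> 1 / (64 ^ k * A k))"
    using limsup_near_good_fractions[OF ab T(2) _ _ nsum] by blast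
  have "(\<lambda>k. 8 ^ k * (C * (5 * (real (Suc k))\<^sup>2)) / 32 ^ Suc k) \<longlonglongrightarrow> 0" by real_asymp
  then have "\<forall>\<^sub>F k in sequentially. 8 ^ k * (C * (5 * (real (Suc k))\<^sup>2)) / 32 ^ Suc k < 1"
    by (rule order_tendstoD) simp
  moreover have "\<forall>\<^sub>F k in sequentially. 128 / \<epsilon> \<le> real k" by real_asymp
  ultimately have "\<forall>\<^sub>F k in sequentially. 8 ^ k * (C * (5 * (real (Suc k))\<^sup>2)) / 32 ^ Suc k < 1 \<and> 128 / \<epsilon> \<le> real k"
    by (rule eventually_conj)
  then obtain n0 where n0: "\<And>k. k \<ge> n0 \<Longrightarrow> 8 ^ k * (C * (5 * (real (Suc k))\<^sup>2)) / 32 ^ Suc k < 1"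
     "\<And>k. k \<ge> n0 \<Longrightarrow> 128 / \<epsilon> \<le> real k"
    unfolding eventually_sequentially by blast
  have "ereal (1 - 3 * \<epsilon>) \<le> upper_density {N. N \<ge> 2 \<and> sudler N x \<le> exp (- \<psi> (ln (real N)))}" if x: "x \<in> L" for x
  proof (rule upper_density_geI)
    fix n :: nat
    obtain k p q where k: "k \<ge> n0 + n + 1" "k \<in> I" "good_fraction \<epsilon> T k p q" "\<bar>x - of_int p / real q\<bar> \<le> 1 / (64 ^ k * A k)"
      using L(4)[OF x, of "n0 + n + 1"] by blast
    have k1: "k \<ge> 1" "k \<ge> n0" using k(1) by auto
    define M where "M = nat \<lfloor>real q * A k / 32\<rfloor>"
    have kA: "5 * real (Suc k) \<le> \<Psi> k" "384 * \<Psi> k \<le> A k" by (rule \<Psi>5, rule AC)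
    have A1: "20 * real k \<le> A k" using kA by simp
    have A2: "128 / \<epsilon> \<le> A k" using kA n0(2)[OF k1(2)] by simp
    have Y: "\<psi> (5 * real (Suc k)) + 1 + (T + 4) * real k \<le> \<epsilon> * A k / 64"
    proof -
      have "\<epsilon> * A k / 64 = (T + 6) * \<Psi> k" using \<epsilon> by (simp add: A_def C_def)
      also have "\<dots> = \<Psi> k + \<Psi> k + (T + 4) * \<Psi> k" by (simp add: algebra_simps)
      finally have "\<epsilon> * A k / 64 = \<Psi> k + \<Psi> k + (T + 4) * \<Psi> k" .
      moreover have "(T + 4) * real k \<le> (T + 4) * \<Psi> k" using T kA(1) by (intro mult_left_mono) auto
      moreover have "1 \<le> \<Psi> k" using kA(1) by simp
      moreover have "\<psi> (5 * real (Suc k)) \<le> \<Psi> k" by (simp add: \<Psi>_def)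
      ultimately show ?thesis by linarith
    qed
    \<comment> \<open>The origin of the number 5: 8^k times a quadratic is eventually below 32^(k+1)
      = 2^(5(k+1)), hence below e^(5(k+1)).\<close>
    have Z: "8 ^ k * A k \<le> exp (5 * real (Suc k))"
    proof -
      have "\<Psi> k \<le> 5 * (real (Suc k))\<^sup>2"
      proof -
        have "real (Suc k) * 1 \<le> real (Suc k) * real (Suc k)" by (intro mult_left_mono) auto
        then have "5 * real (Suc k) \<le> 5 * (real (Suc k))\<^sup>2" unfolding power2_eq_square by linarith
        moreover have "\<psi> (5 * real (Suc k)) \<le> (real (Suc k))\<^sup>2" using k(2) by (simp add: I_def)
        moreover have "0 \<le> (real (Suc k))\<^sup>2" by simp
        ultimately show ?thesis unfolding \<Psi>_def by (intro max.boundedI) linarith+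
      qed
      then have "8 ^ k * A k \<le> 8 ^ k * (C * (5 * (real (Suc k))\<^sup>2))"
        unfolding A_def using C by (intro mult_left_mono) auto
      also have "\<dots> \<le> 32 ^ Suc k" using n0(1)[OF k1(2)] by (simp add: divide_less_eq)
      also have "\<dots> = (2 ^ 5) ^ Suc k" by simp
      also have "\<dots> \<le> (exp 1 ^ 5) ^ Suc k"
        using exp_ge_add_one_self[of 1] by (intro power_mono) auto
      also have "\<dots> = exp (5 * real (Suc k))"
        by (simp only: power_mult[symmetric] exp_of_nat_mult[symmetric]) simp
      finally show ?thesis .
    qed
    note dens = density_near_good_fraction[where \<psi>=\<psi>, OF mono k(3) \<epsilon> k1(1) k(4) A1 A2 Y Z, folded M_def]
    have "n < 8 ^ (k - 1)"
    proof -
      have "n \<le> k - 1" using k(1) by simp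
      also have "k - 1 < 8 ^ (k - 1)" by (rule power_gt_expt) simp
      finally show ?thesis .
    qed
    also have "\<dots> < q" using k(3) by (simp add: good_fraction_def)
    also have "q \<le> M" by (rule dens(2))
    finally have "n < M" .
    then show "\<exists>M\<ge>n. M > 0 \<and> (1 - 3 * \<epsilon>) * real M \<le> real (card ({N. N \<ge> 2 \<and> sudler N x \<le> exp (- \<psi> (ln (real N)))} \<inter> {1..M}))"
      using dens(1) by (intro exI[of _ M]) auto
  qed
  then show ?thesis using L by (intro bexI[of _ L]) auto
qed

text \<open>The exponential form of the inequality also covers a vanishing product, where the
  logarithm would be minus infinity. Requiring N \<ge> 2 puts ln N into the domain of \<psi> and
  leaves the upper density unchanged.\<close>

theorem theorem1:
  fixes \<psi> :: "real \<Rightarrow> real"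
  assumes pos: "\<And>x. x > 0 \<Longrightarrow> \<psi> x > 0"
    and mono: "\<And>x y. 0 < x \<Longrightarrow> x \<le> y \<Longrightarrow> \<psi> x \<le> \<psi> y"
    and div: "\<not> summable (\<lambda>k::nat. 1 / \<psi> (real (Suc k)))"
  shows "AE \<alpha> in lborel.
           upper_density {N. N \<ge> 2 \<and> sudler N \<alpha> \<le> exp (- \<psi> (ln (real N)))} = 1"
proof -
  let ?u = "\<lambda>x. upper_density {N. N \<ge> 2 \<and> sudler N x \<le> exp (- \<psi> (ln (real N)))}"
  have [measurable]: "?u \<in> borel_measurable borel" by (rule upper_density_measurable)
  \<comment> \<open>Taking \<epsilon> = 1/(m+1) leaves countably many null sets; m to infinity gives
    density 1.\<close>
  have "AE x in lborel. \<forall>m::nat. ereal (1 - 3 * (1 / real (Suc m))) \<le> ?u x"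
    unfolding AE_all_countable
  proof
    fix m :: nat
    let ?S = "{x. ereal (1 - 3 * (1 / real (Suc m))) \<le> ?u x}"
    have "?S \<in> sets borel" by measurable
    moreover have "\<exists>L \<in> sets lborel. L \<subseteq> {a..b} \<inter> ?S \<and> 1 / 28672 * (b - a) \<le> measure lborel L" if "a < b" for a b
      by (rule positive_proportion_large_upper_density[OF pos mono div _ _ that]) auto
    ultimately have "AE x in lborel. x \<in> ?S"
      by (intro AE_if_positive_proportion[of _ "1 / 28672"]) auto
    then show "AE x in lborel. ereal (1 - 3 * (1 / real (Suc m))) \<le> ?u x" by simp
  qed
  then show ?thesis
  proof eventually_elim
    case (elim x)
    have "(\<lambda>m. ereal (1 - 3 * (1 / real (Suc m)))) \<longlonglongrightarrow> ereal 1"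
      unfolding lim_ereal by real_asymp
    then have "ereal 1 \<le> ?u x"
      by (rule LIMSEQ_le_const2) (use elim in auto)
    then show ?case using upper_density_le_1 by (intro antisym) (auto simp: one_ereal_def)
  qed
qed

end
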